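(* The following affirmations are equivalent: (1) For every finite union of intervals with rational endpoints $\Omega=\bigcup_{i=1}^n(\alpha_i,\beta_i)$ with $|\Omega|=1$, if $\Omega$ has a spectrum $\Lambda$ with period $p$, then $\Omega$ tiles $\mathbb{R}$ by a subset $\mathcal{T}$ of $\frac1p\mathbb{Z}$. (2) For every finite union of intervals with integer endpoints $\Omega=\bigcup_{i=1}^n(\alpha_i,\beta_i)$, $|\Omega|=N$, if $\Omega$ has a spectrum $\Lambda$ with minimal period $\frac rN$, $r\in\mathbb{Z}$, then $\frac Nr$ is an integer and $\Omega$ tiles $\mathbb{R}$ with a subset $\mathcal{T}$ of $\frac Nr\mathbb{Z}$. (3) Every bounded Lebesgue measurable spectral set $\Omega\subset\mathbb{R}$ (of positive measure) tiles $\mathbb{R}$ by translations.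
   Context: $|\Omega|$ denotes Lebesgue measure. For $\lambda\in\mathbb{R}$, $e_\lambda(x):=e^{2\pi i\lambda x}$, $x\in\mathbb{R}$. A Lebesgue measurable set $\Omega\subset\mathbb{R}$ of finite (positive) Lebesgue measure is spectral if there exists $\Lambda\subset\mathbb{R}$ such that $\{e_\lambda:\lambda\in\Lambda\}$ (restricted to $\Omega$) is an orthogonal basis for $L^2(\Omega)$; then $\Lambda$ is called a spectrum for $\Omega$. $\Omega$ tiles $\mathbb{R}$ by (with) $\mathcal{T}\subset\mathbb{R}$ if $\{\Omega+t:t\in\mathcal{T}\}$ is a partition of $\mathbb{R}$ up to Lebesgue measure zero; $\Omega$ tiles $\mathbb{R}$ by translations if such a $\mathcal{T}$ exists. A spectrum $\Lambda$ has period $p\neq0$ if $\Lambda+p=\Lambda$. It is known that every spectrum $\Lambda$ of a spectral set $\Omega$ has a period, and that every period is an integer multiple of $1/|\Omega|$. Periods are taken positive; the minimal period is the smallest positive period. *)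

theory Defs
  imports "HOL-Analysis.Analysis"
begin

definition exp_char :: "real \<Rightarrow> real \<Rightarrow> complex"
  where "exp_char l x = exp (2 * of_real pi * \<i> * of_real l * of_real x)"

text \<open>
  Elements of $L^2(\Omega)$ are represented by functions rather than by classes modulo
  a.e. equality; values outside the set are irrelevant.
\<close>

definition L2_fun :: "real set \<Rightarrow> (real \<Rightarrow> complex) set"
  where "L2_fun \<Omega> = {f. f \<in> borel_measurable (lebesgue_on \<Omega>) \<and>
                        integrable (lebesgue_on \<Omega>) (\<lambda>x. (cmod (f x))\<^sup>2)}"

definition L2_inner :: "real set \<Rightarrow> (real \<Rightarrow> complex) \<Rightarrow> (real \<Rightarrow> complex) \<Rightarrow> complex"
  where "L2_inner \<Omega> f g = (LINT x|lebesgue_on \<Omega>. f x * cnj (g x))"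

definition L2_norm :: "real set \<Rightarrow> (real \<Rightarrow> complex) \<Rightarrow> real"
  where "L2_norm \<Omega> f = sqrt (LINT x|lebesgue_on \<Omega>. (cmod (f x))\<^sup>2)"

text \<open>
  Nonzero, pairwise orthogonal vectors whose finite linear combinations are dense in
  $L^2(\Omega)$.
\<close>

definition L2_orthogonal_basis :: "real set \<Rightarrow> 'i set \<Rightarrow> ('i \<Rightarrow> real \<Rightarrow> complex) \<Rightarrow> bool"
  where "L2_orthogonal_basis \<Omega> I u \<longleftrightarrow>
    (\<forall>i\<in>I. u i \<in> L2_fun \<Omega> \<and> L2_norm \<Omega> (u i) \<noteq> 0) \<and>
    (\<forall>i\<in>I. \<forall>j\<in>I. i \<noteq> j \<longrightarrow> L2_inner \<Omega> (u i) (u j) = 0) \<and>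
    (\<forall>f\<in>L2_fun \<Omega>. \<forall>\<epsilon>>0. \<exists>F c. finite F \<and> F \<subseteq> I \<and>
        L2_norm \<Omega> (\<lambda>x. f x - (\<Sum>i\<in>F. c i * u i x)) < \<epsilon>)"

definition is_spectrum :: "real set \<Rightarrow> real set \<Rightarrow> bool"
  where "is_spectrum \<Omega> \<Lambda> \<longleftrightarrow>
    \<Omega> \<in> sets lebesgue \<and> 0 < emeasure lebesgue \<Omega> \<and> emeasure lebesgue \<Omega> < \<infinity> \<and>
    L2_orthogonal_basis \<Omega> \<Lambda> exp_char"

definition spectral :: "real set \<Rightarrow> bool"
  where "spectral \<Omega> \<longleftrightarrow> (\<exists>\<Lambda>. is_spectrum \<Omega> \<Lambda>)"

definition tiles_by :: "real set \<Rightarrow> real set \<Rightarrow> bool"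
  where "tiles_by \<Omega> T \<longleftrightarrow>
    (\<forall>s\<in>T. \<forall>t\<in>T. s \<noteq> t \<longrightarrow> ((+) s ` \<Omega>) \<inter> ((+) t ` \<Omega>) \<in> null_sets lebesgue) \<and>
    UNIV - (\<Union>t\<in>T. (+) t ` \<Omega>) \<in> null_sets lebesgue"

text \<open>Periods are positive by convention.\<close>

definition has_period :: "real set \<Rightarrow> real \<Rightarrow> bool"
  where "has_period \<Lambda> p \<longleftrightarrow> 0 < p \<and> (+) p ` \<Lambda> = \<Lambda>"

definition has_minimal_period :: "real set \<Rightarrow> real \<Rightarrow> bool"
  where "has_minimal_period \<Lambda> p \<longleftrightarrow> has_period \<Lambda> p \<and> (\<forall>q. has_period \<Lambda> q \<longrightarrow> p \<le> q)"

text \<open>The intervals may overlap or share endpoints.\<close>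

definition finite_interval_union :: "real set \<Rightarrow> real set \<Rightarrow> bool"
  where "finite_interval_union K \<Omega> \<longleftrightarrow>
    (\<exists>(n::nat) \<alpha> \<beta>. (\<forall>i\<in>{1..n}. \<alpha> i \<in> K \<and> \<beta> i \<in> K \<and> \<alpha> i < \<beta> i) \<and>
                    \<Omega> = (\<Union>i\<in>{1..n}. {\<alpha> i<..<\<beta> i}))"

end

theory Submission
  imports Defs "HOL-Complex_Analysis.Complex_Analysis"
begin

text \<open>
  All three statements are equivalent to a universal tiling property: finite sets of integers with
  a common dual spectrum have a common translational complement in the integers. If a spectrum of a
  bounded set has period one, Fourier analysis on the unit interval shows that almost all fibres of
  the set over the unit interval are such integer sets. Conversely, integer sets with a common
  dual spectrum can be glued along any partition of the unit interval to a spectral set: a partition into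
  intervals gives the statements about intervals, and a partition so irregular that
  tiles can only meet along integer translates forces every tiling to be a common one.

  The remaining ingredient is that the spectrum of a bounded set is periodic. Its differences are zeros of an entire
  function, so only finitely many patterns occur in a window of fixed length, and a sufficiently
  long window determines the next point: otherwise one would approximate an exponential, on a set of positive
  measure, by sums of exponentials of larger frequency, which Jensen's inequality in the half plane forbids.
\<close>

section \<open>Square-integrable functions and orthogonal expansions\<close>

text \<open>Rescaling makes a given period equal to 1, so the spectrum becomes \<open>G + Z\<close>
  with \<open>G\<close> in the unit interval; that two classes are orthogonal then says that all
  Fourier coefficients of one periodised exponential vanish. This turns integrals over the set into
  statements about almost every fibre, where completeness becomes the count
  \<open>card A = card G\<close>. The ways back to the integers differ. The first two statements
  confine the translates to a lattice, so equal subintervals suffice. The third allows arbitrary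
  real translates; the colouring excludes them because every nonzero displacement shorter than
  \<open>1 - \<delta>\<close> shows every ordered pair of colours on some interval. Longer
  displacements below 1 are excluded by a separate argument with all colours at once. Periodicity
  must be proved for the third statement only: the first supplies a period, and integer endpoints
  force period 1 in the second. Its estimates are uniform over all finite frequency sets orthogonal
  for the given set, since one window length must serve at every point of the spectrum.\<close>

definition sqint :: "'a measure \<Rightarrow> ('a \<Rightarrow> complex) \<Rightarrow> bool"
  where "sqint M f \<longleftrightarrow> f \<in> borel_measurable M \<and> integrable M (\<lambda>x. (cmod (f x))\<^sup>2)"

definition ip :: "'a measure \<Rightarrow> ('a \<Rightarrow> complex) \<Rightarrow> ('a \<Rightarrow> complex) \<Rightarrow> complex"
  where "ip M f g = (LINT x|M. f x * cnj (g x))"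

lemma cmod_mult_le_half_squares: "cmod (a * cnj b) \<le> ((cmod a)\<^sup>2 + (cmod b)\<^sup>2) / 2"
  using sum_squares_bound[of "cmod a" "cmod b"] by (simp add: norm_mult)

lemma mult_cnj_eq_cmod_squared: "z * cnj z = (complex_of_real (cmod z))\<^sup>2"
  using complex_norm_square[of z] by simp

lemma sqint_mult_integrable:
  assumes "sqint M f" "sqint M g"
  shows "integrable M (\<lambda>x. f x * cnj (g x))"
proof (rule Bochner_Integration.integrable_bound)
  show "integrable M (\<lambda>x. ((cmod (f x))\<^sup>2 + (cmod (g x))\<^sup>2) / 2)"
    using assms by (auto simp: sqint_def)
  have [measurable]: "f \<in> borel_measurable M" "g \<in> borel_measurable M"
    using assms by (auto simp: sqint_def)
  show "(\<lambda>x. f x * cnj (g x)) \<in> borel_measurable M"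
    by (intro borel_measurable_times borel_measurable_continuous_on[of cnj]) (auto intro!: continuous_intros)
  show "AE x in M. norm (f x * cnj (g x)) \<le> norm (((cmod (f x))\<^sup>2 + (cmod (g x))\<^sup>2) / 2)"
    by (intro AE_I2) (metis cmod_mult_le_half_squares abs_ge_self order_trans real_norm_def)
qed

lemma norm_add_squared_le: "(norm (a + b :: 'a :: real_normed_vector))\<^sup>2 \<le> 2 * (norm a)\<^sup>2 + 2 * (norm b)\<^sup>2"
proof -
  have "(norm (a + b))\<^sup>2 \<le> (norm a + norm b)\<^sup>2"
    by (intro power_mono norm_triangle_ineq) auto
  also have "\<dots> \<le> 2 * (norm a)\<^sup>2 + 2 * (norm b)\<^sup>2"
    using sum_squares_bound[of "norm a" "norm b"] by (simp add: power2_sum)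
  finally show ?thesis .
qed

lemma norm_sum_squared_le:
  fixes z :: "'i \<Rightarrow> 'a :: real_normed_vector"
  shows "(norm (\<Sum>i\<in>F. z i))\<^sup>2 \<le> card F * (\<Sum>i\<in>F. (norm (z i))\<^sup>2)"
proof -
  have "(norm (\<Sum>i\<in>F. z i))\<^sup>2 \<le> (\<Sum>i\<in>F. norm (z i))\<^sup>2"
    by (intro power_mono norm_sum) auto
  also have "\<dots> \<le> card F * (\<Sum>i\<in>F. (norm (z i))\<^sup>2)"
    using sum_squared_le_sum_of_squares[of "\<lambda>i. norm (z i)" F] by (simp add: mult.commute)
  finally show ?thesis .
qed

lemma sqint_zero [simp]: "sqint M (\<lambda>_. 0)"
  by (simp add: sqint_def)

lemma sqint_add:
  assumes "sqint M f" "sqint M g"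
  shows "sqint M (\<lambda>x. f x + g x)"
proof -
  have [measurable]: "f \<in> borel_measurable M" "g \<in> borel_measurable M"
    using assms by (auto simp: sqint_def)
  have "integrable M (\<lambda>x. (cmod (f x + g x))\<^sup>2)"
  proof (rule Bochner_Integration.integrable_bound)
    show "integrable M (\<lambda>x. 2 * (cmod (f x))\<^sup>2 + 2 * (cmod (g x))\<^sup>2)"
      using assms by (auto simp: sqint_def)
    show "AE x in M. norm ((cmod (f x + g x))\<^sup>2) \<le> norm (2 * (cmod (f x))\<^sup>2 + 2 * (cmod (g x))\<^sup>2)"
      using norm_add_squared_le by auto
  qed measurable
  then show ?thesis by (simp add: sqint_def)
qed

lemma sqint_cmult: "sqint M f \<Longrightarrow> sqint M (\<lambda>x. c * f x)"
  by (auto simp: sqint_def norm_mult power_mult_distrib)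

lemma sqint_minus: "sqint M f \<Longrightarrow> sqint M (\<lambda>x. - f x)"
  by (auto simp: sqint_def)

lemma sqint_diff: "sqint M f \<Longrightarrow> sqint M g \<Longrightarrow> sqint M (\<lambda>x. f x - g x)"
  using sqint_add[of M f "\<lambda>x. - g x"] sqint_minus[of M g] by simp

lemma sqint_sum: "(\<And>i. i \<in> F \<Longrightarrow> sqint M (f i)) \<Longrightarrow> sqint M (\<lambda>x. \<Sum>i\<in>F. f i x)"
  by (induction F rule: infinite_finite_induct) (auto intro: sqint_add)

lemma sqint_bounded:
  assumes "finite_measure M" "f \<in> borel_measurable M" "\<And>x. x \<in> space M \<Longrightarrow> cmod (f x) \<le> B"
  shows "sqint M f"
proof -
  interpret finite_measure M by fact
  have "integrable M (\<lambda>x. (cmod (f x))\<^sup>2)"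
    using assms by (intro integrable_const_bound[where B="B\<^sup>2"]) (auto intro!: power_mono)
  then show ?thesis using assms by (simp add: sqint_def)
qed

lemma ip_norm: "ip M f f = of_real (LINT x|M. (cmod (f x))\<^sup>2)"
  unfolding ip_def by (simp add: complex_norm_square[symmetric] flip: integral_complex_of_real)

lemma ip_commute: "ip M g f = cnj (ip M f g)"
  unfolding ip_def Bochner_Integration.integral_cnj[symmetric] by (simp add: mult.commute)

lemma ip_sum_right:
  assumes "sqint M f" "\<And>i. i \<in> F \<Longrightarrow> sqint M (u i)"
  shows "ip M f (\<lambda>x. \<Sum>i\<in>F. c i * u i x) = (\<Sum>i\<in>F. cnj (c i) * ip M f (u i))"
proof -
  have "ip M f (\<lambda>x. \<Sum>i\<in>F. c i * u i x) = (LINT x|M. (\<Sum>i\<in>F. cnj (c i) * (f x * cnj (u i x))))"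
    unfolding ip_def by (simp add: sum_distrib_left mult_ac)
  also have "\<dots> = (\<Sum>i\<in>F. (LINT x|M. cnj (c i) * (f x * cnj (u i x))))"
    using assms by (intro Bochner_Integration.integral_sum integrable_mult_right sqint_mult_integrable) auto
  also have "\<dots> = (\<Sum>i\<in>F. cnj (c i) * ip M f (u i))"
    unfolding ip_def by simp
  finally show ?thesis .
qed

lemma integral_norm_diff_squared:
  assumes f: "sqint M f" and g: "sqint M g"
  shows "(LINT x|M. (cmod (f x - g x))\<^sup>2) =
    (LINT x|M. (cmod (f x))\<^sup>2) - 2 * Re (ip M f g) + (LINT x|M. (cmod (g x))\<^sup>2)"
proof -
  have i: "integrable M (\<lambda>x. Re (f x * cnj (g x)))"
    by (rule integrable_Re[OF sqint_mult_integrable[OF f g]])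
  have "(cmod (f x - g x))\<^sup>2 = (cmod (f x))\<^sup>2 - 2 * Re (f x * cnj (g x)) + (cmod (g x))\<^sup>2" for x
    unfolding cmod_power2 by (simp add: power2_eq_square algebra_simps)
  then have "(LINT x|M. (cmod (f x - g x))\<^sup>2) =
     (LINT x|M. (cmod (f x))\<^sup>2 - 2 * Re (f x * cnj (g x)) + (cmod (g x))\<^sup>2)" by simp
  also have "\<dots> = (LINT x|M. (cmod (f x))\<^sup>2) - 2 * (LINT x|M. Re (f x * cnj (g x))) + (LINT x|M. (cmod (g x))\<^sup>2)"
    using f g i by (simp add: sqint_def del: times_complex.sel)
  also have "(LINT x|M. Re (f x * cnj (g x))) = Re (ip M f g)"
    unfolding ip_def using sqint_mult_integrable[OF f g] by (rule integral_Re)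
  finally show ?thesis .
qed

text \<open>The measure is arbitrary because the same identities serve Lebesgue measure on a set and
  counting measure on a finite set of integers. One common squared norm \<open>V\<close> suffices:
  exponentials have modulus one, so \<open>V\<close> is the total mass.\<close>

locale orthogonal_family =
  fixes M :: "'a measure" and F :: "'i set" and u :: "'i \<Rightarrow> 'a \<Rightarrow> complex" and V :: real
  assumes finite_F: "finite F"
    and sqint_u: "\<And>i. i \<in> F \<Longrightarrow> sqint M (u i)"
    and orth: "\<And>i j. i \<in> F \<Longrightarrow> j \<in> F \<Longrightarrow> i \<noteq> j \<Longrightarrow> ip M (u i) (u j) = 0"
    and norm_u: "\<And>i. i \<in> F \<Longrightarrow> (LINT x|M. (cmod (u i x))\<^sup>2) = V"
begin

lemma sqint_comb: "sqint M (\<lambda>x. \<Sum>i\<in>F. c i * u i x)"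
  using sqint_u by (intro sqint_sum sqint_cmult)

lemma integral_comb_squared:
  "(LINT x|M. (cmod (\<Sum>i\<in>F. c i * u i x))\<^sup>2) = V * (\<Sum>i\<in>F. (cmod (c i))\<^sup>2)"
proof -
  have "ip M (\<lambda>x. \<Sum>i\<in>F. c i * u i x) (u j) = c j * of_real V" if "j \<in> F" for j
  proof -
    have "ip M (\<lambda>x. \<Sum>i\<in>F. c i * u i x) (u j) = cnj (ip M (u j) (\<lambda>x. \<Sum>i\<in>F. c i * u i x))"
      by (rule ip_commute)
    also have "\<dots> = (\<Sum>i\<in>F. c i * cnj (ip M (u j) (u i)))"
      using that by (subst ip_sum_right) (auto simp: sqint_u)
    also have "\<dots> = (\<Sum>i\<in>F. if i = j then c j * of_real V else 0)"
      using that by (intro sum.cong) (auto simp: orth ip_norm norm_u)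
    also have "\<dots> = c j * of_real V" using that finite_F by simp
    finally show ?thesis .
  qed
  then have "ip M (\<lambda>x. \<Sum>i\<in>F. c i * u i x) (\<lambda>x. \<Sum>i\<in>F. c i * u i x) = (\<Sum>i\<in>F. cnj (c i) * (c i * of_real V))"
    by (subst ip_sum_right) (auto simp: sqint_u sqint_comb)
  also have "\<dots> = of_real (V * (\<Sum>i\<in>F. (cmod (c i))\<^sup>2))"
    by (simp add: mult_cnj_eq_cmod_squared[symmetric] sum_distrib_left mult_ac)
  finally show ?thesis unfolding ip_norm of_real_eq_iff .
qed

lemma integral_diff_comb_squared:
  assumes f: "sqint M f"
  shows "(LINT x|M. (cmod (f x - (\<Sum>i\<in>F. c i * u i x)))\<^sup>2) =
    (LINT x|M. (cmod (f x))\<^sup>2) - 2 * (\<Sum>i\<in>F. Re (cnj (c i) * ip M f (u i))) + V * (\<Sum>i\<in>F. (cmod (c i))\<^sup>2)"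
  using f by (simp add: integral_norm_diff_squared sqint_comb integral_comb_squared ip_sum_right sqint_u)

lemma integral_diff_projection_squared:
  assumes f: "sqint M f" and V: "V > 0"
  shows "(LINT x|M. (cmod (f x - (\<Sum>i\<in>F. (ip M f (u i) / V) * u i x)))\<^sup>2) =
    (LINT x|M. (cmod (f x))\<^sup>2) - (\<Sum>i\<in>F. (cmod (ip M f (u i)))\<^sup>2) / V"
proof -
  have "cnj (ip M f (u i) / V) * ip M f (u i) = of_real ((cmod (ip M f (u i)))\<^sup>2 / V)" for i
    by (simp add: mult_cnj_eq_cmod_squared[symmetric] mult.commute)
  then have *: "Re (cnj (ip M f (u i) / V) * ip M f (u i)) = (cmod (ip M f (u i)))\<^sup>2 / V" for i
    by (metis Re_complex_of_real)
  show ?thesis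
    unfolding integral_diff_comb_squared[OF f] *
    using V by (simp add: norm_divide power_divide sum_divide_distrib[symmetric] power2_eq_square field_simps)
qed

lemma bessel:
  assumes f: "sqint M f" and V: "V > 0"
  shows "(\<Sum>i\<in>F. (cmod (ip M f (u i)))\<^sup>2) \<le> V * (LINT x|M. (cmod (f x))\<^sup>2)"
proof -
  have "0 \<le> (LINT x|M. (cmod (f x - (\<Sum>i\<in>F. (ip M f (u i) / V) * u i x)))\<^sup>2)"
    by (rule integral_nonneg_AE) auto
  then show ?thesis
    unfolding integral_diff_projection_squared[OF assms] using V by (simp add: field_simps)
qed

lemma best_approximation:
  assumes f: "sqint M f" and V: "V > 0"
  shows "(LINT x|M. (cmod (f x - (\<Sum>i\<in>F. (ip M f (u i) / V) * u i x)))\<^sup>2) \<le>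
    (LINT x|M. (cmod (f x - (\<Sum>i\<in>F. c i * u i x)))\<^sup>2)"
proof -
  \<comment> \<open>Completing the square in each coefficient separately; orthogonality makes the
    error a sum of such terms.\<close>
  have "2 * Re (cnj (c i) * ip M f (u i)) - V * (cmod (c i))\<^sup>2 \<le> (cmod (ip M f (u i)))\<^sup>2 / V" for i
  proof -
    have "2 * Re (cnj (c i) * ip M f (u i)) \<le> 2 * (cmod (c i) * cmod (ip M f (u i)))"
      using complex_Re_le_cmod[of "cnj (c i) * ip M f (u i)"] by (simp add: norm_mult)
    moreover have "0 \<le> (V * cmod (c i) - cmod (ip M f (u i)))\<^sup>2 / V" using V by simp
    ultimately have "2 * Re (cnj (c i) * ip M f (u i)) \<le> 2 * (cmod (c i) * cmod (ip M f (u i)))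
        + (V * cmod (c i) - cmod (ip M f (u i)))\<^sup>2 / V"
      by linarith
    also have "\<dots> = V * (cmod (c i))\<^sup>2 + (cmod (ip M f (u i)))\<^sup>2 / V"
      using V by (simp add: power2_eq_square field_simps)
    finally show ?thesis by simp
  qed
  then have "(\<Sum>i\<in>F. 2 * Re (cnj (c i) * ip M f (u i)) - V * (cmod (c i))\<^sup>2) \<le> (\<Sum>i\<in>F. (cmod (ip M f (u i)))\<^sup>2 / V)"
    by (rule sum_mono)
  then show ?thesis
    unfolding integral_diff_projection_squared[OF assms] integral_diff_comb_squared[OF f]
    by (simp add: sum_subtractf sum_distrib_left sum_divide_distrib)
qed

end

section \<open>Exponentials\<close>

lemma exp_char_cis: "exp_char l x = cis (2 * pi * l * x)"
  by (simp add: exp_char_def cis_conv_exp mult_ac)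

lemma norm_exp_char [simp]: "cmod (exp_char l x) = 1"
  by (simp add: exp_char_cis)

lemma exp_char_nonzero [simp]: "exp_char l x \<noteq> 0"
  by (simp add: exp_char_def)

lemma exp_char_0 [simp]: "exp_char 0 x = 1" "exp_char l 0 = 1"
  by (simp_all add: exp_char_def)

lemma cnj_exp_char: "cnj (exp_char l x) = exp_char (- l) x"
  by (simp add: exp_char_cis cis_cnj)

lemma exp_char_add: "exp_char (l + m) x = exp_char l x * exp_char m x"
  by (simp add: exp_char_cis cis_mult algebra_simps)

lemma exp_char_diff: "exp_char (l - m) x = exp_char l x * cnj (exp_char m x)"
  by (simp add: cnj_exp_char flip: exp_char_add)

lemma exp_char_add_right: "exp_char l (x + y) = exp_char l x * exp_char l y"
  by (simp add: exp_char_cis cis_mult algebra_simps)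

lemma exp_char_diff_right: "exp_char l (x - y) = exp_char l x * cnj (exp_char l y)"
  by (simp add: exp_char_cis cis_mult cis_cnj algebra_simps)

lemma exp_char_int: "l * x \<in> \<int> \<Longrightarrow> exp_char l x = 1"
  using cis_multiple_2pi[of "l * x"] by (simp add: exp_char_cis mult.assoc)

lemma exp_char_of_int [simp]: "exp_char (of_int k) (of_int m) = 1"
  by (rule exp_char_int) auto

lemma continuous_exp_char [continuous_intros]: "continuous_on S (exp_char l)"
  unfolding exp_char_def by (intro continuous_intros)

lemma measurable_exp_char [measurable]: "exp_char l \<in> borel_measurable (lebesgue_on S)"
  using continuous_imp_measurable_on_sets_lebesgue[OF continuous_exp_char, of UNIV l]
  by (simp add: lebesgue_on_UNIV_eq measurable_restrict_space1)

lemma measurable_exp_char_UNIV [measurable]: "exp_char l \<in> borel_measurable lebesgue"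
  using measurable_exp_char[of l UNIV] by (simp add: lebesgue_on_UNIV_eq)

lemma sqint_exp_char:
  assumes "S \<in> lmeasurable"
  shows "sqint (lebesgue_on S) (exp_char l)"
  using assms by (intro sqint_bounded[where B=1] finite_measure_lebesgue_on measurable_exp_char) auto

lemma measure_lebesgue_on_self: "S \<in> lmeasurable \<Longrightarrow> measure (lebesgue_on S) S = measure lebesgue S"
  by (subst measure_restrict_space) (auto simp: fmeasurableD)

lemma integral_exp_char_squared:
  assumes "S \<in> lmeasurable"
  shows "(LINT x|lebesgue_on S. (cmod (exp_char l x))\<^sup>2) = measure lebesgue S"
  using assms by (simp add: measure_lebesgue_on_self)

text \<open>The Fourier transform of the indicator function of \<open>S\<close>, taken at
  \<open>- l\<close>. Inner products of exponentials depend only on the difference of frequencies,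
  so orthogonality is a condition on the zeros of this one function.\<close>

definition hat :: "real set \<Rightarrow> real \<Rightarrow> complex"
  where "hat S l = (LINT x|lebesgue_on S. exp_char l x)"

lemma ip_exp_char: "ip (lebesgue_on S) (exp_char l) (exp_char m) = hat S (l - m)"
  by (simp add: ip_def hat_def exp_char_diff)

lemma hat_uminus: "hat S (- l) = cnj (hat S l)"
  unfolding hat_def Bochner_Integration.integral_cnj[symmetric] by (simp add: cnj_exp_char)

lemma hat_0: "S \<in> lmeasurable \<Longrightarrow> hat S 0 = measure lebesgue S"
  by (simp add: hat_def measure_lebesgue_on_self scaleR_conv_of_real)

definition hat_orth :: "real set \<Rightarrow> real set \<Rightarrow> bool"
  where "hat_orth S L \<longleftrightarrow> (\<forall>l\<in>L. \<forall>m\<in>L. l \<noteq> m \<longrightarrow> hat S (l - m) = 0)"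

lemma orthogonal_family_exp_char:
  assumes "S \<in> lmeasurable" "finite F" "hat_orth S F"
  shows "orthogonal_family (lebesgue_on S) F exp_char (measure lebesgue S)"
  using assms by unfold_locales (auto simp: sqint_exp_char ip_exp_char hat_orth_def measure_lebesgue_on_self)

lemma hat_orth_subset: "hat_orth S L \<Longrightarrow> K \<subseteq> L \<Longrightarrow> hat_orth S K"
  by (auto simp: hat_orth_def)

lemma L2_fun_iff: "f \<in> L2_fun S \<longleftrightarrow> sqint (lebesgue_on S) f"
  by (simp add: L2_fun_def sqint_def)

definition exp_dense :: "real set \<Rightarrow> real set \<Rightarrow> bool"
  where "exp_dense S L \<longleftrightarrow> (\<forall>f \<epsilon>. sqint (lebesgue_on S) f \<longrightarrow> \<epsilon> > 0 \<longrightarrow>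
     (\<exists>F c. finite F \<and> F \<subseteq> L \<and> (LINT x|lebesgue_on S. (cmod (f x - (\<Sum>l\<in>F. c l * exp_char l x)))\<^sup>2) < \<epsilon>))"

lemma is_spectrum_iff:
  "is_spectrum S L \<longleftrightarrow> S \<in> lmeasurable \<and> measure lebesgue S > 0 \<and> hat_orth S L \<and> exp_dense S L"
proof (cases "S \<in> lmeasurable \<and> measure lebesgue S > 0")
  case True
  then have S: "S \<in> lmeasurable" "measure lebesgue S > 0" by auto
  have m: "S \<in> sets lebesgue" "0 < emeasure lebesgue S" "emeasure lebesgue S < \<infinity>"
    using S by (auto simp: fmeasurable_def emeasure_eq_measure2[OF S(1)])
  have n: "L2_norm S f < e \<longleftrightarrow> (LINT x|lebesgue_on S. (cmod (f x))\<^sup>2) < e\<^sup>2" if "e > 0" for f e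
    unfolding L2_norm_def using that real_sqrt_less_iff[of "LINT x|lebesgue_on S. (cmod (f x))\<^sup>2" "e\<^sup>2"] by simp
  have d: "(\<forall>f\<in>L2_fun S. \<forall>\<epsilon>>0. \<exists>F c. finite F \<and> F \<subseteq> L \<and>
        L2_norm S (\<lambda>x. f x - (\<Sum>i\<in>F. c i * exp_char i x)) < \<epsilon>) \<longleftrightarrow> exp_dense S L" (is "?L = ?R")
  proof
    assume ?L
    show ?R unfolding exp_dense_def
    proof (intro allI impI)
      fix f and e :: real assume "sqint (lebesgue_on S) f" "e > 0"
      then have "\<exists>F c. finite F \<and> F \<subseteq> L \<and> L2_norm S (\<lambda>x. f x - (\<Sum>i\<in>F. c i * exp_char i x)) < sqrt e"
        using \<open>?L\<close> by (simp add: L2_fun_iff)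
      then show "\<exists>F c. finite F \<and> F \<subseteq> L \<and> (LINT x|lebesgue_on S. (cmod (f x - (\<Sum>l\<in>F. c l * exp_char l x)))\<^sup>2) < e"
        using \<open>e > 0\<close> by (simp add: n)
    qed
  next
    assume ?R
    show ?L
    proof (intro ballI allI impI)
      fix f and e :: real assume "f \<in> L2_fun S" "e > 0"
      then obtain F c where "finite F" "F \<subseteq> L"
        "(LINT x|lebesgue_on S. (cmod (f x - (\<Sum>l\<in>F. c l * exp_char l x)))\<^sup>2) < e\<^sup>2"
        using \<open>?R\<close> unfolding exp_dense_def L2_fun_iff by (meson zero_less_power)
      then show "\<exists>F c. finite F \<and> F \<subseteq> L \<and> L2_norm S (\<lambda>x. f x - (\<Sum>i\<in>F. c i * exp_char i x)) < e"
        using n[OF \<open>e > 0\<close>] by blast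
    qed
  qed
  have o: "(\<forall>i\<in>L. exp_char i \<in> L2_fun S \<and> L2_norm S (exp_char i) \<noteq> 0)"
    using S by (auto simp: L2_fun_iff sqint_exp_char L2_norm_def measure_lebesgue_on_self)
  have h: "(\<forall>i\<in>L. \<forall>j\<in>L. i \<noteq> j \<longrightarrow> L2_inner S (exp_char i) (exp_char j) = 0) \<longleftrightarrow> hat_orth S L"
    by (simp add: hat_orth_def ip_exp_char[symmetric] ip_def L2_inner_def)
  show ?thesis
    unfolding is_spectrum_def L2_orthogonal_basis_def d h using S m o by blast
next
  case False
  have "\<not> (S \<in> sets lebesgue \<and> 0 < emeasure lebesgue S \<and> emeasure lebesgue S < \<infinity>)"
  proof
    assume *: "S \<in> sets lebesgue \<and> 0 < emeasure lebesgue S \<and> emeasure lebesgue S < \<infinity>"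
    then have S: "S \<in> lmeasurable" by (intro fmeasurableI) auto
    then have "ennreal (measure lebesgue S) > 0" using * by (simp add: emeasure_eq_measure2)
    then show False using False S by simp
  qed
  then show ?thesis
    unfolding is_spectrum_def using False by blast
qed

text \<open>Density provides some combination over a finite \<open>F\<close>; by best approximation
  its coefficients may be replaced by the Fourier coefficients, and the residual formula turns the
  small error into a lower Parseval bound.\<close>

lemma spectrum_parseval:
  assumes "is_spectrum S L" "sqint (lebesgue_on S) f" "e > 0"
  obtains F where "finite F" "F \<subseteq> L"
    "(LINT x|lebesgue_on S. (cmod (f x - (\<Sum>l\<in>F. (ip (lebesgue_on S) f (exp_char l) / measure lebesgue S) * exp_char l x)))\<^sup>2) < e"
    "(LINT x|lebesgue_on S. (cmod (f x))\<^sup>2) - e < (\<Sum>l\<in>F. (cmod (ip (lebesgue_on S) f (exp_char l)))\<^sup>2) / measure lebesgue S"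
proof -
  have S: "S \<in> lmeasurable" "measure lebesgue S > 0" "hat_orth S L" "exp_dense S L"
    using assms(1) by (auto simp: is_spectrum_iff)
  obtain F c where F: "finite F" "F \<subseteq> L" "(LINT x|lebesgue_on S. (cmod (f x - (\<Sum>l\<in>F. c l * exp_char l x)))\<^sup>2) < e"
    using S(4)[unfolded exp_dense_def, rule_format, OF assms(2,3)] by (elim exE conjE)
  interpret orthogonal_family "lebesgue_on S" F exp_char "measure lebesgue S"
    using orthogonal_family_exp_char[OF S(1) F(1) hat_orth_subset[OF S(3) F(2)]] .
  show ?thesis
  proof (rule that[OF F(1,2)])
    show *: "(LINT x|lebesgue_on S. (cmod (f x - (\<Sum>l\<in>F. (ip (lebesgue_on S) f (exp_char l) / measure lebesgue S) * exp_char l x)))\<^sup>2) < e"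
      using best_approximation[OF assms(2) S(2), of c] F(3) by (rule le_less_trans)
    then show "(LINT x|lebesgue_on S. (cmod (f x))\<^sup>2) - e < (\<Sum>l\<in>F. (cmod (ip (lebesgue_on S) f (exp_char l)))\<^sup>2) / measure lebesgue S"
      unfolding integral_diff_projection_squared[OF assms(2) S(2)] by linarith
  qed
qed

section \<open>Scaling\<close>

lemma mem_scale_iff: "c \<noteq> 0 \<Longrightarrow> c * x \<in> (*) c ` S \<longleftrightarrow> x \<in> (S :: real set)"
  by auto

lemma mem_scale_iff': "c \<noteq> 0 \<Longrightarrow> x \<in> (*) c ` S \<longleftrightarrow> x / c \<in> (S :: real set)"
  by (auto intro: image_eqI[of _ _ "x / c"])

lemma scale_scale: "(*) a ` (*) b ` (S :: real set) = (*) (a * b) ` S"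
  by (auto simp: image_image mult.assoc)

lemma lmeasurable_scale:
  assumes "c > 0" "S \<in> lmeasurable"
  shows "(*) c ` S \<in> lmeasurable" and "measure lebesgue ((*) c ` S) = c * measure lebesgue S"
proof -
  have "indicat_real ((*) c ` S) = (\<lambda>x. indicat_real S (0 + (1 / c) * x))"
    using assms by (auto simp: indicator_def mem_scale_iff')
  then show "(*) c ` S \<in> lmeasurable"
    using assms lebesgue_integrable_real_affine[of "indicat_real S" "1 / c" 0]
    by (simp add: lmeasurable_iff_integrable)
  have "(\<lambda>x. c *\<^sub>R x + 0) ` S = (*) c ` S" by auto
  then show "measure lebesgue ((*) c ` S) = c * measure lebesgue S"
    using measure_lebesgue_affine[of c 0 S] assms by simp
qed

lemma LINT_scale:
  fixes f :: "real \<Rightarrow> 'b::euclidean_space"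
  assumes c: "c > 0" and S: "S \<in> lmeasurable"
  shows "(LINT x|lebesgue_on ((*) c ` S). f x) = c *\<^sub>R (LINT x|lebesgue_on S. f (c * x))"
proof -
  have "(LINT x|lebesgue_on ((*) c ` S). f x) = (LINT x|lebesgue. (if x \<in> (*) c ` S then f x else 0))"
    using lmeasurable_scale[OF c S] by (intro Lebesgue_Measure.integral_restrict_UNIV[symmetric]) auto
  also have "\<dots> = c *\<^sub>R (LINT x|lebesgue. (if c * x \<in> (*) c ` S then f (c * x) else 0))"
    using c lebesgue_integral_real_affine[of c "\<lambda>x. if x \<in> (*) c ` S then f x else 0" 0] by (simp cong: if_cong)
  also have "\<dots> = c *\<^sub>R (LINT x|lebesgue. (if x \<in> S then f (c * x) else 0))"
    using c by (simp add: mem_scale_iff)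
  also have "\<dots> = c *\<^sub>R (LINT x|lebesgue_on S. f (c * x))"
    using S by (subst Lebesgue_Measure.integral_restrict_UNIV) auto
  finally show ?thesis .
qed

lemma measurable_scale:
  fixes f :: "real \<Rightarrow> 'b::euclidean_space"
  assumes c: "c > 0" and S: "S \<in> lmeasurable" and f: "f \<in> borel_measurable (lebesgue_on S)"
  shows "(\<lambda>x. f (x / c)) \<in> borel_measurable (lebesgue_on ((*) c ` S))"
proof -
  have "(\<lambda>x. if x \<in> S then f x else 0) \<in> borel_measurable lebesgue"
    using f S by (intro borel_measurable_if_I) auto
  then have "(\<lambda>x. if 0 + (1 / c) *\<^sub>R x \<in> S then f (0 + (1 / c) *\<^sub>R x) else 0) \<in> borel_measurable lebesgue"
    using c by (intro borel_measurable_affine[of "\<lambda>x. if x \<in> S then f x else 0"]) auto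
  then have "(\<lambda>x. if x \<in> (*) c ` S then f (x / c) else 0) \<in> borel_measurable lebesgue"
    using c by (simp add: mem_scale_iff' cong: if_cong)
  then show ?thesis by (rule borel_measurable_if_D)
qed

lemma integrable_scale:
  fixes f :: "real \<Rightarrow> 'b::euclidean_space"
  assumes c: "c > 0" and S: "S \<in> lmeasurable" and f: "integrable (lebesgue_on S) f"
  shows "integrable (lebesgue_on ((*) c ` S)) (\<lambda>x. f (x / c))"
proof -
  have "integrable lebesgue (\<lambda>x. if x \<in> S then f x else 0)"
    using f S by (subst Lebesgue_Measure.integrable_restrict_UNIV) auto
  then have "integrable lebesgue (\<lambda>x. if 0 + (1 / c) * x \<in> S then f (0 + (1 / c) * x) else 0)"
    using c by (intro lebesgue_integrable_real_affine[of "\<lambda>x. if x \<in> S then f x else 0"]) auto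
  then have "integrable lebesgue (\<lambda>x. if x \<in> (*) c ` S then f (x / c) else 0)"
    using c by (simp add: mem_scale_iff' cong: if_cong)
  then show ?thesis
    using lmeasurable_scale[OF c S] by (subst (asm) Lebesgue_Measure.integrable_restrict_UNIV) auto
qed

lemma sqint_scale:
  fixes c :: real
  assumes c: "c > 0" and S: "S \<in> lmeasurable" and f: "sqint (lebesgue_on ((*) c ` S)) f"
  shows "sqint (lebesgue_on S) (\<lambda>x. f (c * x))"
proof -
  have cS: "(*) c ` S \<in> lmeasurable" "(*) (1 / c) ` (*) c ` S = S"
    using lmeasurable_scale[OF c S] c by (auto simp: image_image)
  show ?thesis
    using measurable_scale[of "1 / c" "(*) c ` S" f] integrable_scale[of "1 / c" "(*) c ` S" "\<lambda>x. (cmod (f x))\<^sup>2"] c cS f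
    by (auto simp: sqint_def mult.commute)
qed

lemma exp_char_scale: "exp_char l (c * x) = exp_char (c * l) x"
  by (simp add: exp_char_def mult_ac)

lemma hat_scale:
  assumes "c > 0" "S \<in> lmeasurable"
  shows "hat ((*) c ` S) l = c * hat S (c * l)"
  unfolding hat_def LINT_scale[OF assms] by (simp add: exp_char_scale scaleR_conv_of_real)

lemma exp_dense_scale:
  assumes c: "c > 0" and S: "S \<in> lmeasurable" and L: "exp_dense S L"
  shows "exp_dense ((*) c ` S) ((*) (1 / c) ` L)"
  unfolding exp_dense_def
proof (intro allI impI)
  fix f and e :: real assume f: "sqint (lebesgue_on ((*) c ` S)) f" and e: "e > 0"
  have "e / c > 0" using e c by simp
  from L[unfolded exp_dense_def, rule_format, OF sqint_scale[OF c S f] this]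
  obtain F b where F: "finite F" "F \<subseteq> L" and
    le: "(LINT x|lebesgue_on S. (cmod (f (c * x) - (\<Sum>l\<in>F. b l * exp_char l x)))\<^sup>2) < e / c"
    by (elim exE conjE)
  have sum: "(\<Sum>l\<in>(*) (1 / c) ` F. b (c * l) * exp_char l (c * x)) = (\<Sum>l\<in>F. b l * exp_char l x)" for x
    using c by (subst sum.reindex) (auto simp: inj_on_def exp_char_scale)
  have "(LINT x|lebesgue_on ((*) c ` S). (cmod (f x - (\<Sum>l\<in>(*) (1 / c) ` F. b (c * l) * exp_char l x)))\<^sup>2) < e"
    unfolding LINT_scale[OF c S] sum using le c by (simp add: field_simps)
  then show "\<exists>F b. finite F \<and> F \<subseteq> (*) (1 / c) ` L \<and>
      (LINT x|lebesgue_on ((*) c ` S). (cmod (f x - (\<Sum>l\<in>F. b l * exp_char l x)))\<^sup>2) < e"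
    using F by (intro exI[of _ "(*) (1 / c) ` F"] exI[of _ "\<lambda>l. b (c * l)"]) auto
qed

text \<open>Dilating the set by \<open>c\<close> contracts the frequencies by \<open>1 / c\<close>.
  This is the device that normalises a period to 1 and a measure or a set of endpoints as
  required.\<close>

lemma spectrum_scale:
  assumes c: "c > 0" and L: "is_spectrum S L"
  shows "is_spectrum ((*) c ` S) ((*) (1 / c) ` L)"
proof -
  have S: "S \<in> lmeasurable" and L: "measure lebesgue S > 0" "hat_orth S L" "exp_dense S L"
    using L by (auto simp: is_spectrum_iff)
  have "hat_orth ((*) c ` S) ((*) (1 / c) ` L)"
    using L(2) c unfolding hat_orth_def by (auto simp: hat_scale[OF c S] right_diff_distrib)
  then show ?thesis
    using L c S lmeasurable_scale[OF c S] exp_dense_scale[OF c S L(3)] by (simp add: is_spectrum_iff)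
qed

lemma has_period_scale:
  assumes "c > 0" "has_period L p"
  shows "has_period ((*) c ` L) (c * p)"
proof -
  have "(+) (c * p) ` (*) c ` L = (*) c ` (+) p ` L"
    by (simp add: image_image algebra_simps)
  then show ?thesis using assms by (simp add: has_period_def)
qed

lemma tiles_by_scale:
  assumes c: "c > 0" and T: "tiles_by S T"
  shows "tiles_by ((*) c ` S) ((*) c ` T)"
proof -
  have tr: "(+) (c * t) ` (*) c ` S = (*) c ` (+) t ` S" for t
    by (simp add: image_image algebra_simps)
  have inj: "inj ((*) c :: real \<Rightarrow> real)" using c by (simp add: inj_on_def)
  have null: "(*) c ` N \<in> null_sets lebesgue" if "N \<in> null_sets lebesgue" for N
  proof -
    have "N \<in> lmeasurable" "measure lebesgue N = 0"
      using that by (simp_all add: fmeasurableI_null_sets measure_eq_0_null_sets)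
    then have *: "(*) c ` N \<in> lmeasurable" "measure lebesgue ((*) c ` N) = 0"
      using lmeasurable_scale[OF c] by simp_all
    then have "emeasure lebesgue ((*) c ` N) = 0"
      by (simp only: emeasure_eq_measure2 ennreal_0)
    then show ?thesis
      using * by (intro null_setsI fmeasurableD)
  qed
  have "(*) c ` (UNIV - (\<Union>t\<in>T. (+) t ` S)) = UNIV - (\<Union>t\<in>T. (*) c ` (+) t ` S)"
  proof -
    have "surj ((*) c :: real \<Rightarrow> real)"
      by (rule surjI[of _ "\<lambda>x. x / c"]) (use c in auto)
    then show ?thesis by (simp add: image_set_diff[OF inj] image_UN)
  qed
  moreover have "(\<Union>t\<in>(*) c ` T. (+) t ` (*) c ` S) = (\<Union>t\<in>T. (*) c ` (+) t ` S)"
    by (simp add: tr)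
  ultimately have "UNIV - (\<Union>t\<in>(*) c ` T. (+) t ` (*) c ` S) \<in> null_sets lebesgue"
    using null[of "UNIV - (\<Union>t\<in>T. (+) t ` S)"] T unfolding tiles_by_def by metis
  moreover have "(+) s ` (*) c ` S \<inter> (+) t ` (*) c ` S \<in> null_sets lebesgue"
    if st: "s \<in> (*) c ` T" "t \<in> (*) c ` T" "s \<noteq> t" for s t
  proof -
    obtain s' t' where st': "s = c * s'" "t = c * t'" "s' \<in> T" "t' \<in> T"
      using st(1,2) by blast
    then have "s' \<noteq> t'" using \<open>s \<noteq> t\<close> by auto
    have "(+) s ` (*) c ` S \<inter> (+) t ` (*) c ` S = (*) c ` ((+) s' ` S \<inter> (+) t' ` S)"
      by (simp add: st' tr image_Int[OF inj])
    then show ?thesis using null T st' \<open>s' \<noteq> t'\<close> by (simp add: tiles_by_def)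
  qed
  ultimately show ?thesis by (auto simp: tiles_by_def)
qed

section \<open>Completeness of the trigonometric system on the unit interval\<close>

inductive trig_poly :: "(real \<Rightarrow> complex) \<Rightarrow> bool" where
  monom: "trig_poly (\<lambda>x. c * exp_char (of_int k) x)"
| add: "trig_poly p \<Longrightarrow> trig_poly q \<Longrightarrow> trig_poly (\<lambda>x. p x + q x)"

lemma trig_poly_const: "trig_poly (\<lambda>x. c)"
  using trig_poly.monom[of c 0] by simp

lemma trig_poly_mult:
  assumes "trig_poly p" "trig_poly q"
  shows "trig_poly (\<lambda>x. p x * q x)"
  using assms
proof (induction arbitrary: q rule: trig_poly.induct)
  case (monom c k)
  show ?case using monom
  proof (induction rule: trig_poly.induct)
    case (monom d m)
    have "(\<lambda>x. c * exp_char (of_int k) x * (d * exp_char (of_int m) x)) = (\<lambda>x. (c * d) * exp_char (of_int (k + m)) x)"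
      by (auto simp: exp_char_add)
    then show ?case by (simp only: trig_poly.monom)
  next
    case (add p q)
    then show ?case using trig_poly.add[OF add.IH] by (simp add: distrib_left)
  qed
next
  case (add p r)
  then show ?case using trig_poly.add[OF add.IH(1)[OF add.prems] add.IH(2)[OF add.prems]] by (simp add: distrib_right)
qed

definition exp_comb :: "real set \<Rightarrow> (real \<Rightarrow> complex) \<Rightarrow> bool"
  where "exp_comb L p \<longleftrightarrow> (\<exists>F c. finite F \<and> F \<subseteq> L \<and> p = (\<lambda>x. \<Sum>l\<in>F. c l * exp_char l x))"

lemma exp_comb_single: "l \<in> L \<Longrightarrow> exp_comb L (\<lambda>x. c * exp_char l x)"
  unfolding exp_comb_def by (rule exI[of _ "{l}"], rule exI[of _ "\<lambda>_. c"]) auto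

lemma exp_comb_0: "exp_comb L (\<lambda>x. 0)"
  unfolding exp_comb_def by (rule exI[of _ "{}"]) auto

lemma exp_comb_add:
  assumes "exp_comb L p" "exp_comb L q"
  shows "exp_comb L (\<lambda>x. p x + q x)"
proof -
  obtain F c G d where F: "finite F" "F \<subseteq> L" "p = (\<lambda>x. \<Sum>l\<in>F. c l * exp_char l x)"
    and G: "finite G" "G \<subseteq> L" "q = (\<lambda>x. \<Sum>l\<in>G. d l * exp_char l x)"
    using assms unfolding exp_comb_def by (elim exE conjE)
  have eq: "p x + q x = (\<Sum>l\<in>F \<union> G. ((if l \<in> F then c l else 0) + (if l \<in> G then d l else 0)) * exp_char l x)" for x
  proof -
    have "(\<Sum>l\<in>F. c l * exp_char l x) = (\<Sum>l\<in>F \<union> G. (if l \<in> F then c l else 0) * exp_char l x)"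
      using F G by (intro sum.mono_neutral_cong_left) auto
    moreover have "(\<Sum>l\<in>G. d l * exp_char l x) = (\<Sum>l\<in>F \<union> G. (if l \<in> G then d l else 0) * exp_char l x)"
      using F G by (intro sum.mono_neutral_cong_left) auto
    ultimately show ?thesis unfolding F(3) G(3) by (simp add: sum.distrib distrib_right)
  qed
  show ?thesis
    using F(1,2) G(1,2) unfolding exp_comb_def
    by (intro exI[of _ "F \<union> G"] exI[of _ "\<lambda>l. (if l \<in> F then c l else 0) + (if l \<in> G then d l else 0)"])
       (auto simp: eq)
qed

lemma exp_comb_sum: "(\<And>i. i \<in> F \<Longrightarrow> exp_comb L (p i)) \<Longrightarrow> exp_comb L (\<lambda>x. \<Sum>i\<in>F. p i x)"
  by (induction F rule: infinite_finite_induct) (auto intro: exp_comb_add simp: exp_comb_0)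

lemma exp_comb_mult_exp:
  assumes "exp_comb L p" "\<And>l. l \<in> L \<Longrightarrow> l + m \<in> K"
  shows "exp_comb K (\<lambda>x. p x * exp_char m x)"
proof -
  obtain F c where F: "finite F" "F \<subseteq> L" "p = (\<lambda>x. \<Sum>l\<in>F. c l * exp_char l x)"
    using assms(1) unfolding exp_comb_def by (elim exE conjE)
  have "exp_comb K (\<lambda>x. \<Sum>l\<in>F. c l * exp_char (l + m) x)"
    using F assms(2) by (intro exp_comb_sum exp_comb_single) auto
  then show ?thesis unfolding F(3) by (simp add: exp_char_add sum_distrib_right mult.assoc)
qed

lemma sqint_exp_comb: "S \<in> lmeasurable \<Longrightarrow> exp_comb L p \<Longrightarrow> sqint (lebesgue_on S) p"
  unfolding exp_comb_def by (auto intro!: sqint_sum sqint_cmult sqint_exp_char)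

lemma exp_dense_iff:
  "exp_dense S L \<longleftrightarrow> (\<forall>f \<epsilon>. sqint (lebesgue_on S) f \<longrightarrow> \<epsilon> > 0 \<longrightarrow>
     (\<exists>p. exp_comb L p \<and> (LINT x|lebesgue_on S. (cmod (f x - p x))\<^sup>2) < \<epsilon>))"
  unfolding exp_dense_def exp_comb_def by (intro iff_allI imp_cong refl) blast

lemma trig_poly_exp_comb:
  assumes "trig_poly p"
  shows "exp_comb \<int> p"
  using assms by (induction rule: trig_poly.induct) (auto intro: exp_comb_add exp_comb_single)

lemma trig_poly_real_polynomial:
  assumes "real_polynomial_function q"
  shows "trig_poly (\<lambda>x. of_real (q (exp_char 1 x)))"
  using assms
proof (induction rule: real_polynomial_function.induct)
  case (linear f)
  interpret bounded_linear f by fact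
  have f: "f z = Re z * f 1 + Im z * f \<i>" for z
  proof -
    have "z = Re z *\<^sub>R 1 + Im z *\<^sub>R \<i>" by (simp add: complex_eq_iff)
    then have "f z = f (Re z *\<^sub>R 1 + Im z *\<^sub>R \<i>)" by simp
    then show ?thesis by (simp only: add scaleR real_scaleR_def)
  qed
  \<comment> \<open>On the unit circle the conjugate of \<open>exp_char 1 x\<close> is
    \<open>exp_char (-1) x\<close>, so a real linear functional is a combination of the frequencies
    1 and -1.\<close>
  have "of_real (f (exp_char 1 x)) =
      ((of_real (f 1) - \<i> * of_real (f \<i>)) / 2) * exp_char (of_int 1) x
    + ((of_real (f 1) + \<i> * of_real (f \<i>)) / 2) * exp_char (of_int (-1)) x" for x
    unfolding f[of "exp_char 1 x"] by (simp add: exp_char_cis complex_eq_iff field_simps)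
  then show ?case
    by (simp only: trig_poly.add[OF trig_poly.monom trig_poly.monom])
next
  case (const c)
  then show ?case by (rule trig_poly_const)
next
  case (add f g)
  then show ?case using trig_poly.add[OF add.IH] by simp
next
  case (mult f g)
  then show ?case using trig_poly_mult[OF mult.IH] by simp
qed

lemma trig_poly_polynomial:
  assumes "polynomial_function (p :: complex \<Rightarrow> complex)"
  shows "trig_poly (\<lambda>x. p (exp_char 1 x))"
proof -
  have "real_polynomial_function (Re \<circ> p)" "real_polynomial_function (Im \<circ> p)"
    using assms bounded_linear_Re bounded_linear_Im unfolding polynomial_function_def by blast+
  then have 1: "trig_poly (\<lambda>x. of_real (Re (p (exp_char 1 x))))" "trig_poly (\<lambda>x. of_real (Im (p (exp_char 1 x))))"
    by (auto dest!: trig_poly_real_polynomial simp: o_def)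
  have "trig_poly (\<lambda>x. of_real (Re (p (exp_char 1 x))) + \<i> * of_real (Im (p (exp_char 1 x))))"
    by (intro trig_poly.add trig_poly_mult 1 trig_poly_const)
  then show ?thesis by (simp add: complex_eq[symmetric])
qed

text \<open>The cut-off factor vanishes at the point \<open>1\<close> of the circle, where the function \<open>g\<close> of the angle jumps.\<close>

lemma uniform_trig_approx:
  fixes g :: "real \<Rightarrow> complex"
  assumes g: "continuous_on UNIV g" and e: "e > 0" and m: "m \<ge> 0"
  obtains p where "trig_poly p"
    "\<And>x. 0 < x \<Longrightarrow> x < 1 \<Longrightarrow> cmod (of_real (min 1 (m * cmod (exp_char 1 x - 1))) * g x - p x) < e"
proof -
  define G where "G z = of_real (min 1 (m * cmod (z - 1))) * g (Arg2pi z / (2 * pi))" for z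
  have "bounded (g ` {0..1})"
    by (intro compact_imp_bounded compact_continuous_image continuous_on_subset[OF g]) auto
  then obtain B where B: "\<And>x. x \<in> {0..1} \<Longrightarrow> cmod (g x) \<le> B"
    unfolding bounded_iff by blast
  have G_bound: "cmod (G z) \<le> m * cmod (z - 1) * B" for z
  proof -
    have "cmod (G z) = \<bar>min 1 (m * cmod (z - 1))\<bar> * cmod (g (Arg2pi z / (2 * pi)))"
      by (simp add: G_def norm_mult)
    also have "\<dots> \<le> (m * cmod (z - 1)) * B"
      using m Arg2pi_ge_0[of z] Arg2pi_lt_2pi[of z] by (intro mult_mono B) (auto simp: field_simps)
    finally show ?thesis .
  qed
  have cont: "continuous_on (sphere 0 1) G"
    unfolding continuous_on_eq_continuous_within
  proof
    fix z :: complex assume z: "z \<in> sphere 0 1"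
    show "continuous (at z within sphere 0 1) G"
    proof (cases "z = 1")
      case True
      have "((\<lambda>z. m * cmod (z - 1) * B) \<longlongrightarrow> m * cmod (1 - 1) * B) (at 1 within sphere 0 1)"
        by (intro tendsto_intros)
      then have lim0: "((\<lambda>z. m * cmod (z - 1) * B) \<longlongrightarrow> 0) (at 1 within sphere 0 1)" by simp
      have "(G \<longlongrightarrow> 0) (at 1 within sphere 0 1)"
        by (rule Lim_null_comparison[OF _ lim0]) (simp add: G_bound)
      moreover have "G 1 = 0" using m by (simp add: G_def)
      ultimately show ?thesis using True by (simp add: continuous_within)
    next
      case False
      \<comment> \<open>The branch cut of \<open>Arg2pi\<close> meets the circle only in the point
        1, so away from it the angle is continuous.\<close>
      have "z \<notin> \<real>\<^sub>\<ge>\<^sub>0"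
      proof
        assume "z \<in> \<real>\<^sub>\<ge>\<^sub>0"
        then obtain r where "z = of_real r" "r \<ge> 0" by (auto elim: nonneg_Reals_cases)
        then show False using z False by simp
      qed
      then have "isCont Arg2pi z" by (rule continuous_at_Arg2pi)
      then have "isCont (\<lambda>z. g (Arg2pi z / (2 * pi))) z"
        using g unfolding continuous_on_eq_continuous_at[OF open_UNIV]
        by (intro isCont_o2[of z "\<lambda>z. Arg2pi z / (2 * pi)" g] isCont_divide) simp_all
      then have "isCont G z" unfolding G_def by (intro continuous_intros) auto
      then show ?thesis by (rule continuous_at_imp_continuous_within)
    qed
  qed
  obtain p where p: "polynomial_function p" "\<And>z. z \<in> sphere 0 1 \<Longrightarrow> cmod (G z - p z) < e"
    using Stone_Weierstrass_polynomial_function[OF compact_sphere cont e] by blast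
  show ?thesis
  proof (rule that[OF trig_poly_polynomial[OF p(1)]])
    fix x :: real assume x: "0 < x" "x < 1"
    have "Arg2pi (exp_char 1 x) = 2 * pi * x"
      by (rule Arg2pi_unique[of 1]) (use x in \<open>auto simp: exp_char_def mult_ac\<close>)
    then have "G (exp_char 1 x) = of_real (min 1 (m * cmod (exp_char 1 x - 1))) * g x"
      by (simp add: G_def)
    then show "cmod (of_real (min 1 (m * cmod (exp_char 1 x - 1))) * g x - p (exp_char 1 x)) < e"
      using p(2)[of "exp_char 1 x"] by simp
  qed
qed

lemma integral_norm_diff_squared_triangle:
  assumes "sqint M f" "sqint M g" "sqint M h"
  shows "(LINT x|M. (cmod (f x - h x))\<^sup>2) \<le> 2 * (LINT x|M. (cmod (f x - g x))\<^sup>2) + 2 * (LINT x|M. (cmod (g x - h x))\<^sup>2)"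
proof -
  have s: "sqint M (\<lambda>x. f x - h x)" "sqint M (\<lambda>x. f x - g x)" "sqint M (\<lambda>x. g x - h x)"
    using assms by (auto intro: sqint_diff)
  have "(LINT x|M. (cmod (f x - h x))\<^sup>2) \<le> (LINT x|M. 2 * (cmod (f x - g x))\<^sup>2 + 2 * (cmod (g x - h x))\<^sup>2)"
    using s norm_add_squared_le[of "f x - g x" "g x - h x" for x] by (intro integral_mono) (auto simp: sqint_def)
  then show ?thesis using s by (simp add: sqint_def)
qed

section \<open>Truncation of square-integrable functions\<close>

text \<open>The radial retraction onto the closed disc of radius \<open>K\<close>. Being continuous,
  it preserves both measurability and continuity, which a cut-off by cases would not.\<close>

definition clip :: "real \<Rightarrow> complex \<Rightarrow> complex"
  where "clip K z = z / of_real (max 1 (cmod z / K))"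

lemma norm_clip_le: "K > 0 \<Longrightarrow> cmod (clip K z) \<le> K"
  by (auto simp: clip_def norm_divide max_def field_simps)

lemma clip_id: "K > 0 \<Longrightarrow> cmod z \<le> K \<Longrightarrow> clip K z = z"
  by (simp add: clip_def max_def field_simps)

lemma norm_diff_clip_le: "K > 0 \<Longrightarrow> cmod (z - clip K z) \<le> cmod z"
proof -
  assume K: "K > 0"
  define m where "m = max 1 (cmod z / K)"
  have m: "m \<ge> 1" by (simp add: m_def)
  have "z - clip K z = of_real (1 - 1 / m) * z"
    using m by (simp add: clip_def m_def[symmetric] field_simps)
  then have "cmod (z - clip K z) = \<bar>1 - 1 / m\<bar> * cmod z" by (simp only: norm_mult norm_of_real)
  also have "\<dots> \<le> 1 * cmod z" using m by (intro mult_right_mono) auto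
  finally show ?thesis by simp
qed

lemma continuous_clip: "K > 0 \<Longrightarrow> continuous_on UNIV (clip K)"
  unfolding clip_def by (intro continuous_intros) auto

lemma measurable_clip: "K > 0 \<Longrightarrow> f \<in> borel_measurable M \<Longrightarrow> (\<lambda>x. clip K (f x)) \<in> borel_measurable M"
  by (rule borel_measurable_continuous_on[OF continuous_clip])

lemma clip_approx:
  assumes f: "sqint M f" and e: "e > 0"
  obtains K where "K > 0" "(LINT x|M. (cmod (f x - clip K (f x)))\<^sup>2) < e"
proof -
  have [measurable]: "f \<in> borel_measurable M" using f by (simp add: sqint_def)
  have "(\<lambda>n. (LINT x|M. (cmod (f x - clip (real (Suc n)) (f x)))\<^sup>2)) \<longlonglongrightarrow> (LINT x|M. 0)"
  proof (rule integral_dominated_convergence[where w="\<lambda>x. (cmod (f x))\<^sup>2"])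
    show "integrable M (\<lambda>x. (cmod (f x))\<^sup>2)" using f by (simp add: sqint_def)
    show "(\<lambda>x. (cmod (f x - clip (real (Suc n)) (f x)))\<^sup>2) \<in> borel_measurable M" for n
      using measurable_clip[of "real (Suc n)" f M] by measurable
    show "AE x in M. (\<lambda>n. (cmod (f x - clip (real (Suc n)) (f x)))\<^sup>2) \<longlonglongrightarrow> 0"
    proof (intro AE_I2 tendsto_eventually)
      fix x
      obtain N :: nat where "cmod (f x) \<le> real N" using real_arch_simple by blast
      then show "\<forall>\<^sub>F n in sequentially. (cmod (f x - clip (real (Suc n)) (f x)))\<^sup>2 = 0"
        by (intro eventually_sequentiallyI[of N]) (simp add: clip_id)
    qed
    show "AE x in M. norm ((cmod (f x - clip (real (Suc n)) (f x)))\<^sup>2) \<le> (cmod (f x))\<^sup>2" for n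
      using norm_diff_clip_le[of "real (Suc n)"] by (intro AE_I2) (auto intro!: power_mono)
  qed auto
  then have "\<forall>\<^sub>F n in sequentially. (LINT x|M. (cmod (f x - clip (real (Suc n)) (f x)))\<^sup>2) < e"
    using e by (intro order_tendstoD(2)) auto
  then obtain n where "(LINT x|M. (cmod (f x - clip (real (Suc n)) (f x)))\<^sup>2) < e"
    unfolding eventually_sequentially by auto
  then show ?thesis using that[of "real (Suc n)"] by simp
qed

lemma lmeasurable_half_open [simp]: "{a..<b :: real} \<in> lmeasurable"
  by (intro bounded_set_imp_lmeasurable) auto

lemma exp_dense_unit_interval: "exp_dense {0..<1} \<int>"
  unfolding exp_dense_iff
proof (intro allI impI)
  let ?I = "{0..<1::real}" let ?M = "lebesgue_on ?I"
  interpret finite_measure ?M by (rule finite_measure_lebesgue_on) auto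
  fix f and e :: real assume f: "sqint ?M f" and e: "e > 0"
  \<comment> \<open>The error budget: truncation costs less than \<open>e / 4\<close>, the two later
    approximations at most \<open>e / 16\<close> each, and two uses of the squared triangle
    inequality weight them by 2, 4 and 4.\<close>
  obtain K where K: "K > 0" and fK: "(LINT x|?M. (cmod (f x - clip K (f x)))\<^sup>2) < e / 4"
    using clip_approx[OF f, of "e / 4"] e by auto
  have fm: "f \<in> borel_measurable ?M" using f by (simp add: sqint_def)
  then have "f measurable_on ?I" by (simp add: measurable_on_iff_borel_measurable)
  then obtain N g where N: "negligible N" and g: "\<And>n. continuous_on UNIV (g n)"
    and lim: "\<And>x. x \<notin> N \<Longrightarrow> (\<lambda>n. g n x) \<longlonglongrightarrow> (if x \<in> ?I then f x else 0)"
    unfolding measurable_on_def by auto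
  \<comment> \<open>The cut-off slope \<open>n\<close> grows, so at every point of the interval
    other than 0 the cut-off is eventually 1 and does not disturb the limit; the single point 0 is
    null.\<close>
  define h where "h n x = of_real (min 1 (real n * cmod (exp_char 1 x - 1))) * clip K (g n x)" for n x
  have cg: "continuous_on UNIV (\<lambda>x. clip K (g n x))" for n
    using continuous_on_compose2[OF continuous_clip[OF K] g] by simp
  have "continuous_on UNIV (h n)" for n
    unfolding h_def by (intro continuous_intros cg)
  then have hm: "h n \<in> borel_measurable ?M" for n
    using continuous_imp_measurable_on_sets_lebesgue[of UNIV "h n"]
    by (simp add: lebesgue_on_UNIV_eq measurable_restrict_space1)
  have h_bound: "cmod (h n x) \<le> K" for n x
  proof -
    have "cmod (h n x) = \<bar>min 1 (real n * cmod (exp_char 1 x - 1))\<bar> * cmod (clip K (g n x))"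
      by (simp add: h_def norm_mult)
    also have "\<dots> \<le> 1 * K" by (intro mult_mono norm_clip_le K) auto
    finally show ?thesis by simp
  qed
  have sq: "sqint ?M (\<lambda>x. clip K (f x))" "sqint ?M (h n)" for n
    using sqint_bounded[of ?M "\<lambda>x. clip K (f x)" K] sqint_bounded[of ?M "h n" K] measurable_clip[OF K fm] hm
      norm_clip_le[OF K] h_bound finite_measure_axioms by auto
  have h_lim: "(\<lambda>n. h n x) \<longlonglongrightarrow> clip K (f x)" if "x \<in> ?I" "x \<notin> N" "x \<noteq> 0" for x
  proof -
    have "exp_char 1 x \<noteq> 1"
    proof
      assume "exp_char 1 x = 1"
      then obtain k where "2 * pi * x = of_int k * 2 * pi"
        by (auto simp: exp_char_def exp_eq_1 mult_ac)
      then have "x = of_int k" by simp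
      then show False using that by auto
    qed
    then have c: "cmod (exp_char 1 x - 1) > 0" by simp
    obtain n0 :: nat where "1 / cmod (exp_char 1 x - 1) \<le> real n0" using real_arch_simple by blast
    then have "min 1 (real n * cmod (exp_char 1 x - 1)) = 1" if "n \<ge> n0" for n
    proof -
      have "1 \<le> real n0 * cmod (exp_char 1 x - 1)"
        using \<open>1 / cmod (exp_char 1 x - 1) \<le> real n0\<close> c by (simp add: field_simps)
      also have "\<dots> \<le> real n * cmod (exp_char 1 x - 1)" using that by (intro mult_right_mono) auto
      finally show ?thesis by simp
    qed
    then have "\<forall>\<^sub>F n in sequentially. clip K (g n x) = h n x"
      by (intro eventually_sequentiallyI[of n0]) (simp add: h_def)
    moreover have "(\<lambda>n. clip K (g n x)) \<longlonglongrightarrow> clip K (f x)"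
      using lim[OF that(2)] that(1) continuous_clip[OF K]
      by (intro continuous_on_tendsto_compose[of UNIV "clip K"]) auto
    ultimately show ?thesis by (rule Lim_transform_eventually[rotated])
  qed
  have "AE x in lebesgue. x \<notin> N" "AE x in lebesgue. x \<notin> {0}"
    using N AE_not_in[of "{0}" lebesgue] AE_not_in[of N lebesgue] by (simp_all add: negligible_iff_null_sets)
  then have ae: "AE x in ?M. (\<lambda>n. h n x) \<longlonglongrightarrow> clip K (f x)"
    unfolding AE_restrict_space_iff[of ?I lebesgue, simplified] by eventually_elim (use h_lim in auto)
  have "(\<lambda>n. (LINT x|?M. (cmod (clip K (f x) - h n x))\<^sup>2)) \<longlonglongrightarrow> (LINT x|?M. 0)"
  proof (rule integral_dominated_convergence[where w="\<lambda>x. (2 * K)\<^sup>2"])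
    show "(\<lambda>x. (cmod (clip K (f x) - h n x))\<^sup>2) \<in> borel_measurable ?M" for n
      using measurable_clip[OF K fm] hm[of n] by measurable
    show "AE x in ?M. (\<lambda>n. (cmod (clip K (f x) - h n x))\<^sup>2) \<longlonglongrightarrow> 0"
      using ae
    proof eventually_elim
      case (elim x)
      then have "(\<lambda>n. (cmod (clip K (f x) - h n x))\<^sup>2) \<longlonglongrightarrow> (cmod (clip K (f x) - clip K (f x)))\<^sup>2"
        by (intro tendsto_intros)
      then show ?case by simp
    qed
    show "AE x in ?M. norm ((cmod (clip K (f x) - h n x))\<^sup>2) \<le> (2 * K)\<^sup>2" for n
    proof (intro AE_I2)
      fix x
      have "cmod (clip K (f x) - h n x) \<le> K + K"
        using norm_triangle_ineq4[of "clip K (f x)" "h n x"] norm_clip_le[OF K, of "f x"] h_bound[of n x] by linarith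
      then have "(cmod (clip K (f x) - h n x))\<^sup>2 \<le> (2 * K)\<^sup>2" by (intro power_mono) auto
      then show "norm ((cmod (clip K (f x) - h n x))\<^sup>2) \<le> (2 * K)\<^sup>2" by simp
    qed
  qed auto
  then have "\<forall>\<^sub>F n in sequentially. (LINT x|?M. (cmod (clip K (f x) - h n x))\<^sup>2) < e / 16"
    using e by (intro order_tendstoD(2)) auto
  then obtain n where n: "(LINT x|?M. (cmod (clip K (f x) - h n x))\<^sup>2) < e / 16"
    unfolding eventually_sequentially by auto
  have "sqrt (e / 16) > 0" using e by simp
  then obtain p where p: "trig_poly p" "\<And>x. 0 < x \<Longrightarrow> x < 1 \<Longrightarrow> cmod (h n x - p x) < sqrt (e / 16)"
    using uniform_trig_approx[OF cg[of n], of "sqrt (e / 16)" "real n"] unfolding h_def by auto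
  have sp: "sqint ?M p"
    by (rule sqint_exp_comb[OF _ trig_poly_exp_comb[OF p(1)]]) simp
  have pe: "(cmod (h n x - p x))\<^sup>2 \<le> e / 16" if "0 < x" "x < 1" for x
  proof -
    have "(cmod (h n x - p x))\<^sup>2 \<le> (sqrt (e / 16))\<^sup>2"
      using p(2)[OF that] by (intro power_mono) auto
    then show ?thesis using e by simp
  qed
  have "(LINT x|?M. (cmod (h n x - p x))\<^sup>2) \<le> (LINT x|?M. e / 16)"
  proof (rule integral_mono_AE)
    show "integrable ?M (\<lambda>x. (cmod (h n x - p x))\<^sup>2)" using sqint_diff[OF sq(2) sp] by (simp add: sqint_def)
    have "AE x in lebesgue. x \<notin> {0::real}" by (intro AE_not_in) auto
    then show "AE x in ?M. (cmod (h n x - p x))\<^sup>2 \<le> e / 16"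
      unfolding AE_restrict_space_iff[of ?I lebesgue, simplified]
      by eventually_elim (use pe in auto)
  qed auto
  also have "\<dots> = e / 16" by (simp add: measure_lebesgue_on_self)
  finally have "(LINT x|?M. (cmod (h n x - p x))\<^sup>2) \<le> e / 16" .
  then have "(LINT x|?M. (cmod (f x - p x))\<^sup>2) < e"
    using integral_norm_diff_squared_triangle[OF f sq(1) sp] fK n
      integral_norm_diff_squared_triangle[OF sq(1) sq(2)[of n] sp] by linarith
  then show "\<exists>p. exp_comb \<int> p \<and> (LINT x|?M. (cmod (f x - p x))\<^sup>2) < e"
    using trig_poly_exp_comb[OF p(1)] by blast
qed

lemma integrable_exp_char: "S \<in> lmeasurable \<Longrightarrow> integrable (lebesgue_on S) (exp_char l)"
  by (rule finite_measure.integrable_const_bound[OF finite_measure_lebesgue_on, of _ _ 1]) simp_all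

lemma integral_exp_char_interval:
  assumes "a \<le> b" "l \<noteq> 0"
  shows "(LINT x|lebesgue_on {a..b}. exp_char l x) = (exp_char l b - exp_char l a) / (2 * of_real pi * \<i> * of_real l)"
proof -
  have "(exp_char l has_integral (exp_char l b / (2 * of_real pi * \<i> * of_real l) - exp_char l a / (2 * of_real pi * \<i> * of_real l))) {a..b}"
  proof (rule fundamental_theorem_of_calculus[OF assms(1)])
    fix x
    show "((\<lambda>x. exp_char l x / (2 * of_real pi * \<i> * of_real l)) has_vector_derivative exp_char l x) (at x within {a..b})"
      unfolding exp_char_def using assms(2)
      by (auto intro!: derivative_eq_intros has_vector_derivative_real_field simp: field_simps)
  qed
  moreover have "integrable (lebesgue_on {a..b}) (exp_char l)"
    by (rule integrable_exp_char) simp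
  ultimately show ?thesis
    by (simp add: lebesgue_integral_eq_integral integral_unique diff_divide_distrib)
qed

lemma integral_half_open_eq_closed:
  fixes f :: "real \<Rightarrow> 'b::euclidean_space"
  assumes f: "f \<in> borel_measurable lebesgue"
  shows "(LINT x|lebesgue_on {a..<b}. f x) = (LINT x|lebesgue_on {a..b}. f x)"
proof -
  have "(LINT x|lebesgue. (if x \<in> {a..<b} then f x else 0)) = (LINT x|lebesgue. (if x \<in> {a..b} then f x else 0))"
  proof (rule integral_cong_AE)
    show "(\<lambda>x. if x \<in> {a..<b} then f x else 0) \<in> borel_measurable lebesgue"
      "(\<lambda>x. if x \<in> {a..b} then f x else 0) \<in> borel_measurable lebesgue"
      by (rule borel_measurable_if_I, rule measurable_restrict_space1[OF f], simp)+
    have "AE x in lebesgue. x \<notin> {b}" by (intro AE_not_in) auto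
    then show "AE x in lebesgue. (if x \<in> {a..<b} then f x else 0) = (if x \<in> {a..b} then f x else 0)"
      by eventually_elim auto
  qed
  then show ?thesis by (subst (asm) (1 2) Lebesgue_Measure.integral_restrict_UNIV) auto
qed

lemma hat_unit_interval:
  "l \<noteq> 0 \<Longrightarrow> hat {0..<1} l = (exp_char l 1 - 1) / (2 * of_real pi * \<i> * of_real l)"
  unfolding hat_def by (simp add: integral_half_open_eq_closed integral_exp_char_interval)

lemma exp_char_eq_1_iff: "exp_char l 1 = 1 \<longleftrightarrow> l \<in> \<int>"
proof
  assume "exp_char l 1 = 1"
  then obtain k where "2 * pi * l = of_int k * 2 * pi" by (auto simp: exp_char_def exp_eq_1 mult_ac)
  then show "l \<in> \<int>" by simp
qed (simp add: exp_char_int)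

lemma hat_unit_interval_eq_0_iff: "hat {0..<1} l = 0 \<longleftrightarrow> l \<in> \<int> \<and> l \<noteq> 0"
  by (cases "l = 0") (auto simp: hat_unit_interval hat_0 exp_char_eq_1_iff)

lemma spectrum_unit_interval: "is_spectrum {0..<1} \<int>"
  by (auto simp: is_spectrum_iff exp_dense_unit_interval hat_orth_def hat_unit_interval_eq_0_iff)

section \<open>Fibres over the unit interval\<close>

text \<open>The fibre of \<open>S\<close> over \<open>x\<close> under reduction modulo 1.\<close>

definition pat :: "real set \<Rightarrow> real \<Rightarrow> int set"
  where "pat S x = {k. x + of_int k \<in> S}"

text \<open>\<open>G\<close> is a spectrum of the finite set \<open>A\<close>: the characters with
  frequencies in \<open>G\<close> are orthogonal on \<open>A\<close>, and equality of the
  cardinalities expresses completeness by dimension.\<close>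

definition dual_set :: "real set \<Rightarrow> int set \<Rightarrow> bool"
  where "dual_set G A \<longleftrightarrow> finite A \<and> card A = card G \<and>
    (\<forall>g\<in>G. \<forall>h\<in>G. g \<noteq> h \<longrightarrow> (\<Sum>a\<in>A. exp_char (g - h) (of_int a)) = 0)"

lemma pat_subset:
  assumes "S \<subseteq> {- real B..<real B}" "x \<in> {0..<1}"
  shows "pat S x \<subseteq> {- int B..<int B}"
proof
  fix k assume "k \<in> pat S x"
  then have "- real B \<le> x + of_int k" "x + of_int k < real B"
    using assms(1) by (auto simp: pat_def)
  then have "of_int (- int B) < of_int (k + 1) + (0 :: real)" "of_int k < (of_int (int B) :: real)"
    using assms(2) by auto
  then show "k \<in> {- int B..<int B}" unfolding add_0_right of_int_less_iff by auto
qed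

lemma finite_pat:
  assumes "S \<subseteq> {- real B..<real B}" "x \<in> {0..<1}"
  shows "finite (pat S x)"
  using finite_subset[OF pat_subset[OF assms]] by auto

lemma sum_pat:
  fixes h :: "real \<Rightarrow> 'b :: comm_monoid_add"
  assumes "S \<subseteq> {- real B..<real B}" "x \<in> {0..<1}"
  shows "(\<Sum>k\<in>pat S x. h (x + of_int k)) = (\<Sum>k\<in>{- int B..<int B}. if x + of_int k \<in> S then h (x + of_int k) else 0)"
  using pat_subset[OF assms]
  by (subst sum.inter_filter[symmetric]) (auto intro!: sum.cong simp: pat_def)

text \<open>Periodisation: the line is cut into unit intervals and each is moved back to the first
  one. Boundedness of \<open>S\<close> leaves finitely many intervals, so no convergence question
  arises.\<close>

lemma
  fixes h :: "real \<Rightarrow> 'b::euclidean_space"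
  assumes S: "S \<in> sets lebesgue" "S \<subseteq> {- real B..<real B}" and h: "integrable (lebesgue_on S) h"
  shows integrable_fibre_sum: "integrable (lebesgue_on {0..<1}) (\<lambda>x. \<Sum>k\<in>pat S x. h (x + of_int k))"
    and integral_fibre_sum: "(LINT x|lebesgue_on S. h x) = (LINT x|lebesgue_on {0..<1}. (\<Sum>k\<in>pat S x. h (x + of_int k)))"
proof -
  define h0 where "h0 x = (if x \<in> S then h x else 0)" for x
  define K where "K = {- int B..<int B}"
  have h0: "integrable lebesgue h0"
    unfolding h0_def using h S by (subst Lebesgue_Measure.integrable_restrict_UNIV)
  have piece: "integrable lebesgue (\<lambda>x. if x \<in> {of_int k..<of_int k + 1} then h0 x else 0)" for k :: int
    using integrable_mult_indicator[OF _ h0, of "{of_int k..<of_int k + 1}"]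
    by (simp add: indicator_scaleR_eq_if)
  have h0_sum: "h0 x = (\<Sum>k\<in>K. if x \<in> {of_int k..<of_int k + 1} then h0 x else 0)" for x
  proof (cases "x \<in> S")
    case True
    then have "\<lfloor>x\<rfloor> \<in> K" using S(2) by (auto simp: K_def le_floor_iff floor_less_iff)
    moreover have "x \<in> {of_int k..<of_int k + 1} \<longleftrightarrow> k = \<lfloor>x\<rfloor>" for k
      by (auto simp: floor_eq_iff eq_commute[of k])
    ultimately show ?thesis by (simp add: K_def)
  next
    case False
    then have "h0 x = 0" by (simp add: h0_def)
    then show ?thesis by (intro trans[OF _ sum.neutral[symmetric]]) auto
  qed
  have shift: "(\<lambda>x. if of_int k + 1 * x \<in> {of_int k..<of_int k + 1} then h0 (of_int k + 1 * x) else 0) =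
      (\<lambda>x. if x \<in> {0..<1} then h0 (x + of_int k) else 0)" for k
    by (auto simp: add.commute)
  have piece': "integrable lebesgue (\<lambda>x. if x \<in> {0..<1} then h0 (x + of_int k) else 0)" for k
    using lebesgue_integrable_real_affine[OF piece[of k], of 1 "of_int k"] unfolding shift by simp
  then have piece_on: "integrable (lebesgue_on {0..<1}) (\<lambda>x. h0 (x + of_int k))" for k
    by (subst (asm) Lebesgue_Measure.integrable_restrict_UNIV) auto
  have eq: "(\<Sum>k\<in>pat S x. h (x + of_int k)) = (\<Sum>k\<in>K. h0 (x + of_int k))" if "x \<in> {0..<1}" for x
    unfolding sum_pat[OF S(2) that] by (simp add: K_def h0_def)
  show "integrable (lebesgue_on {0..<1}) (\<lambda>x. \<Sum>k\<in>pat S x. h (x + of_int k))"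
    by (subst Bochner_Integration.integrable_cong[OF refl eq]) (auto intro!: Bochner_Integration.integrable_sum piece_on)
  have "(LINT x|lebesgue_on S. h x) = (LINT x|lebesgue. h0 x)"
    unfolding h0_def using S(1) by (rule Lebesgue_Measure.integral_restrict_UNIV[symmetric])
  also have "\<dots> = (LINT x|lebesgue. (\<Sum>k\<in>K. if x \<in> {of_int k..<of_int k + 1} then h0 x else 0))"
    by (rule Bochner_Integration.integral_cong[OF refl h0_sum])
  also have "\<dots> = (\<Sum>k\<in>K. (LINT x|lebesgue. (if x \<in> {of_int k..<of_int k + 1} then h0 x else 0)))"
    by (rule Bochner_Integration.integral_sum) (rule piece)
  also have "\<dots> = (\<Sum>k\<in>K. (LINT x|lebesgue. (if x \<in> {0..<1} then h0 (x + of_int k) else 0)))"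
  proof (rule sum.cong[OF refl])
    fix k :: int
    show "(LINT x|lebesgue. (if x \<in> {of_int k..<of_int k + 1} then h0 x else 0)) = (LINT x|lebesgue. (if x \<in> {0..<1} then h0 (x + of_int k) else 0))"
      unfolding lebesgue_integral_real_affine[of 1 "\<lambda>x. if x \<in> {of_int k..<of_int k + 1} then h0 x else 0" "of_int k", OF one_neq_zero] shift
      by simp
  qed
  also have "\<dots> = (\<Sum>k\<in>K. (LINT x|lebesgue_on {0..<1}. h0 (x + of_int k)))"
    by (intro sum.cong refl Lebesgue_Measure.integral_restrict_UNIV) auto
  also have "\<dots> = (LINT x|lebesgue_on {0..<1}. (\<Sum>k\<in>K. h0 (x + of_int k)))"
    by (intro Bochner_Integration.integral_sum[symmetric] piece_on)
  also have "\<dots> = (LINT x|lebesgue_on {0..<1}. (\<Sum>k\<in>pat S x. h (x + of_int k)))"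
    by (intro Bochner_Integration.integral_cong refl) (simp add: eq)
  finally show "(LINT x|lebesgue_on S. h x) = (LINT x|lebesgue_on {0..<1}. (\<Sum>k\<in>pat S x. h (x + of_int k)))" .
qed

lemma sqint_shift:
  fixes S :: "real set"
  assumes S: "S \<in> sets lebesgue" and f: "sqint (lebesgue_on S) f"
  shows "sqint (lebesgue_on {0..<1}) (\<lambda>x. if x + of_int k \<in> S then f (x + of_int k) else 0)"
proof -
  have m: "(\<lambda>x. if x \<in> S then f x else 0) \<in> borel_measurable lebesgue"
    using f S by (intro borel_measurable_if_I) (auto simp: sqint_def)
  have "(\<lambda>x. if of_int k + 1 *\<^sub>R x \<in> S then f (of_int k + 1 *\<^sub>R x) else 0) \<in> borel_measurable lebesgue"
    using borel_measurable_affine[OF m, of 1 "of_int k"] by simp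
  then have 1: "(\<lambda>x. if x + of_int k \<in> S then f (x + of_int k) else 0) \<in> borel_measurable lebesgue"
    by (simp add: add.commute cong: if_cong)
  have i: "integrable lebesgue (\<lambda>x. if x \<in> S then (cmod (f x))\<^sup>2 else 0)"
    using f S by (subst Lebesgue_Measure.integrable_restrict_UNIV) (auto simp: sqint_def)
  have "integrable lebesgue (\<lambda>x. if x + of_int k \<in> S then (cmod (f (x + of_int k)))\<^sup>2 else 0)"
    using lebesgue_integrable_real_affine[OF i, of 1 "of_int k"] by (simp add: add.commute cong: if_cong)
  then have "integrable lebesgue (\<lambda>x. indicator {0..<1} x *\<^sub>R (if x + of_int k \<in> S then (cmod (f (x + of_int k)))\<^sup>2 else 0))"
    by (rule integrable_mult_indicator[rotated]) simp
  then have "integrable (lebesgue_on {0..<1}) (\<lambda>x. if x + of_int k \<in> S then (cmod (f (x + of_int k)))\<^sup>2 else 0)"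
    by (subst integrable_restrict_space) auto
  moreover have "(\<lambda>x. (cmod (if x + of_int k \<in> S then f (x + of_int k) else 0))\<^sup>2) = (\<lambda>x. if x + of_int k \<in> S then (cmod (f (x + of_int k)))\<^sup>2 else 0)"
    by auto
  ultimately show ?thesis using 1 by (simp add: sqint_def measurable_restrict_space1)
qed

lemma ex_AE_unit_interval:
  assumes "AE x in lebesgue_on {0..<1::real}. P x"
  obtains x where "x \<in> {0..<1}" "P x"
proof -
  have "\<exists>x\<in>{0..<1}. P x"
  proof (rule ccontr)
    assume "\<not> (\<exists>x\<in>{0..<1}. P x)"
    then have nP: "\<not> P x" if "x \<in> {0..<1}" for x using that by blast
    have "AE x in lebesgue_on {0..<1::real}. False"
      by (rule AE_mp[OF assms, OF AE_I2]) (simp add: nP)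
    then have "emeasure (lebesgue_on {0..<1::real}) {0..<1} = 0"
      using AE_iff_measurable[of "{0..<1}" "lebesgue_on {0..<1::real}" "\<lambda>_. False"]
      by (simp add: atLeastLessThan_def atLeast_def lessThan_def Collect_conj_eq)
    then show False by (simp add: emeasure_restrict_space)
  qed
  then show ?thesis using that by blast
qed

section \<open>Finite orthogonality on sets of integers\<close>

lemma integral_count_space_finite: "finite A \<Longrightarrow> (LINT a|count_space A. f a) = (\<Sum>a\<in>A. f a)"
  by (rule lebesgue_integral_count_space_finite)

lemma orthogonal_family_dual:
  assumes "finite A" "finite G" "\<And>g h. g \<in> G \<Longrightarrow> h \<in> G \<Longrightarrow> g \<noteq> h \<Longrightarrow> (\<Sum>a\<in>A. exp_char (g - h) (of_int a)) = 0"
  shows "orthogonal_family (count_space A) G (\<lambda>g a. exp_char g (of_int a)) (card A)"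
  using assms
  by unfold_locales (auto simp: sqint_def ip_def integral_count_space_finite integrable_count_space exp_char_diff)

text \<open>Bessel's inequality for a point mass: each of its coefficients has modulus one, so the
  left side counts \<open>G\<close>, while the right side is \<open>card A\<close>.\<close>

lemma card_le_of_orthogonal:
  assumes A: "finite A" "A \<noteq> {}" and G: "finite G"
    and o: "\<And>g h. g \<in> G \<Longrightarrow> h \<in> G \<Longrightarrow> g \<noteq> h \<Longrightarrow> (\<Sum>a\<in>A. exp_char (g - h) (of_int a)) = 0"
  shows "card G \<le> card A"
proof -
  interpret orthogonal_family "count_space A" G "\<lambda>g a. exp_char g (of_int a)" "card A"
    by (rule orthogonal_family_dual[OF A(1) G o])
  obtain a where a: "a \<in> A" using A by auto
  have V: "real (card A) > 0" using A by (simp add: card_gt_0_iff)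
  define f where "f b = (if b = a then 1 else 0 :: complex)" for b
  have f: "sqint (count_space A) f" using A by (simp add: sqint_def integrable_count_space)
  have "ip (count_space A) f (\<lambda>a. exp_char g (of_int a)) = cnj (exp_char g (of_int a))" for g
    using A a by (simp add: ip_def integral_count_space_finite f_def if_distrib[of "\<lambda>x. x * _"] cong: if_cong)
  moreover have "(LINT b|count_space A. (cmod (f b))\<^sup>2) = 1"
    using A a by (simp add: integral_count_space_finite f_def if_distrib[of cmod] if_distrib[of "\<lambda>x. x\<^sup>2"] cong: if_cong)
  ultimately show ?thesis using bessel[OF f V] by simp
qed

text \<open>
  Since all characters have modulus one, the projection of a point mass onto their span has the
  same norm as the point mass; hence orthogonality of the rows implies orthogonality of the columns.
\<close>

lemma dual_set_columns:
  assumes d: "dual_set G A" and G: "finite G" and ab: "a \<in> A" "b \<in> A"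
  shows "(\<Sum>g\<in>G. exp_char g (of_int b - of_int a)) = (if b = a then of_nat (card G) else 0)"
proof -
  have A: "finite A" "card A = card G" using d by (auto simp: dual_set_def)
  interpret orthogonal_family "count_space A" G "\<lambda>g a. exp_char g (of_int a)" "card A"
    by (rule orthogonal_family_dual[OF A(1) G]) (use d in \<open>auto simp: dual_set_def\<close>)
  have "A \<noteq> {}" using ab by auto
  then have V: "real (card A) > 0" using A(1) by (simp add: card_gt_0_iff)
  define f where "f b = (if b = a then 1 else 0 :: complex)" for b
  have f: "sqint (count_space A) f" using A by (simp add: sqint_def integrable_count_space)
  have ip: "ip (count_space A) f (\<lambda>a. exp_char g (of_int a)) = cnj (exp_char g (of_int a))" for g
    using A ab by (simp add: ip_def integral_count_space_finite f_def if_distrib[of "\<lambda>x. x * _"] cong: if_cong)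
  have nf: "(LINT b|count_space A. (cmod (f b))\<^sup>2) = 1"
    using A ab by (simp add: integral_count_space_finite f_def if_distrib[of cmod] if_distrib[of "\<lambda>x. x\<^sup>2"] cong: if_cong)
  have "(\<Sum>b\<in>A. (cmod (f b - (\<Sum>g\<in>G. (cnj (exp_char g (of_int a)) / card A) * exp_char g (of_int b))))\<^sup>2) = 0"
    using integral_diff_projection_squared[OF f V] V A unfolding ip nf
    by (simp add: integral_count_space_finite)
  then have "f b = (\<Sum>g\<in>G. (cnj (exp_char g (of_int a)) / card A) * exp_char g (of_int b))"
    using A ab by (subst (asm) sum_nonneg_eq_0_iff) auto
  also have "\<dots> = (\<Sum>g\<in>G. exp_char g (of_int b - of_int a)) / card G"
    by (simp add: A exp_char_diff_right sum_divide_distrib mult.commute)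
  finally show ?thesis using V A by (auto simp: f_def field_simps split: if_splits)
qed

section \<open>Spectra of period one\<close>

text \<open>With all coefficients zero, the lower Parseval bound makes the squared norm smaller than
  every positive number.\<close>

lemma AE_eq_0_of_fourier_coefficients:
  assumes D: "sqint (lebesgue_on {0..<1}) D"
    and 0: "\<And>n. n \<in> \<int> \<Longrightarrow> ip (lebesgue_on {0..<1}) D (exp_char n) = 0"
  shows "AE x in lebesgue_on {0..<1}. D x = 0"
proof -
  have "(LINT x|lebesgue_on {0..<1}. (cmod (D x))\<^sup>2) < e" if e: "e > 0" for e
  proof -
    obtain F where "finite F" "F \<subseteq> \<int>" "(LINT x|lebesgue_on {0..<1}. (cmod (D x))\<^sup>2) - e <
        (\<Sum>l\<in>F. (cmod (ip (lebesgue_on {0..<1}) D (exp_char l)))\<^sup>2) / measure lebesgue {0..<1::real}"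
      by (rule spectrum_parseval[OF spectrum_unit_interval D e])
    moreover from this have "(\<Sum>l\<in>F. (cmod (ip (lebesgue_on {0..<1}) D (exp_char l)))\<^sup>2) = 0"
      using 0 by (intro sum.neutral) auto
    ultimately show ?thesis by simp
  qed
  then have "(LINT x|lebesgue_on {0..<1}. (cmod (D x))\<^sup>2) \<le> 0"
    by (meson less_irrefl not_le)
  moreover have "(LINT x|lebesgue_on {0..<1}. (cmod (D x))\<^sup>2) \<ge> 0" by simp
  ultimately have "(LINT x|lebesgue_on {0..<1}. (cmod (D x))\<^sup>2) = 0" by linarith
  then have "AE x in lebesgue_on {0..<1}. (cmod (D x))\<^sup>2 = 0"
    using D by (subst (asm) integral_nonneg_eq_0_iff_AE) (auto simp: sqint_def)
  then show ?thesis by simp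
qed

lemma has_period_of_int:
  assumes "has_period L p" "l \<in> L"
  shows "l + of_int n * p \<in> L"
proof -
  have eq: "(+) p ` L = L" using assms(1) by (simp add: has_period_def)
  have up: "x + p \<in> L" if "x \<in> L" for x
    using imageI[OF that, of "(+) p"] unfolding eq by (simp add: add.commute)
  have down: "x - p \<in> L" if "x \<in> L" for x
  proof -
    have "x \<in> (+) p ` L" unfolding eq by (rule that)
    then show ?thesis by auto
  qed
  show ?thesis
  proof (induction n rule: int_induct[of _ 0])
    case (step1 i)
    then show ?case using up[of "l + of_int i * p"] by (simp add: algebra_simps)
  next
    case (step2 i)
    then show ?case using down[of "l + of_int i * p"] by (simp add: algebra_simps)
  qed (simp add: assms(2))
qed

lemma spectrum_nonempty: "is_spectrum S L \<Longrightarrow> L \<noteq> {}"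
proof
  assume S: "is_spectrum S L" and "L = {}"
  have m: "S \<in> lmeasurable" "measure lebesgue S > 0" using S by (auto simp: is_spectrum_iff)
  obtain F where "F \<subseteq> L" "(LINT x|lebesgue_on S. (cmod (exp_char 0 x))\<^sup>2) - measure lebesgue S / 2 <
      (\<Sum>l\<in>F. (cmod (ip (lebesgue_on S) (exp_char 0) (exp_char l)))\<^sup>2) / measure lebesgue S"
    by (rule spectrum_parseval[OF S sqint_exp_char[OF m(1)] half_gt_zero[OF m(2)]])
  then show False using \<open>L = {}\<close> m by (simp add: measure_lebesgue_on_self)
qed

text \<open>By periodicity \<open>L\<close> consists of the integer translates of \<open>G\<close>.
  Orthogonality of two classes annihilates a whole Fourier series and hence holds on almost every
  fibre. The size of \<open>G\<close> is squeezed: it is at most the common fibre size by finite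
  orthogonality, and at least that size by completeness of \<open>L\<close>.\<close>

lemma spectrum_imp_dual_set:
  assumes S: "bounded S" and L: "is_spectrum S L" and per: "has_period L 1"
  defines "G \<equiv> L \<inter> {0..<1}"
  shows "finite G" "G \<noteq> {}" "measure lebesgue S = card G"
    "AE x in lebesgue_on {0..<1}. dual_set G (pat S x)"
proof -
  let ?M = "lebesgue_on {0..<1::real}"
  define V where "V = measure lebesgue S"
  have m: "S \<in> lmeasurable" "V > 0" "hat_orth S L" "S \<in> sets lebesgue"
    using L by (auto simp: is_spectrum_iff V_def)
  obtain B0 where B0: "\<And>x. x \<in> S \<Longrightarrow> \<bar>x\<bar> \<le> B0" using S by (auto simp: bounded_iff)
  obtain B :: nat where "B0 < real B" using reals_Archimedean2 by blast
  then have SB: "S \<subseteq> {- real B..<real B}" using B0 by force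
  have per': "l + of_int n \<in> L" if "l \<in> L" for l n
    using has_period_of_int[OF per that, of n] by simp
  obtain l0 where l0: "l0 \<in> L" using spectrum_nonempty[OF L] by auto
  have G_iff: "frac l \<in> G" if "l \<in> L" for l
    using per'[OF that, of "- \<lfloor>l\<rfloor>"] by (simp add: G_def frac_def frac_lt_1[unfolded frac_def] )
  show "G \<noteq> {}" using G_iff[OF l0] by auto
  \<comment> \<open>The periodised exponential, whose Fourier coefficient at an integer
    \<open>n\<close> is \<open>hat S (l - n)\<close>.\<close>
  define s where "s l x = (\<Sum>k\<in>pat S x. exp_char l (x + of_int k))" for l x
  have s_int: "integrable ?M (s l)" for l
    unfolding s_def by (rule integrable_fibre_sum[OF m(4) SB integrable_exp_char[OF m(1)]])
  have s_bound: "cmod (s l x) \<le> 2 * real B" if "x \<in> {0..<1}" for l x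
  proof -
    have "cmod (s l x) \<le> (\<Sum>k\<in>pat S x. 1)" unfolding s_def by (rule sum_norm_le) simp
    also have "\<dots> \<le> card {- int B..<int B}"
      using card_mono[OF _ pat_subset[OF SB that]] by simp
    finally show ?thesis by simp
  qed
  have fm: "finite_measure ?M" by (rule finite_measure_lebesgue_on) simp
  have s_sq: "sqint ?M (s l)" for l
    using s_int[of l] s_bound[of _ l] by (intro sqint_bounded[OF fm]) auto
  have s_ip: "ip ?M (s l) (exp_char n) = hat S (l - n)" if "n \<in> \<int>" for l n
  proof -
    have n: "exp_char n (of_int k) = 1" for k using that by (intro exp_char_int) auto
    show ?thesis unfolding hat_def integral_fibre_sum[OF m(4) SB integrable_exp_char[OF m(1)]] ip_def s_def
      by (simp add: exp_char_diff sum_distrib_right exp_char_add_right[of n] n)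
  qed
  have orth: "AE x in ?M. (\<Sum>k\<in>pat S x. exp_char (g - h) (of_int k)) = 0" if "g \<in> G" "h \<in> G" "g \<noteq> h" for g h
  proof -
    have "AE x in ?M. s (g - h) x = 0"
    proof (rule AE_eq_0_of_fourier_coefficients[OF s_sq])
      fix n :: real assume "n \<in> \<int>"
      then obtain k where k: "n = of_int k" by (auto elim: Ints_cases)
      have "h + n \<in> L" using per'[of h k] that by (simp add: G_def k)
      moreover have "g \<noteq> h + n"
      proof
        assume "g = h + n"
        then have "\<bar>of_int k :: real\<bar> < 1" using that by (auto simp: G_def k)
        then have "k = 0" by linarith
        then show False using \<open>g = h + n\<close> that k by simp
      qed
      ultimately have "hat S (g - (h + n)) = 0" using m(3) that by (auto simp: hat_orth_def G_def)
      then show "ip ?M (s (g - h)) (exp_char n) = 0"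
        unfolding s_ip[OF \<open>n \<in> \<int>\<close>] by (simp add: algebra_simps)
    qed
    then show ?thesis
      by eventually_elim (simp add: s_def exp_char_add_right sum_distrib_left[symmetric])
  qed
  \<comment> \<open>\<open>s 0\<close> counts the points of the fibre. Its coefficient at a nonzero
    integer vanishes because \<open>l0\<close> and its translate by that integer are distinct
    elements of \<open>L\<close>; so it is a.e. constant, equal to its mean.\<close>
  have "AE x in ?M. s 0 x - of_real V = 0"
  proof (rule AE_eq_0_of_fourier_coefficients)
    show c: "sqint ?M (\<lambda>x. s 0 x - of_real V)"
      by (intro sqint_diff s_sq sqint_bounded[OF fm]) auto
    fix n :: real assume n: "n \<in> \<int>"
    have "ip ?M (\<lambda>x. s 0 x - of_real V) (exp_char n) = ip ?M (s 0) (exp_char n) - of_real V * hat {0..<1} (- n)"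
    proof -
      have "integrable ?M (\<lambda>x. s 0 x * cnj (exp_char n x))"
        by (intro sqint_mult_integrable s_sq sqint_exp_char) simp
      then have "(LINT x|?M. s 0 x * cnj (exp_char n x) - of_real V * cnj (exp_char n x)) =
          ip ?M (s 0) (exp_char n) - of_real V * hat {0..<1} (- n)"
        unfolding ip_def hat_def cnj_exp_char
        by (subst Bochner_Integration.integral_diff) (auto intro!: integrable_exp_char)
      then show ?thesis by (simp add: ip_def algebra_simps)
    qed
    also have "\<dots> = 0"
    proof (cases "n = 0")
      case True
      then show ?thesis using m by (simp add: s_ip hat_0 V_def)
    next
      case False
      obtain k where k: "n = of_int k" using n by (auto elim: Ints_cases)
      have "hat S (- n) = 0"
        using m(3)[unfolded hat_orth_def, rule_format, OF l0 per'[OF l0, of k]] False k by simp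
      moreover have "hat {0..<1} (- n) = 0" using n False by (simp add: hat_unit_interval_eq_0_iff)
      ultimately show ?thesis by (simp add: s_ip n)
    qed
    finally show "ip ?M (\<lambda>x. s 0 x - of_real V) (exp_char n) = 0" .
  qed
  then have card_pat: "AE x in ?M. real (card (pat S x)) = V"
  proof eventually_elim
    case (elim x)
    then have "complex_of_real (real (card (pat S x))) = of_real V" by (simp add: s_def)
    then show ?case unfolding of_real_eq_iff .
  qed
  \<comment> \<open>Exceptional null sets may be united only over finitely many pairs, and
    \<open>G\<close> is not yet known to be finite; hence the detour through finite subsets
    \<open>H\<close>.\<close>
  have orth_all: "AE x in ?M. \<forall>g\<in>H. \<forall>h\<in>H. g \<noteq> h \<longrightarrow> (\<Sum>k\<in>pat S x. exp_char (g - h) (of_int k)) = 0"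
    if H: "finite H" "H \<subseteq> G" for H
  proof (intro AE_finite_allI H(1))
    fix g h assume "g \<in> H" "h \<in> H"
    then show "AE x in ?M. g \<noteq> h \<longrightarrow> (\<Sum>k\<in>pat S x. exp_char (g - h) (of_int k)) = 0"
      using orth[of g h] H(2) by (cases "g = h") (simp, metis (no_types, lifting) subsetD eventually_mono)
  qed
  have card_le: "real (card H) \<le> V" if "finite H" "H \<subseteq> G" for H
  proof -
    have "AE x in ?M. \<forall>g\<in>H. \<forall>h\<in>H. g \<noteq> h \<longrightarrow> (\<Sum>k\<in>pat S x. exp_char (g - h) (of_int k)) = 0"
      by (rule orth_all[OF that])
    with card_pat have "AE x in ?M. real (card (pat S x)) = V \<and>
        (\<forall>g\<in>H. \<forall>h\<in>H. g \<noteq> h \<longrightarrow> (\<Sum>k\<in>pat S x. exp_char (g - h) (of_int k)) = 0)"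
      by eventually_elim auto
    then obtain x where x: "x \<in> {0..<1}" "real (card (pat S x)) = V"
      "\<forall>g\<in>H. \<forall>h\<in>H. g \<noteq> h \<longrightarrow> (\<Sum>k\<in>pat S x. exp_char (g - h) (of_int k)) = 0"
      by (rule ex_AE_unit_interval) auto
    have "pat S x \<noteq> {}" using x(2) m(2) by auto
    then have "card H \<le> card (pat S x)"
      using finite_pat[OF SB x(1)] that(1) x(3) by (intro card_le_of_orthogonal) auto
    then show ?thesis using x(2) by simp
  qed
  show G: "finite G"
  proof (rule ccontr)
    assume "infinite G"
    obtain n :: nat where n: "V < real n" using reals_Archimedean2 by blast
    obtain H where "H \<subseteq> G" "finite H" "card H = n"
      using infinite_arbitrarily_large[OF \<open>infinite G\<close>] by blast
    then show False using card_le[of H] n by simp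
  qed
  \<comment> \<open>Completeness is tested on the indicator of a part \<open>E\<close> of
    \<open>S\<close> inside one unit interval. Each class of frequencies modulo 1 is orthogonal on
    that interval and so contributes at most the measure of \<open>E\<close>, whereas Parseval needs
    \<open>V\<close> times that measure in total.\<close>
  have "V \<le> card G"
  proof -
    have "\<exists>k\<in>{- int B..<int B}. measure lebesgue (S \<inter> {of_int k..<of_int k + 1}) > 0"
    proof (rule ccontr)
      assume "\<not> ?thesis"
      then have 0: "measure lebesgue (S \<inter> {of_int k..<of_int k + 1}) = 0" if "k \<in> {- int B..<int B}" for k
        using that by (metis less_eq_real_def measure_nonneg)
      have eqS: "S = (\<Union>k\<in>{- int B..<int B}. S \<inter> {of_int k..<of_int k + 1})"
      proof (intro equalityI subsetI)
        fix x assume "x \<in> S"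
        moreover have "\<lfloor>x\<rfloor> \<in> {- int B..<int B}"
          using SB \<open>x \<in> S\<close> by (auto simp: le_floor_iff floor_less_iff)
        ultimately show "x \<in> (\<Union>k\<in>{- int B..<int B}. S \<inter> {of_int k..<of_int k + 1})"
          by (intro UN_I[of "\<lfloor>x\<rfloor>"]) auto
      qed auto
      have "measure lebesgue (\<Union>k\<in>{- int B..<int B}. S \<inter> {of_int k..<of_int k + 1}) \<le>
          (\<Sum>k\<in>{- int B..<int B}. measure lebesgue (S \<inter> {of_int k..<of_int k + 1}))"
        by (rule measure_UNION_le) (use m(4) in auto)
      then have "V \<le> (\<Sum>k\<in>{- int B..<int B}. measure lebesgue (S \<inter> {of_int k..<of_int k + 1}))"
        unfolding eqS[symmetric] V_def .
      then show False using m(2) 0 by simp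
    qed
    then obtain k where k: "k \<in> {- int B..<int B}" "measure lebesgue (S \<inter> {of_int k..<of_int k + 1}) > 0" by auto
    define E where "E = S \<inter> {of_int k..<of_int k + 1 :: real}"
    define f :: "real \<Rightarrow> complex" where "f = indicator E"
    define w :: "real \<Rightarrow> complex" where "w x = (if x + of_int k \<in> E then 1 else 0)" for x
    have E: "E \<in> lmeasurable" "E \<in> sets lebesgue" "measure lebesgue E > 0" "E \<subseteq> S"
      using m k by (auto simp: E_def fmeasurable_Int_fmeasurable)
    have sqf: "sqint (lebesgue_on S) f"
      unfolding f_def
    proof (rule sqint_bounded[OF finite_measure_lebesgue_on[OF m(1)], where B=1])
      show "indicator E \<in> borel_measurable (lebesgue_on S)"
        using E by (intro measurable_restrict_space1) auto
    qed (auto simp: indicator_def)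
    have nf: "(LINT x|lebesgue_on S. (cmod (f x))\<^sup>2) = measure lebesgue E"
    proof -
      have "(LINT x|lebesgue_on S. (cmod (f x))\<^sup>2) = (LINT x|lebesgue_on S. indicator E x)"
        by (intro Bochner_Integration.integral_cong) (auto simp: f_def indicator_def)
      also have "\<dots> = measure (lebesgue_on S) E"
        using E by (simp add: Int_absorb2)
      also have "\<dots> = measure lebesgue E" using E m by (subst measure_restrict_space) auto
      finally show ?thesis .
    qed
    have sqw: "sqint ?M w"
      unfolding w_def using sqint_shift[OF E(2) sqint_exp_char[OF E(1), of 0], of k] by (simp cong: if_cong)
    have fib: "(LINT x|lebesgue_on S. f x * h x) = (LINT x|?M. w x * h (x + of_int k))"
      if h: "h \<in> borel_measurable lebesgue" "\<And>x. cmod (h x) \<le> 1" for h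
    proof -
      have "f x * h x = (if x \<in> E then h x else 0)" for x by (simp add: f_def indicator_def)
      then have "(LINT x|lebesgue_on S. f x * h x) = (LINT x|lebesgue_on E. h x)"
        using Lebesgue_Measure.integral_restrict[OF E(4,2) m(4), of h] by simp
      also have "integrable (lebesgue_on E) h"
        using h by (intro finite_measure.integrable_const_bound[OF finite_measure_lebesgue_on[OF E(1)], of _ 1])
          (auto intro: measurable_restrict_space1)
      then have "(LINT x|lebesgue_on E. h x) = (LINT x|?M. (\<Sum>j\<in>pat E x. h (x + of_int j)))"
        using SB E by (intro integral_fibre_sum) auto
      also have "\<dots> = (LINT x|?M. w x * h (x + of_int k))"
      proof (intro Bochner_Integration.integral_cong refl)
        fix x assume "x \<in> space ?M"
        have "j = k" if "j \<in> pat E x" for j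
        proof -
          have "\<bar>of_int (j - k) :: real\<bar> < 1"
            using that \<open>x \<in> space ?M\<close> by (auto simp: pat_def E_def)
          then show ?thesis by linarith
        qed
        then have sub: "pat E x \<subseteq> {k}" by blast
        have "k \<in> pat E x \<longleftrightarrow> x + of_int k \<in> E" by (simp add: pat_def)
        with sub have "pat E x = (if x + of_int k \<in> E then {k} else {})" by (cases "x + of_int k \<in> E") auto
        then show "(\<Sum>j\<in>pat E x. h (x + of_int j)) = w x * h (x + of_int k)" by (simp add: w_def)
      qed
      finally show ?thesis .
    qed
    have nw: "(LINT x|?M. (cmod (w x))\<^sup>2) = measure lebesgue E"
    proof -
      have "of_real (measure lebesgue E) = ip (lebesgue_on S) f f" by (simp add: ip_norm nf)
      also have "\<dots> = (LINT x|lebesgue_on S. f x * 1)"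
        unfolding ip_def by (intro Bochner_Integration.integral_cong) (auto simp: f_def indicator_def)
      also have "\<dots> = (LINT x|?M. w x * 1)" by (rule fib) auto
      also have "\<dots> = ip ?M w w"
        unfolding ip_def by (intro Bochner_Integration.integral_cong) (auto simp: w_def)
      also have "\<dots> = of_real (LINT x|?M. (cmod (w x))\<^sup>2)" by (rule ip_norm)
      finally show ?thesis unfolding of_real_eq_iff by simp
    qed
    \<comment> \<open>Moving the interval to the origin multiplies the coefficient by a number of
      modulus one only.\<close>
    have ipf: "cmod (ip (lebesgue_on S) f (exp_char l)) = cmod (ip ?M w (exp_char l))" for l
    proof -
      have "ip (lebesgue_on S) f (exp_char l) = (LINT x|?M. w x * cnj (exp_char l (x + of_int k)))"
        unfolding ip_def cnj_exp_char by (rule fib) auto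
      also have "w x * cnj (exp_char l (x + of_int k)) = cnj (exp_char l (of_int k)) * (w x * cnj (exp_char l x))" for x
        by (simp add: exp_char_add_right)
      then have "(LINT x|?M. w x * cnj (exp_char l (x + of_int k))) = cnj (exp_char l (of_int k)) * ip ?M w (exp_char l)"
        by (simp only: ip_def integral_mult_right_zero)
      finally show ?thesis by (simp add: norm_mult)
    qed
    have "(\<Sum>l\<in>F. (cmod (ip (lebesgue_on S) f (exp_char l)))\<^sup>2) \<le> card G * measure lebesgue E"
      if F: "finite F" "F \<subseteq> L" for F
    proof -
      have "(\<Sum>l\<in>F. (cmod (ip (lebesgue_on S) f (exp_char l)))\<^sup>2) =
          (\<Sum>g\<in>G. \<Sum>l\<in>{l\<in>F. frac l = g}. (cmod (ip ?M w (exp_char l)))\<^sup>2)"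
        unfolding ipf using F G G_iff by (intro sum.group[symmetric]) auto
      also have "\<dots> \<le> (\<Sum>g\<in>G. measure lebesgue E)"
      proof (rule sum_mono)
        fix g assume "g \<in> G"
        have "l - l' \<in> \<int>" if "frac l = g" "frac l' = g" for l l' :: real
        proof -
          have "l - l' = of_int (\<lfloor>l\<rfloor> - \<lfloor>l'\<rfloor>)" using that by (simp add: frac_def)
          then show ?thesis by (metis Ints_of_int)
        qed
        then have "hat_orth {0..<1} {l\<in>F. frac l = g}"
          by (auto simp: hat_orth_def hat_unit_interval_eq_0_iff)
        then have "orthogonal_family ?M {l\<in>F. frac l = g} exp_char (measure lebesgue {0..<1::real})"
          using F by (intro orthogonal_family_exp_char) auto
        from orthogonal_family.bessel[OF this sqw]
        show "(\<Sum>l\<in>{l\<in>F. frac l = g}. (cmod (ip ?M w (exp_char l)))\<^sup>2) \<le> measure lebesgue E"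
          by (simp add: nw)
      qed
      finally show ?thesis by simp
    qed
    note le = this
    show ?thesis
    proof (rule ccontr)
      assume "\<not> V \<le> card G"
      \<comment> \<open>The tolerance is chosen so that the Parseval bound becomes exactly
        \<open>card G * measure lebesgue E / V\<close>, the value that the classwise Bessel bound
        does not exceed.\<close>
      then have "measure lebesgue E * (V - card G) / V > 0" using E m(2) by simp
      then obtain F where F: "finite F" "F \<subseteq> L" "measure lebesgue E - measure lebesgue E * (V - card G) / V <
          (\<Sum>l\<in>F. (cmod (ip (lebesgue_on S) f (exp_char l)))\<^sup>2) / V"
        unfolding nf[symmetric] V_def by (rule spectrum_parseval[OF L sqf])
      have "(\<Sum>l\<in>F. (cmod (ip (lebesgue_on S) f (exp_char l)))\<^sup>2) / V \<le> card G * measure lebesgue E / V"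
        using le[OF F(1,2)] m(2) by (intro divide_right_mono) auto
      also have "\<dots> = measure lebesgue E - measure lebesgue E * (V - card G) / V"
        using m(2) by (simp add: field_simps)
      finally show False using F(3) by simp
    qed
  qed
  then have V: "V = card G" using card_le[OF G] by simp
  then show "measure lebesgue S = card G" by (simp add: V_def)
  have "AE x in ?M. \<forall>g\<in>G. \<forall>h\<in>G. g \<noteq> h \<longrightarrow> (\<Sum>k\<in>pat S x. exp_char (g - h) (of_int k)) = 0"
    by (rule orth_all[OF G order_refl])
  moreover have "AE x in ?M. finite (pat S x)"
    using finite_pat[OF SB] by (intro AE_I2) auto
  ultimately show "AE x in ?M. dual_set G (pat S x)"
    using card_pat by eventually_elim (auto simp: dual_set_def V)
qed

text \<open>On each fibre a function is an exact combination of the characters from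
  \<open>G\<close>, with coefficients depending on the base point. Approximating these coefficients
  by trigonometric polynomials on the unit interval puts all frequencies into
  \<open>L\<close>.\<close>

lemma dual_set_imp_spectrum:
  assumes S: "bounded S" "S \<in> sets lebesgue" and G: "finite G" "G \<noteq> {}"
    and dual: "AE x in lebesgue_on {0..<1}. dual_set G (pat S x)"
  defines "L \<equiv> {g + of_int n |g n. g \<in> G}"
  shows "is_spectrum S L" "measure lebesgue S = card G"
proof -
  let ?M = "lebesgue_on {0..<1::real}"
  define r where "r = card G"
  have r: "r > 0" using G by (simp add: r_def card_gt_0_iff)
  obtain B0 where B0: "\<And>x. x \<in> S \<Longrightarrow> \<bar>x\<bar> \<le> B0" using S(1) by (auto simp: bounded_iff)
  obtain B :: nat where "B0 < real B" using reals_Archimedean2 by blast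
  then have SB: "S \<subseteq> {- real B..<real B}" using B0 by force
  have m: "S \<in> lmeasurable" by (rule bounded_set_imp_lmeasurable[OF S])
  \<comment> \<open>The integrand over the fibre is \<open>exp_char l x\<close> times a finite
    character sum that equals \<open>card G\<close> or 0, so only the transform of the unit interval
    survives.\<close>
  have hatS: "hat S (g - h + of_int n) = (if g = h then of_nat r * hat {0..<1} (of_int n) else 0)"
    if gh: "g \<in> G" "h \<in> G" for g h and n :: int
  proof -
    define l where "l = g - h + of_int n"
    have e: "exp_char l (of_int k) = exp_char (g - h) (of_int k)" for k
      by (simp add: l_def exp_char_add)
    have s: "integrable ?M (\<lambda>x. \<Sum>k\<in>pat S x. exp_char l (x + of_int k))"
      by (rule integrable_fibre_sum[OF S(2) SB integrable_exp_char[OF m]])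
    have "hat S l = (LINT x|?M. (\<Sum>k\<in>pat S x. exp_char l (x + of_int k)))"
      unfolding hat_def by (rule integral_fibre_sum[OF S(2) SB integrable_exp_char[OF m]])
    also have "\<dots> = (LINT x|?M. (if g = h then of_nat r else 0) * exp_char l x)"
    proof (rule integral_cong_AE)
      show "(\<lambda>x. \<Sum>k\<in>pat S x. exp_char l (x + of_int k)) \<in> borel_measurable ?M" using s by auto
      show "AE x in ?M. (\<Sum>k\<in>pat S x. exp_char l (x + of_int k)) = (if g = h then of_nat r else 0) * exp_char l x"
        using dual
      proof eventually_elim
        case (elim x)
        have "(\<Sum>k\<in>pat S x. exp_char l (x + of_int k)) = exp_char l x * (\<Sum>k\<in>pat S x. exp_char (g - h) (of_int k))"
          by (simp add: exp_char_add_right e sum_distrib_left)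
        also have "(\<Sum>k\<in>pat S x. exp_char (g - h) (of_int k)) = (if g = h then of_nat r else 0)"
          using elim gh by (auto simp: dual_set_def r_def)
        finally show ?case by simp
      qed
    qed simp
    also have "\<dots> = (if g = h then of_nat r * hat {0..<1} l else 0)"
      by (simp add: hat_def)
    finally show ?thesis by (auto simp: l_def)
  qed
  obtain g0 where g0: "g0 \<in> G" using G by auto
  have V: "measure lebesgue S = r"
  proof -
    have "complex_of_real (measure lebesgue S) = of_real (real r)"
      using hatS[OF g0 g0, of 0] m by (simp add: hat_0)
    then show ?thesis unfolding of_real_eq_iff .
  qed
  then show "measure lebesgue S = card G" by (simp add: r_def)
  have orth: "hat_orth S L"
    unfolding hat_orth_def
  proof (intro ballI impI)
    fix l l' assume "l \<in> L" "l' \<in> L" "l \<noteq> l'"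
    then obtain g h n n' where gh: "g \<in> G" "h \<in> G" "l = g + of_int n" "l' = h + of_int n'" by (auto simp: L_def)
    have "l - l' = g - h + of_int (n - n')" using gh by simp
    moreover have "n \<noteq> n'" if "g = h" using that gh \<open>l \<noteq> l'\<close> by auto
    ultimately show "hat S (l - l') = 0"
      using hatS[OF gh(1,2), of "n - n'"] hat_unit_interval_eq_0_iff[of "of_int (n - n')"] by auto
  qed
  have "exp_dense S L"
    unfolding exp_dense_iff
  proof (intro allI impI)
    fix f and e :: real assume f: "sqint (lebesgue_on S) f" and e: "e > 0"
    define K where "K = {- int B..<int B}"
    \<comment> \<open>The finite Fourier coefficient of \<open>f\<close> on the fibre over
      \<open>x\<close>, written as a sum over a fixed window instead of the fibre so that square
      integrability in \<open>x\<close> follows termwise.\<close>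
    define c where "c g x = (\<Sum>k\<in>K. (if x + of_int k \<in> S then f (x + of_int k) * exp_char (- g) (x + of_int k) else 0)) / of_nat r" for g x
    have fe: "sqint (lebesgue_on S) (\<lambda>x. f x * exp_char l x)" for l
    proof -
      have "f \<in> borel_measurable (lebesgue_on S)" using f by (simp add: sqint_def)
      then have "(\<lambda>x. f x * exp_char l x) \<in> borel_measurable (lebesgue_on S)" by measurable
      then show ?thesis using f by (simp add: sqint_def norm_mult)
    qed
    have c_sq: "sqint ?M (c g)" for g
    proof -
      have "sqint ?M (\<lambda>x. inverse (of_nat r) * (\<Sum>k\<in>K. (if x + of_int k \<in> S then f (x + of_int k) * exp_char (- g) (x + of_int k) else 0)))"
        by (intro sqint_cmult sqint_sum sqint_shift[OF S(2) fe])
      then show ?thesis by (simp add: c_def[abs_def] divide_inverse mult.commute)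
    qed
    \<comment> \<open>Inversion on the fibre: exchanging the sums leaves the column sums, which
      \<open>dual_set_columns\<close> evaluates.\<close>
    have f_eq: "f (x + of_int k) = (\<Sum>g\<in>G. c g x * exp_char g (x + of_int k))"
      if x: "x \<in> {0..<1}" "dual_set G (pat S x)" "k \<in> pat S x" for x k
    proof -
      have fin: "finite (pat S x)" by (rule finite_pat[OF SB x(1)])
      have "c g x = (\<Sum>j\<in>pat S x. f (x + of_int j) * exp_char (- g) (x + of_int j)) / of_nat r" for g
        unfolding c_def K_def sum_pat[OF SB x(1), of "\<lambda>y. f y * exp_char (- g) y"] ..
      then have "(\<Sum>g\<in>G. c g x * exp_char g (x + of_int k)) =
          (\<Sum>g\<in>G. \<Sum>j\<in>pat S x. f (x + of_int j) * exp_char g (of_int k - of_int j)) / of_nat r"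
        by (simp add: sum_divide_distrib sum_distrib_right sum_distrib_left cnj_exp_char[symmetric] exp_char_diff_right
            exp_char_add_right mult_ac)
          (simp add: cnj_exp_char exp_char_add[symmetric] mult.assoc[symmetric])
      also have "(\<Sum>g\<in>G. \<Sum>j\<in>pat S x. f (x + of_int j) * exp_char g (of_int k - of_int j)) =
          (\<Sum>j\<in>pat S x. f (x + of_int j) * (\<Sum>g\<in>G. exp_char g (of_int k - of_int j)))"
        by (subst sum.swap) (simp add: sum_distrib_left)
      also have "\<dots> = (\<Sum>j\<in>pat S x. if k = j then f (x + of_int j) * of_nat r else 0)"
        using x(3) by (intro sum.cong refl) (simp add: dual_set_columns[OF x(2) G(1)] r_def)
      also have "\<dots> = f (x + of_int k) * of_nat r" using fin x(3) by simp
      finally show ?thesis using r by simp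
    qed
    \<comment> \<open>Three factors \<open>r\<close> are lost: one by Cauchy-Schwarz over
      \<open>G\<close>, one by the points of the fibre, one by summing the errors over
      \<open>G\<close>. Half of \<open>e\<close> remains.\<close>
    define e' where "e' = e / (2 * real r * real r * real r)"
    have e': "e' > 0" using e r by (simp add: e'_def)
    have "\<exists>p. exp_comb \<int> p \<and> (LINT x|?M. (cmod (c g x - p x))\<^sup>2) < e'" for g
      using exp_dense_unit_interval[unfolded exp_dense_iff, rule_format, OF c_sq e'] .
    then obtain p where p: "\<And>g. exp_comb \<int> (p g)" "\<And>g. (LINT x|?M. (cmod (c g x - p g x))\<^sup>2) < e'" by metis
    define P where "P x = (\<Sum>g\<in>G. p g x * exp_char g x)" for x
    have P: "exp_comb L P"
      unfolding P_def[abs_def] by (intro exp_comb_sum exp_comb_mult_exp[OF p(1)]) (auto simp: L_def add.commute elim!: Ints_cases)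
    have p_per: "p g (x + of_int k) = p g x" for g x k
    proof -
      obtain F b where "F \<subseteq> \<int>" "p g = (\<lambda>x. \<Sum>l\<in>F. b l * exp_char l x)"
        using p(1)[of g] unfolding exp_comb_def by (elim exE conjE)
      moreover have "exp_char l (x + of_int k) = exp_char l x" if "l \<in> \<int>" for l
        using that exp_char_int[of l "of_int k"] by (simp add: exp_char_add_right)
      ultimately show ?thesis by (auto intro!: sum.cong)
    qed
    have sq: "sqint (lebesgue_on S) (\<lambda>x. f x - P x)"
      by (intro sqint_diff f sqint_exp_comb[OF m P])
    have cp: "sqint ?M (\<lambda>x. c g x - p g x)" for g
      by (rule sqint_diff[OF c_sq sqint_exp_comb[OF _ p(1)]]) simp
    have int: "integrable (lebesgue_on S) (\<lambda>x. (cmod (f x - P x))\<^sup>2)" using sq by (simp add: sqint_def)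
    have "(LINT x|lebesgue_on S. (cmod (f x - P x))\<^sup>2) = (LINT x|?M. (\<Sum>k\<in>pat S x. (cmod (f (x + of_int k) - P (x + of_int k)))\<^sup>2))"
      by (rule integral_fibre_sum[OF S(2) SB int])
    also have "\<dots> \<le> (LINT x|?M. real r * real r * (\<Sum>g\<in>G. (cmod (c g x - p g x))\<^sup>2))"
    proof (rule integral_mono_AE)
      show "integrable ?M (\<lambda>x. \<Sum>k\<in>pat S x. (cmod (f (x + of_int k) - P (x + of_int k)))\<^sup>2)"
        by (rule integrable_fibre_sum[OF S(2) SB int])
      show "integrable ?M (\<lambda>x. real r * real r * (\<Sum>g\<in>G. (cmod (c g x - p g x))\<^sup>2))"
        using cp by (intro integrable_mult_right Bochner_Integration.integrable_sum) (simp add: sqint_def)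
      have "AE x in ?M. x \<in> {0..<1}" by (rule AE_I2) simp
      with dual show "AE x in ?M. (\<Sum>k\<in>pat S x. (cmod (f (x + of_int k) - P (x + of_int k)))\<^sup>2)
          \<le> real r * real r * (\<Sum>g\<in>G. (cmod (c g x - p g x))\<^sup>2)"
      proof eventually_elim
        case (elim x)
        have "(cmod (f (x + of_int k) - P (x + of_int k)))\<^sup>2 \<le> real r * (\<Sum>g\<in>G. (cmod (c g x - p g x))\<^sup>2)"
          if "k \<in> pat S x" for k
        proof -
          have "f (x + of_int k) - P (x + of_int k) = (\<Sum>g\<in>G. (c g x - p g x) * exp_char g (x + of_int k))"
            unfolding f_eq[OF elim(2,1) that] P_def p_per by (simp add: sum_subtractf left_diff_distrib)
          then show ?thesis
            using norm_sum_squared_le[of "\<lambda>g. (c g x - p g x) * exp_char g (x + of_int k)" G]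
            by (simp add: norm_mult r_def)
        qed
        then have "(\<Sum>k\<in>pat S x. (cmod (f (x + of_int k) - P (x + of_int k)))\<^sup>2) \<le>
            (\<Sum>k\<in>pat S x. real r * (\<Sum>g\<in>G. (cmod (c g x - p g x))\<^sup>2))"
          by (rule sum_mono)
        also have "\<dots> = real r * real r * (\<Sum>g\<in>G. (cmod (c g x - p g x))\<^sup>2)"
          using elim(1) by (simp add: dual_set_def r_def)
        finally show ?case .
      qed
    qed
    also have "\<dots> = real r * real r * (\<Sum>g\<in>G. (LINT x|?M. (cmod (c g x - p g x))\<^sup>2))"
      using cp by (simp add: Bochner_Integration.integral_sum sqint_def)
    also have "\<dots> \<le> real r * real r * (\<Sum>g\<in>G. e')"
      by (intro mult_left_mono sum_mono less_imp_le[OF p(2)]) auto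
    also have "\<dots> = e / 2" using r by (simp add: e'_def r_def)
    also have "\<dots> < e" using e by simp
    finally show "\<exists>p. exp_comb L p \<and> (LINT x|lebesgue_on S. (cmod (f x - p x))\<^sup>2) < e"
      using P by blast
  qed
  then show "is_spectrum S L" using m V r orth by (simp add: is_spectrum_iff)
qed

section \<open>Jensen's inequality for holomorphic functions\<close>

lemma sum_cyclic_shift:
  fixes g :: "nat \<Rightarrow> 'a :: comm_monoid_add"
  assumes "\<And>k. g (k + N) = g k"
  shows "(\<Sum>k<N. g (k + j)) = (\<Sum>k<N. g k)"
proof (induction j)
  case (Suc j)
  have "(\<Sum>k<N. g (k + Suc j)) = (\<Sum>k<N. g (Suc k + j))" by simp
  also have "\<dots> = (\<Sum>k<N. g (k + j))"
  proof (cases N)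
    case (Suc m)
    have "(\<Sum>k<N. g (Suc k + j)) = (\<Sum>k<m. g (Suc k + j)) + g (N + j)"
      by (simp add: Suc)
    also have "g (N + j) = g (0 + j)" using assms[of j] by (simp add: add.commute)
    also have "(\<Sum>k<m. g (Suc k + j)) + g (0 + j) = (\<Sum>k<N. g (k + j))"
      unfolding Suc sum.lessThan_Suc_shift by (simp add: add.commute)
    finally show ?thesis .
  qed simp
  finally show ?case using Suc by simp
qed simp

text \<open>Dilation turns the unit interval into one of length \<open>N\<close>, and the fibre
  identity folds it back. In this form a Riemann sum averaged over its offset is exactly the
  integral.\<close>

lemma unit_interval_average:
  fixes h :: "real \<Rightarrow> real"
  assumes N: "N > 0" and h: "integrable (lebesgue_on {0..<1}) h"
  shows "integrable (lebesgue_on {0..<1}) (\<lambda>x. \<Sum>k<N. h ((x + real k) / real N))"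
    and "(LINT x|lebesgue_on {0..<1}. (\<Sum>k<N. h ((x + real k) / real N))) = real N * (LINT x|lebesgue_on {0..<1}. h x)"
proof -
  define S where "S = {0..<real N}"
  have S: "S \<in> sets lebesgue" "S \<in> lmeasurable" "S \<subseteq> {- real N..<real N}" by (auto simp: S_def)
  have "x \<in> (*) (real N) ` {0..<1} \<longleftrightarrow> x \<in> S" for x
    using N by (subst mem_scale_iff') (auto simp: S_def field_simps)
  then have sc: "(*) (real N) ` {0..<1} = S" by blast
  have int: "integrable (lebesgue_on S) (\<lambda>x. h (x / real N))"
    using integrable_scale[of "real N" "{0..<1}" h] h N unfolding sc by simp
  have pat: "pat S x = int ` {..<N}" if "x \<in> {0..<1}" for x
  proof -
    have "x + of_int k \<in> S \<longleftrightarrow> 0 \<le> k \<and> k < int N" for k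
    proof -
      have fl: "\<lfloor>x + of_int k\<rfloor> = k" using that by (auto simp: floor_eq_iff)
      have "0 \<le> x + of_int k \<longleftrightarrow> 0 \<le> k"
        using zero_le_floor[of "x + of_int k"] unfolding fl by simp
      moreover have "x + of_int k < real N \<longleftrightarrow> k < int N"
        using floor_less_iff[of "x + of_int k" "int N"] unfolding fl by simp
      ultimately show ?thesis by (simp add: S_def)
    qed
    moreover have "int ` {..<N} = {k. 0 \<le> k \<and> k < int N}"
      by (auto simp: image_iff) (metis nat_0_le nat_less_iff of_nat_0_le_iff lessThan_iff)
    ultimately show ?thesis by (auto simp: pat_def)
  qed
  have eq: "(\<Sum>k\<in>pat S x. h ((x + of_int k) / real N)) = (\<Sum>k<N. h ((x + real k) / real N))" if "x \<in> {0..<1}" for x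
    unfolding pat[OF that] by (subst sum.reindex) auto
  show "integrable (lebesgue_on {0..<1}) (\<lambda>x. \<Sum>k<N. h ((x + real k) / real N))"
    using integrable_fibre_sum[OF S(1,3) int] by (subst Bochner_Integration.integrable_cong[OF refl eq[symmetric]]) auto
  have "real N * (LINT x|lebesgue_on {0..<1}. h x) = (LINT x|lebesgue_on S. h (x / real N))"
    using LINT_scale[of "real N" "{0..<1}" "\<lambda>x. h (x / real N)"] N unfolding sc by simp
  also have "\<dots> = (LINT x|lebesgue_on {0..<1}. (\<Sum>k\<in>pat S x. h ((x + of_int k) / real N)))"
    by (rule integral_fibre_sum[OF S(1,3) int])
  also have "\<dots> = (LINT x|lebesgue_on {0..<1}. (\<Sum>k<N. h ((x + real k) / real N)))"
    by (intro Bochner_Integration.integral_cong refl) (simp add: eq)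
  finally show "(LINT x|lebesgue_on {0..<1}. (\<Sum>k<N. h ((x + real k) / real N))) = real N * (LINT x|lebesgue_on {0..<1}. h x)" ..
qed

text \<open>
  The product of the rotated functions \<open>f (\<omega>\<^sup>k z)\<close> over the \<open>N\<close>-th roots of unity \<open>\<omega>\<^sup>k\<close> has
  modulus \<open>\<bar>f 0\<bar>\<^sup>N\<close> at the origin, while on the circle its logarithm is a Riemann sum; the
  maximum principle compares the two.
\<close>

lemma jensen_disc:
  assumes f: "f holomorphic_on ball 0 1" and \<rho>: "0 < \<rho>" "\<rho> < 1" and \<epsilon>: "\<epsilon> > 0" and f0: "f 0 \<noteq> 0"
  shows "ln (cmod (f 0)) \<le> (LINT \<tau>|lebesgue_on {0..<1}. ln (cmod (f (of_real \<rho> * exp_char 1 \<tau>)) + \<epsilon>))"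
proof -
  \<comment> \<open>The positive \<open>\<epsilon>\<close> keeps the logarithm continuous where
    \<open>f\<close> vanishes.\<close>
  define h where "h \<tau> = ln (cmod (f (of_real \<rho> * exp_char 1 \<tau>)) + \<epsilon>)" for \<tau>
  have in_ball: "of_real \<rho> * exp_char 1 \<tau> \<in> ball 0 1" for \<tau>
    using \<rho> by (simp add: norm_mult)
  have "continuous_on UNIV (\<lambda>\<tau>. f (of_real \<rho> * exp_char 1 \<tau>))"
    by (rule continuous_on_compose2[OF holomorphic_on_imp_continuous_on[OF f]])
       (use in_ball in \<open>auto intro!: continuous_intros\<close>)
  then have h_cont: "continuous_on UNIV h"
    unfolding h_def using \<epsilon> by (intro continuous_intros) (auto simp: add_nonneg_eq_0_iff)
  have h_per: "h (\<tau> + 1) = h \<tau>" for \<tau>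
    by (simp add: h_def exp_char_add_right exp_char_int)
  have h_int: "integrable (lebesgue_on {0..<1}) h"
  proof -
    have "bounded (h ` {0..1})"
      by (intro compact_imp_bounded compact_continuous_image continuous_on_subset[OF h_cont]) auto
    then obtain B where B: "\<And>x. x \<in> {0..1} \<Longrightarrow> norm (h x) \<le> B" unfolding bounded_iff by blast
    have "h \<in> borel_measurable lebesgue"
      using continuous_imp_measurable_on_sets_lebesgue[OF h_cont] by (simp add: lebesgue_on_UNIV_eq)
    then show ?thesis
      using B by (intro finite_measure.integrable_const_bound[OF finite_measure_lebesgue_on, of _ _ B])
        (auto intro: measurable_restrict_space1)
  qed
  define a where "a = (LINT \<tau>|lebesgue_on {0..<1}. h \<tau>)"
  have "ln (cmod (f 0)) \<le> a + \<eta>" if \<eta>: "\<eta> > 0" for \<eta>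
  proof -
    \<comment> \<open>The interval has length 2 because the sampling points
      \<open>t + k / N\<close>, with \<open>t\<close> and \<open>k / N\<close> below 1, are not
      reduced modulo 1.\<close>
    have "uniformly_continuous_on {0..2} h"
      by (rule compact_uniformly_continuous[OF continuous_on_subset[OF h_cont]]) auto
    then obtain d where d: "d > 0" "\<And>x y. x \<in> {0..2} \<Longrightarrow> y \<in> {0..2} \<Longrightarrow> \<bar>x - y\<bar> < d \<Longrightarrow> \<bar>h x - h y\<bar> < \<eta>"
      unfolding uniformly_continuous_on_def dist_real_def using \<eta> by metis
    obtain N :: nat where N: "N > 0" "1 / real N < d"
      using d(1) by (metis inverse_eq_divide ex_inverse_of_nat_less)
    define F where "F z = (\<Prod>k<N. f (exp_char 1 (real k / real N) * z))" for z
    have F_hol: "F holomorphic_on ball 0 1"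
      unfolding F_def
    proof (intro holomorphic_intros)
      fix k
      show "(\<lambda>z. f (exp_char 1 (real k / real N) * z)) holomorphic_on ball 0 1"
        by (rule holomorphic_on_compose_gen[OF _ f, unfolded o_def]) (auto intro!: holomorphic_intros simp: norm_mult)
    qed
    have F_le: "cmod (F z) \<le> exp (real N * (a + \<eta>))" if z: "z \<in> sphere 0 \<rho>" for z
    proof -
      define t where "t = Arg2pi z / (2 * pi)"
      have t: "0 \<le> t" "t < 1" using Arg2pi_ge_0[of z] Arg2pi_lt_2pi[of z] by (auto simp: t_def field_simps)
      have zt: "z = of_real \<rho> * exp_char 1 t"
        using Arg2pi_eq[of z] z by (simp add: exp_char_def t_def mult.commute)
      \<comment> \<open>\<open>(x + j) / N\<close> lies within \<open>1 / N\<close> of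
        \<open>t\<close> for every offset \<open>x\<close> in the unit interval. The index shift by
        \<open>j\<close> is absorbed cyclically, and the comparison is then integrated over
        \<open>x\<close>.\<close>
      define j where "j = nat \<lfloor>real N * t\<rfloor>"
      have j: "real j \<le> real N * t" "real N * t < real j + 1"
        using t by (auto simp: j_def of_nat_nat)
      have j_less: "j < N"
      proof -
        have "real N * t < real N * 1" using t(2) N(1) by (intro mult_strict_left_mono) auto
        then have "real j < real N" using j(1) by simp
        then show ?thesis by simp
      qed
      have sum_le: "(\<Sum>k<N. h (t + real k / real N)) \<le> (\<Sum>k<N. h ((x + real k) / real N)) + real N * \<eta>"
        if x: "x \<in> {0..<1}" for x
      proof -
        have "(\<Sum>k<N. h (t + real k / real N)) \<le> (\<Sum>k<N. h ((x + real (k + j)) / real N) + \<eta>)"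
        proof (rule sum_mono)
          fix k assume k: "k \<in> {..<N}"
          have "real k / real N \<le> 1" using k N by simp
          then have 1: "t + real k / real N \<in> {0..2}" using t by auto
          have "x + real (k + j) \<le> 2 * real N" using x k j_less by auto
          then have 2: "(x + real (k + j)) / real N \<in> {0..2}" using x N by (auto simp: field_simps)
          have "\<bar>real N * t - real j - x\<bar> / real N < 1 / real N"
            using j x N by (intro divide_strict_right_mono) auto
          moreover have "(t + real k / real N) - (x + real (k + j)) / real N = (real N * t - real j - x) / real N"
            using N by (simp add: field_simps)
          ultimately have "\<bar>(t + real k / real N) - (x + real (k + j)) / real N\<bar> < 1 / real N"
            by simp
          then have "\<bar>h (t + real k / real N) - h ((x + real (k + j)) / real N)\<bar> < \<eta>"
            using d(2)[OF 1 2] N(2) by linarith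
          then show "h (t + real k / real N) \<le> h ((x + real (k + j)) / real N) + \<eta>" by linarith
        qed
        also have "\<dots> = (\<Sum>k<N. h ((x + real (k + j)) / real N)) + real N * \<eta>"
          by (simp add: sum.distrib)
        also have "(\<Sum>k<N. h ((x + real (k + j)) / real N)) = (\<Sum>k<N. h ((x + real k) / real N))"
        proof (rule sum_cyclic_shift)
          fix k
          have "(x + real (k + N)) / real N = (x + real k) / real N + 1" using N by (simp add: field_simps)
          then show "h ((x + real (k + N)) / real N) = h ((x + real k) / real N)" by (simp add: h_per)
        qed
        finally show ?thesis .
      qed
      have "(\<Sum>k<N. h (t + real k / real N)) = (LINT x|lebesgue_on {0..<1::real}. (\<Sum>k<N. h (t + real k / real N)))"
        by (simp add: measure_lebesgue_on_self)
      also have "\<dots> \<le> (LINT x|lebesgue_on {0..<1}. (\<Sum>k<N. h ((x + real k) / real N)) + real N * \<eta>)"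
        using unit_interval_average(1)[OF N(1) h_int] sum_le
        by (intro integral_mono Bochner_Integration.integrable_add finite_measure.integrable_const finite_measure_lebesgue_on) auto
      also have "\<dots> = real N * a + real N * \<eta>"
        using unit_interval_average[OF N(1) h_int]
        by (subst Bochner_Integration.integral_add)
           (auto intro!: finite_measure.integrable_const finite_measure_lebesgue_on simp: a_def measure_lebesgue_on_self)
      finally have le: "(\<Sum>k<N. h (t + real k / real N)) \<le> real N * (a + \<eta>)" by (simp add: algebra_simps)
      have "cmod (F z) = (\<Prod>k<N. cmod (f (exp_char 1 (real k / real N) * z)))"
        by (simp add: F_def prod_norm[symmetric])
      also have "\<dots> \<le> (\<Prod>k<N. exp (h (t + real k / real N)))"
      proof (intro prod_mono conjI)
        fix k
        have "exp_char 1 (real k / real N) * z = of_real \<rho> * exp_char 1 (t + real k / real N)"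
          unfolding zt by (simp add: exp_char_add_right)
        moreover have "cmod w + \<epsilon> > 0" for w using \<epsilon> by (simp add: add_nonneg_pos)
        ultimately show "cmod (f (exp_char 1 (real k / real N) * z)) \<le> exp (h (t + real k / real N))"
          using \<epsilon> by (simp add: h_def)
      qed simp
      also have "\<dots> = exp (\<Sum>k<N. h (t + real k / real N))" by (simp add: exp_sum)
      also have "\<dots> \<le> exp (real N * (a + \<eta>))" using le by simp
      finally show ?thesis .
    qed
    have "cmod (F 0) \<le> exp (real N * (a + \<eta>))"
    proof (rule maximum_modulus_frontier[of F "cball 0 \<rho>"])
      show "F holomorphic_on interior (cball 0 \<rho>)" using \<rho> by (auto intro: holomorphic_on_subset[OF F_hol])
      show "continuous_on (closure (cball 0 \<rho>)) F"
        using \<rho> by (intro holomorphic_on_imp_continuous_on holomorphic_on_subset[OF F_hol]) auto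
      show "cmod (F z) \<le> exp (real N * (a + \<eta>))" if "z \<in> frontier (cball 0 \<rho>)" for z
        using that \<rho> by (intro F_le) (simp add: frontier_cball)
    qed (use \<rho> in auto)
    also have "cmod (F 0) = cmod (f 0) ^ N" by (simp add: F_def norm_power)
    also have "\<dots> = exp (real N * ln (cmod (f 0)))" using f0 by (simp add: exp_of_nat_mult)
    finally show ?thesis using N by simp
  qed
  then show ?thesis unfolding a_def h_def by (rule field_le_epsilon)
qed

section \<open>The Poisson kernel of the half plane\<close>

text \<open>The density of harmonic measure on the real line seen from the point \<open>Y\<close>
  times the imaginary unit.\<close>

definition poisson :: "real \<Rightarrow> real \<Rightarrow> real"
  where "poisson Y t = (Y / pi) / (Y\<^sup>2 + t\<^sup>2)"

lemma poisson_pos: "Y > 0 \<Longrightarrow> poisson Y t > 0"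
  by (simp add: poisson_def add_pos_nonneg)

text \<open>\<open>g\<close> is an antiderivative of the kernel and maps the line bijectively onto
  the open unit interval, so this is a change of variables; the endpoint 0 is null.\<close>

lemma
  fixes h :: "real \<Rightarrow> real"
  assumes Y: "Y > 0" and h: "integrable (lebesgue_on {0..<1}) h"
  defines "g \<equiv> \<lambda>t. 1 / 2 + arctan (t / Y) / pi"
  shows integrable_poisson: "integrable lebesgue (\<lambda>t. poisson Y t * h (g t))"
    and integral_poisson: "(LINT t|lebesgue. poisson Y t * h (g t)) = (LINT x|lebesgue_on {0..<1}. h x)"
proof -
  have g': "(g has_real_derivative poisson Y t) (at t)" for t
  proof -
    have p: "1 + (t / Y)\<^sup>2 > 0" by (simp add: add_pos_nonneg)
    have "(g has_real_derivative (0 + (inverse (1 + (t / Y)\<^sup>2) * (1 / Y)) / pi)) (at t)"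
      unfolding g_def using Y by (auto intro!: derivative_eq_intros)
    also have "0 + (inverse (1 + (t / Y)\<^sup>2) * (1 / Y)) / pi = poisson Y t"
      using Y p by (simp add: poisson_def field_simps power2_eq_square)
    finally show ?thesis .
  qed
  have range: "g ` UNIV = {0<..<1}"
  proof (intro equalityI subsetI)
    fix x assume "x \<in> g ` UNIV"
    then obtain t where t: "x = g t" by auto
    show "x \<in> {0<..<1}" using arctan_bounded[of "t / Y"] by (auto simp: t g_def field_simps)
  next
    fix x :: real assume x: "x \<in> {0<..<1}"
    have "- (pi / 2) < pi * (x - 1 / 2)"
    proof -
      have "pi * (- 1 / 2) < pi * (x - 1 / 2)" using x by (intro mult_strict_left_mono) auto
      then show ?thesis by simp
    qed
    moreover have "pi * (x - 1 / 2) < pi / 2"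
    proof -
      have "pi * (x - 1 / 2) < pi * (1 / 2)" using x by (intro mult_strict_left_mono) auto
      then show ?thesis by simp
    qed
    ultimately have "arctan (tan (pi * (x - 1 / 2))) = pi * (x - 1 / 2)" by (rule arctan_tan)
    then have "g (Y * tan (pi * (x - 1 / 2))) = x" using Y by (simp add: g_def)
    then show "x \<in> g ` UNIV" by (metis rangeI)
  qed
  have inj: "inj_on g UNIV" using Y by (auto simp: inj_on_def g_def arctan_eq_iff)
  have h01: "integrable lebesgue (\<lambda>x. indicator {0..<1} x *\<^sub>R h x)"
    using h by (simp add: integrable_restrict_space)
  have ind: "indicator {0<..<1} x *\<^sub>R h x = indicator {0<..<1} x *\<^sub>R (indicator {0..<1} x *\<^sub>R h x)" for x
    by (auto simp: indicator_def)
  have h01': "integrable lebesgue (\<lambda>x. indicator {0<..<1} x *\<^sub>R h x)"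
    unfolding ind by (rule integrable_mult_indicator[OF _ h01]) simp
  then have I: "h absolutely_integrable_on {0<..<1}" by (simp add: set_integrable_def)
  have "(LINT x|lebesgue. indicator {0<..<1} x *\<^sub>R h x) = (LINT x|lebesgue. indicator {0..<1} x *\<^sub>R h x)"
  proof (rule integral_cong_AE)
    have "AE x in lebesgue. x \<notin> {0::real}" by (intro AE_not_in) auto
    then show "AE x in lebesgue. indicator {0<..<1} x *\<^sub>R h x = indicator {0..<1} x *\<^sub>R h x"
      by eventually_elim (auto simp: indicator_def)
  qed (use h01 h01' in auto)
  then have eq: "integral {0<..<1} h = (LINT x|lebesgue_on {0..<1}. h x)"
    using set_lebesgue_integral_eq_integral(2)[OF I]
    by (simp add: set_lebesgue_integral_def integral_restrict_space)
  have ab: "\<bar>poisson Y t\<bar> = poisson Y t" for t using poisson_pos[OF Y, of t] by simp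
  have "(\<lambda>t. \<bar>poisson Y t\<bar> *\<^sub>R h (g t)) absolutely_integrable_on UNIV \<and>
      integral UNIV (\<lambda>t. \<bar>poisson Y t\<bar> *\<^sub>R h (g t)) = integral {0<..<1} h"
    using has_absolute_integral_change_of_variables_real[of UNIV g "poisson Y" h "integral {0<..<1} h"] g' inj I
    by (simp add: range)
  then have *: "(\<lambda>t. poisson Y t * h (g t)) absolutely_integrable_on UNIV"
    "integral UNIV (\<lambda>t. poisson Y t * h (g t)) = (LINT x|lebesgue_on {0..<1}. h x)"
    by (simp_all add: ab eq)
  show "integrable lebesgue (\<lambda>t. poisson Y t * h (g t))"
    using *(1) by (simp add: set_integrable_def)
  show "(LINT t|lebesgue. poisson Y t * h (g t)) = (LINT x|lebesgue_on {0..<1}. h x)"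
    using set_lebesgue_integral_eq_integral(2)[OF *(1)] *(2) by (simp add: set_lebesgue_integral_def)
qed

lemma poisson_integrable: "Y > 0 \<Longrightarrow> integrable lebesgue (poisson Y)"
  and poisson_integral: "Y > 0 \<Longrightarrow> (LINT t|lebesgue. poisson Y t) = 1"
  using integrable_poisson[of Y "\<lambda>_. 1"] integral_poisson[of Y "\<lambda>_. 1"]
  by (simp_all add: finite_measure.integrable_const finite_measure_lebesgue_on measure_lebesgue_on_self)

text \<open>The Cayley transform on the boundary: the circle point whose angle is the distribution
  function of the kernel is the image of the real number \<open>s\<close>.\<close>

lemma exp_char_half_arctan:
  "exp_char 1 (1 / 2 + arctan s / pi) = (of_real s - \<i>) / (of_real s + \<i>)"
proof -
  have p: "1 + s\<^sup>2 > 0" by (simp add: add_pos_nonneg)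
  define c where "c = cos (arctan s)"
  define d where "d = sin (arctan s)"
  have c2: "c\<^sup>2 = 1 / (1 + s\<^sup>2)" using p by (simp add: c_def cos_arctan power_divide)
  have d: "d = s * c" by (simp add: c_def d_def cos_arctan sin_arctan)
  have "exp_char 1 (1 / 2 + arctan s / pi) = cis (pi + 2 * arctan s)"
    by (simp add: exp_char_cis distrib_left)
  also have "\<dots> = - (cis (arctan s))\<^sup>2"
    by (simp add: cis_mult power2_eq_square flip: cis_mult[of pi])
  also have "cis (arctan s) = of_real c * (1 + \<i> * of_real s)"
    by (simp add: complex_eq_iff c_def[symmetric] d_def[symmetric] d)
  also have "- (of_real c * (1 + \<i> * of_real s))\<^sup>2 = - of_real (c\<^sup>2) * (1 + \<i> * of_real s)\<^sup>2"
    by (simp add: power_mult_distrib)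
  also have "\<dots> = - (1 + \<i> * of_real s)\<^sup>2 / of_real (1 + s\<^sup>2)"
    unfolding c2 by (simp add: divide_inverse)
  also have "of_real (1 + s\<^sup>2) = (1 + \<i> * of_real s) * (1 - \<i> * of_real s)"
    by (simp add: algebra_simps power2_eq_square)
  also have "- (1 + \<i> * of_real s)\<^sup>2 / ((1 + \<i> * of_real s) * (1 - \<i> * of_real s)) = - (1 + \<i> * of_real s) / (1 - \<i> * of_real s)"
  proof -
    have "1 + \<i> * of_real s \<noteq> 0" "1 - \<i> * of_real s \<noteq> 0" by (simp_all add: complex_eq_iff)
    then show ?thesis by (simp add: divide_simps power2_eq_square)
  qed
  also have "\<dots> = (of_real s - \<i>) / (of_real s + \<i>)"
  proof -
    have n: "1 - \<i> * of_real s \<noteq> 0" "of_real s + \<i> \<noteq> 0" by (simp_all add: complex_eq_iff)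
    then show ?thesis by (simp add: divide_simps) (simp add: algebra_simps)
  qed
  finally show ?thesis .
qed

text \<open>A Moebius map transports the inequality from the disc. On the circles approaching the
  boundary the logarithms stay between constants given by \<open>\<epsilon>\<close> and
  \<open>C\<close>, so dominated convergence reaches the boundary.\<close>

lemma jensen_half_plane:
  assumes Q: "Q holomorphic_on UNIV" and C: "\<And>z. Im z \<ge> 0 \<Longrightarrow> cmod (Q z) \<le> C"
    and Y: "Y > 0" and \<epsilon>: "\<epsilon> > 0" and Q0: "Q (\<i> * of_real Y) \<noteq> 0"
  shows "integrable lebesgue (\<lambda>t. poisson Y t * ln (cmod (Q (of_real t)) + \<epsilon>))"
    and "ln (cmod (Q (\<i> * of_real Y))) \<le> (LINT t|lebesgue. poisson Y t * ln (cmod (Q (of_real t)) + \<epsilon>))"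
proof -
  let ?M = "lebesgue_on {0..<1::real}"
  \<comment> \<open>This map sends the disc into the closed upper half plane, its centre to the
    evaluation point, and the boundary point 1 to infinity.\<close>
  define z where "z w = \<i> * of_real Y * (1 + w) / (1 - w)" for w :: complex
  have Im_z: "Im (z w) \<ge> 0" if "cmod w \<le> 1" for w
  proof -
    have "(cmod w)\<^sup>2 \<le> 1" using that by (simp add: power_le_one)
    then have "Im w * Im w + Re w * Re w \<le> 1" unfolding cmod_power2 by (simp add: power2_eq_square)
    moreover have "Im (z w) = Y * (1 - (Im w * Im w + Re w * Re w)) / ((1 - Re w)\<^sup>2 + (Im w)\<^sup>2)"
      by (simp add: z_def Im_divide power2_eq_square algebra_simps)
    ultimately show ?thesis using Y by simp
  qed
  define f where "f w = Q (z w)" for w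
  have f_le: "cmod (f w) \<le> C" if "cmod w \<le> 1" for w
    unfolding f_def by (rule C[OF Im_z[OF that]])
  have z_hol: "z holomorphic_on - {1}" unfolding z_def by (intro holomorphic_intros) auto
  have f_hol: "f holomorphic_on - {1}"
    unfolding f_def using holomorphic_on_compose_gen[OF z_hol Q] by (simp add: o_def)
  have f_hol': "f holomorphic_on ball 0 1" by (rule holomorphic_on_subset[OF f_hol]) auto
  have f0: "f 0 = Q (\<i> * of_real Y)" by (simp add: f_def z_def)
  have C0: "C > 0"
    using f_le[of 0] Q0 f0 by (metis norm_zero zero_le_one zero_less_norm_iff less_le_trans)
  define B where "B = \<bar>ln \<epsilon>\<bar> + \<bar>ln (C + \<epsilon>)\<bar>"
  have ln_le: "\<bar>ln (cmod (f w) + \<epsilon>)\<bar> \<le> B" if "cmod w \<le> 1" for w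
  proof -
    have "ln \<epsilon> \<le> ln (cmod (f w) + \<epsilon>)" using \<epsilon> by (subst ln_le_cancel_iff) (auto simp: add_nonneg_pos)
    moreover have "ln (cmod (f w) + \<epsilon>) \<le> ln (C + \<epsilon>)"
      using \<epsilon> f_le[OF that] C0 by (subst ln_le_cancel_iff) (auto simp: add_nonneg_pos)
    ultimately show ?thesis unfolding B_def by linarith
  qed
  define h where "h \<tau> = ln (cmod (f (exp_char 1 \<tau>)) + \<epsilon>)" for \<tau>
  \<comment> \<open>Radii below 1 are needed since the map has a pole at 1 and the disc inequality
    is available only inside.\<close>
  define \<rho> where "\<rho> n = real (Suc n) / real (Suc (Suc n))" for n
  have \<rho>: "0 < \<rho> n" "\<rho> n < 1" for n by (auto simp: \<rho>_def field_simps)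
  have \<rho>_lim: "\<rho> \<longlonglongrightarrow> 1" unfolding \<rho>_def using LIMSEQ_Suc[OF LIMSEQ_n_over_Suc_n] .
  define s where "s n \<tau> = ln (cmod (f (of_real (\<rho> n) * exp_char 1 \<tau>)) + \<epsilon>)" for n \<tau>
  have Qm: "Q \<in> borel_measurable borel"
    by (rule borel_measurable_continuous_onI[OF holomorphic_on_imp_continuous_on[OF Q]])
  have zm: "z \<in> borel_measurable borel" unfolding z_def by measurable
  have fm: "f \<in> borel_measurable borel" unfolding f_def using measurable_compose[OF zm Qm] .
  have fe: "(\<lambda>\<tau>. f (c * exp_char 1 \<tau>)) \<in> borel_measurable ?M" for c
    by (rule measurable_compose[OF _ fm]) measurable
  have [measurable]: "(\<lambda>\<tau>. f (exp_char 1 \<tau>)) \<in> borel_measurable ?M" using fe[of 1] by simp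
  have hm: "h \<in> borel_measurable ?M" unfolding h_def by measurable
  have sm: "s n \<in> borel_measurable ?M" for n unfolding s_def using fe[of "of_real (\<rho> n)"] by measurable
  have fin: "finite_measure ?M" by (rule finite_measure_lebesgue_on) simp
  have h_int: "integrable ?M h"
    using hm ln_le by (intro finite_measure.integrable_const_bound[OF fin, of _ B]) (auto simp: h_def)
  have "(\<lambda>n. LINT \<tau>|?M. s n \<tau>) \<longlonglongrightarrow> (LINT \<tau>|?M. h \<tau>)"
  proof (rule integral_dominated_convergence[where w="\<lambda>_. B"])
    show "integrable ?M (\<lambda>_. B)" by (rule finite_measure.integrable_const[OF fin])
    show "AE \<tau> in ?M. norm (s n \<tau>) \<le> B" for n
      using \<rho>[of n] ln_le by (intro AE_I2) (auto simp: s_def norm_mult)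
    have lim: "(\<lambda>n. s n \<tau>) \<longlonglongrightarrow> h \<tau>" if "0 < \<tau>" "\<tau> < 1" for \<tau>
    proof -
      have "exp_char 1 \<tau> \<noteq> 1"
      proof
        assume "exp_char 1 \<tau> = 1"
        then have "exp_char \<tau> 1 = 1" by (simp add: exp_char_def mult.commute)
        then show False using that by (auto simp: exp_char_eq_1_iff Ints_def)
      qed
      then have "isCont f (exp_char 1 \<tau>)"
        using holomorphic_on_imp_continuous_on[OF f_hol]
        by (subst (asm) continuous_on_eq_continuous_at) auto
      moreover have "(\<lambda>n. of_real (\<rho> n) * exp_char 1 \<tau>) \<longlonglongrightarrow> of_real 1 * exp_char 1 \<tau>"
        by (intro tendsto_intros \<rho>_lim)
      ultimately have "(\<lambda>n. f (of_real (\<rho> n) * exp_char 1 \<tau>)) \<longlonglongrightarrow> f (exp_char 1 \<tau>)"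
        by (intro isCont_tendsto_compose[of _ f]) auto
      then show ?thesis unfolding s_def h_def
        using \<epsilon> by (intro tendsto_intros) (auto simp: add_nonneg_eq_0_iff)
    qed
    have "AE \<tau> in lebesgue. \<tau> \<notin> {0::real}" by (intro AE_not_in) auto
    then show "AE \<tau> in ?M. (\<lambda>n. s n \<tau>) \<longlonglongrightarrow> h \<tau>"
      unfolding AE_restrict_space_iff[of "{0..<1::real}" lebesgue, simplified] by eventually_elim (use lim in auto)
  qed (use hm sm in auto)
  moreover have "ln (cmod (f 0)) \<le> (LINT \<tau>|?M. s n \<tau>)" for n
    unfolding s_def using jensen_disc[OF f_hol' \<rho> \<epsilon>] Q0 f0 by simp
  ultimately have le: "ln (cmod (f 0)) \<le> (LINT \<tau>|?M. h \<tau>)"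
    by (intro LIMSEQ_le_const[of _ _ "ln (cmod (f 0))"]) auto
  have "z (exp_char 1 (1 / 2 + arctan (t / Y) / pi)) = of_real t" for t
  proof -
    have n: "complex_of_real (t / Y) + \<i> \<noteq> 0" by (simp add: complex_eq_iff)
    have "z ((of_real (t / Y) - \<i>) / (of_real (t / Y) + \<i>)) = \<i> * of_real Y * (2 * of_real (t / Y)) / (2 * \<i>)"
      unfolding z_def using n by (simp add: divide_simps)
    then show ?thesis unfolding exp_char_half_arctan using Y by simp
  qed
  then have h_eq: "h (1 / 2 + arctan (t / Y) / pi) = ln (cmod (Q (of_real t)) + \<epsilon>)" for t
    by (simp add: h_def f_def)
  show "integrable lebesgue (\<lambda>t. poisson Y t * ln (cmod (Q (of_real t)) + \<epsilon>))"
    using integrable_poisson[OF Y h_int] by (simp add: h_eq)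
  show "ln (cmod (Q (\<i> * of_real Y))) \<le> (LINT t|lebesgue. poisson Y t * ln (cmod (Q (of_real t)) + \<epsilon>))"
    using le integral_poisson[OF Y h_int] by (simp add: h_eq f0)
qed

section \<open>Zeros of the Fourier transform of a bounded set\<close>

text \<open>Boundedness of \<open>S\<close> extends the transform to an entire function by a power
  series. Infinitely many zeros in a compact interval would accumulate and make it vanish
  identically, but its value at 0 is the measure of \<open>S\<close>.\<close>

lemma finite_zeros_hat:
  assumes S: "S \<in> sets lebesgue" "bounded S" "measure lebesgue S > 0"
  shows "finite {l \<in> {- R..R}. hat S l = 0}"
proof (rule ccontr)
  let ?M = "lebesgue_on S"
  assume inf: "infinite {l \<in> {- R..R}. hat S l = 0}"
  obtain B where B: "\<And>x. x \<in> S \<Longrightarrow> \<bar>x\<bar> \<le> B" using S(2) by (auto simp: bounded_iff)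
  have m: "S \<in> lmeasurable" by (rule bounded_set_imp_lmeasurable[OF S(2,1)])
  have fin: "finite_measure ?M" by (rule finite_measure_lebesgue_on[OF m])
  define a where "a n = (LINT x|?M. (2 * of_real pi * \<i> * of_real x) ^ n / fact n)" for n :: nat
  define H where "H z = (LINT x|?M. exp (2 * of_real pi * \<i> * of_real x * z))" for z :: complex
  have sums: "(\<lambda>n. a n * z ^ n) sums H z" for z
  proof -
    define u where "u n x = (2 * of_real pi * \<i> * of_real x * z) ^ n / fact n" for n x
    have u_norm: "norm (u n x) \<le> (2 * pi * B * cmod z) ^ n / fact n" if "x \<in> S" for n x
    proof -
      have "norm (u n x) = (2 * pi * \<bar>x\<bar> * cmod z) ^ n / fact n"
        by (simp add: u_def norm_divide norm_power norm_mult)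
      also have "\<dots> \<le> (2 * pi * B * cmod z) ^ n / fact n"
        using B[OF that] by (intro divide_right_mono power_mono mult_mono) auto
      finally show ?thesis .
    qed
    have "continuous_on UNIV (u n)" for n unfolding u_def by (intro continuous_intros) auto
    then have um: "u n \<in> borel_measurable ?M" for n
      using continuous_imp_measurable_on_sets_lebesgue[of UNIV "u n"]
      by (simp add: lebesgue_on_UNIV_eq measurable_restrict_space1)
    have u_int: "integrable ?M (u n)" for n
      using um u_norm by (intro finite_measure.integrable_const_bound[OF fin, of _ "(2 * pi * B * cmod z) ^ n / fact n"]) auto
    have "(\<lambda>n. LINT x|?M. u n x) sums (LINT x|?M. (\<Sum>n. u n x))"
    proof (rule sums_integral[OF u_int])
      have ex: "summable (\<lambda>n. y ^ n / fact n)" for y :: real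
        using summable_exp[of y] by (simp add: divide_inverse mult.commute)
      show "AE x in ?M. summable (\<lambda>n. norm (u n x))"
        using u_norm by (intro AE_I2 summable_comparison_test'[OF ex[of "2 * pi * B * cmod z"], of 0]) auto
      show "summable (\<lambda>n. LINT x|?M. norm (u n x))"
      proof (rule summable_comparison_test'[OF summable_mult[OF ex[of "2 * pi * B * cmod z"], of "measure lebesgue S"], of 0])
        fix n :: nat
        have "(LINT x|?M. norm (u n x)) \<le> (LINT x|?M. (2 * pi * B * cmod z) ^ n / fact n)"
          using u_norm u_int by (intro integral_mono finite_measure.integrable_const[OF fin]) auto
        then show "norm (LINT x|?M. norm (u n x)) \<le> measure lebesgue S * ((2 * pi * B * cmod z) ^ n / fact n)"
          using m by (simp add: measure_lebesgue_on_self)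
      qed
    qed
    moreover have "(\<Sum>n. u n x) = exp (2 * of_real pi * \<i> * of_real x * z)" for x
      unfolding u_def exp_def by (simp add: scaleR_conv_of_real divide_inverse mult.commute)
    moreover have "(LINT x|?M. u n x) = a n * z ^ n" for n
    proof -
      have "u n x = (2 * of_real pi * \<i> * of_real x) ^ n / fact n * z ^ n" for x
        by (simp add: u_def power_mult_distrib)
      then show ?thesis by (simp only: a_def integral_mult_left_zero)
    qed
    ultimately show ?thesis by (simp add: H_def)
  qed
  have hol: "H holomorphic_on ball 0 (\<bar>R\<bar> + 1)"
    using sums by (intro power_series_holomorphic[of 0 _ a]) simp
  have H_hat: "H (of_real l) = hat S l" for l
    unfolding H_def hat_def exp_char_def by (simp add: mult_ac)
  define U where "U = complex_of_real ` {l \<in> {- R..R}. hat S l = 0}"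
  have "infinite U"
    unfolding U_def by (subst finite_image_iff[OF inj_on_subset[OF inj_of_real subset_UNIV]]) (rule inf)
  moreover have U: "U \<subseteq> cball 0 \<bar>R\<bar>"
    by (auto simp: U_def)
  ultimately obtain \<xi> where \<xi>: "\<xi> \<in> cball 0 \<bar>R\<bar>" "\<xi> islimpt U"
    using compact_cball[of "0::complex" "\<bar>R\<bar>"] unfolding compact_eq_Bolzano_Weierstrass by blast
  have "H 0 = 0"
  proof (rule analytic_continuation[OF hol open_ball connected_ball _ _ \<xi>(2)])
    show "U \<subseteq> ball 0 (\<bar>R\<bar> + 1)" using U by force
    show "\<xi> \<in> ball 0 (\<bar>R\<bar> + 1)" using \<xi>(1) by auto
    show "H z = 0" if "z \<in> U" for z using that H_hat by (auto simp: U_def)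
  qed simp
  then show False using H_hat[of 0] S m by (simp add: hat_0)
qed

section \<open>Exponential sums over orthogonal frequencies\<close>

text \<open>Tonelli's theorem is applied later to Borel functions on the product of two copies of
  \<open>lborel\<close>; this replaces a Lebesgue set by a Borel subset of full measure.\<close>

lemma nn_integral_lebesgue_set:
  fixes f :: "real \<Rightarrow> ennreal"
  assumes S: "S \<in> sets lebesgue" and S': "S' \<in> sets borel" "S' \<subseteq> S" "S - S' \<in> null_sets lebesgue"
    and f: "f \<in> borel_measurable borel"
  shows "(\<integral>\<^sup>+x. f x \<partial>lebesgue_on S) = (\<integral>\<^sup>+x. f x * indicator S' x \<partial>lborel)"
proof -
  have "(\<integral>\<^sup>+x. f x \<partial>lebesgue_on S) = (\<integral>\<^sup>+x. f x * indicator S x \<partial>lebesgue)"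
    using S by (simp add: nn_integral_restrict_space)
  also have "\<dots> = (\<integral>\<^sup>+x. f x * indicator S' x \<partial>lebesgue)"
  proof (rule nn_integral_cong_AE)
    have "AE x in lebesgue. x \<notin> S - S'" by (rule AE_not_in[OF S'(3)])
    then show "AE x in lebesgue. f x * indicator S x = f x * indicator S' x"
      by eventually_elim (use S'(2) in \<open>auto simp: indicator_def\<close>)
  qed
  also have "\<dots> = (\<integral>\<^sup>+x. f x * indicator S' x \<partial>lborel)"
    by (simp add: nn_integral_completion)
  finally show ?thesis .
qed

lemma borel_subset_full_measure:
  assumes "S \<in> sets lebesgue"
  obtains S' where "S' \<in> sets borel" "S' \<subseteq> S" "S - S' \<in> null_sets lebesgue"
proof -
  obtain S' N N' where "S = S' \<union> N" "N \<subseteq> N'" "N' \<in> null_sets lborel" "S' \<in> sets lborel"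
    using assms by (rule sets_completionE)
  moreover from this have "N \<in> null_sets lebesgue"
    by (meson null_sets_completionI null_sets_completion_subset)
  ultimately have "S - S' \<in> null_sets lebesgue"
    using null_sets_completion_subset[of "S - S'" N lborel] by blast
  then show ?thesis
    using that[of S'] \<open>S = S' \<union> N\<close> \<open>S' \<in> sets lborel\<close> by auto
qed

text \<open>A Harnack-type comparison: bounded translations change the kernel at height 1 by at most
  a constant factor, because \<open>(y - x)\<^sup>2\<close> is at most
  \<open>2 * y\<^sup>2 + 2 * x\<^sup>2\<close>.\<close>

lemma poisson_shift_le:
  assumes "\<bar>x\<bar> \<le> B"
  shows "poisson 1 y \<le> 2 * (1 + B\<^sup>2) * poisson 1 (y - x)"
proof -
  have "x\<^sup>2 \<le> B\<^sup>2" using assms by (metis abs_ge_zero power2_abs power_mono)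
  moreover have "(y - x)\<^sup>2 \<le> 2 * y\<^sup>2 + 2 * x\<^sup>2" using sum_squares_bound[of y "-x"] by (simp add: power2_eq_square algebra_simps)
  ultimately have "1 + (y - x)\<^sup>2 \<le> 2 * (1 + B\<^sup>2) + 2 * y\<^sup>2" by simp
  also have "\<dots> \<le> 2 * (1 + B\<^sup>2) * (1 + y\<^sup>2)" by (simp add: algebra_simps)
  finally have le: "1 + (y - x)\<^sup>2 \<le> 2 * (1 + B\<^sup>2) * (1 + y\<^sup>2)" .
  have pos: "1 + (y - x)\<^sup>2 > 0" "1 + y\<^sup>2 > 0" by (simp_all add: add_pos_nonneg)
  have "1 / (1 + y\<^sup>2) \<le> 2 * (1 + B\<^sup>2) / (1 + (y - x)\<^sup>2)"
    unfolding pos_le_divide_eq[OF pos(1)] using le pos(2) by (simp add: pos_divide_le_eq)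
  then have "(1 / pi) * (1 / (1 + y\<^sup>2)) \<le> (1 / pi) * (2 * (1 + B\<^sup>2) / (1 + (y - x)\<^sup>2))"
    by (intro mult_left_mono) auto
  then show ?thesis by (simp add: poisson_def mult.commute)
qed

lemma borel_measurable_poisson [measurable]: "poisson Y \<in> borel_measurable borel"
  unfolding poisson_def by measurable

lemma continuous_exp_sum: "continuous_on A (\<lambda>x. \<Sum>l\<in>F. c l * exp_char l x)"
  by (intro continuous_intros)

text \<open>
  The \<open>L\<^sup>2\<close>-norm of an orthogonal sum is the same on all translates of the set; averaging over
  translates controls the sum on the whole line.
\<close>

lemma poisson_norm_le:
  fixes c :: "real \<Rightarrow> complex"
  assumes S: "S \<in> sets lebesgue" "S \<subseteq> {- B..<B}" "measure lebesgue S > 0"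
    and F: "finite F" "hat_orth S F"
  defines "P \<equiv> \<lambda>x. \<Sum>l\<in>F. c l * exp_char l x"
  shows "integrable lebesgue (\<lambda>t. poisson 1 t * (cmod (P t))\<^sup>2)"
    and "(LINT t|lebesgue. poisson 1 t * (cmod (P t))\<^sup>2) \<le> 2 * (1 + B\<^sup>2) * (\<Sum>l\<in>F. (cmod (c l))\<^sup>2)"
proof -
  define V where "V = measure lebesgue S"
  define s where "s = (\<Sum>l\<in>F. (cmod (c l))\<^sup>2)"
  define D where "D = 2 * (1 + B\<^sup>2)"
  have D: "D > 0" by (simp add: D_def add_pos_nonneg)
  have V: "V > 0" using S by (simp add: V_def)
  have s: "s \<ge> 0" by (simp add: s_def sum_nonneg)
  have m: "S \<in> lmeasurable"
    by (rule bounded_set_imp_lmeasurable[OF bounded_subset[OF _ S(2)] S(1)]) simp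
  obtain S' where S': "S' \<in> sets borel" "S' \<subseteq> S" "S - S' \<in> null_sets lebesgue"
    by (rule borel_subset_full_measure[OF S(1)])
  have [measurable]: "S' \<in> sets borel" by (rule S')
  have [measurable]: "P \<in> borel_measurable borel"
    unfolding P_def by (intro borel_measurable_continuous_onI continuous_exp_sum)
  have P_nonneg: "0 \<le> poisson 1 t" for t using poisson_pos[of 1 t] by simp
  \<comment> \<open>Kept as an extended nonnegative number: the averaging argument then presupposes
    no integrability, which is deduced from the bound at the end.\<close>
  define A where "A = (\<integral>\<^sup>+t. ennreal (poisson 1 t * (cmod (P t))\<^sup>2) \<partial>lborel)"
  have "(\<integral>\<^sup>+x. ennreal ((cmod (P (x + \<tau>)))\<^sup>2) * indicator S' x \<partial>lborel) = ennreal (V * s)" for \<tau>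
  proof -
    have P_shift: "P (x + \<tau>) = (\<Sum>l\<in>F. (c l * exp_char l \<tau>) * exp_char l x)" for x
      by (simp add: P_def exp_char_add_right mult_ac)
    interpret orthogonal_family "lebesgue_on S" F exp_char "measure lebesgue S"
      by (rule orthogonal_family_exp_char[OF m F])
    have "(\<integral>\<^sup>+x. ennreal ((cmod (P (x + \<tau>)))\<^sup>2) * indicator S' x \<partial>lborel) = (\<integral>\<^sup>+x. ennreal ((cmod (P (x + \<tau>)))\<^sup>2) \<partial>lebesgue_on S)"
      by (rule nn_integral_lebesgue_set[OF S(1) S', symmetric]) measurable
    also have "\<dots> = ennreal (LINT x|lebesgue_on S. (cmod (P (x + \<tau>)))\<^sup>2)"
      using sqint_comb[of "\<lambda>l. c l * exp_char l \<tau>"] unfolding P_shift sqint_def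
      by (intro nn_integral_eq_integral) auto
    also have "(LINT x|lebesgue_on S. (cmod (P (x + \<tau>)))\<^sup>2) = V * s"
      unfolding P_shift integral_comb_squared by (simp add: V_def s_def norm_mult)
    finally show ?thesis .
  qed
  \<comment> \<open>The constant norm over all translates is averaged in \<open>\<tau>\<close>
    against the probability density \<open>poisson 1\<close>.\<close>
  then have "(\<integral>\<^sup>+\<tau>. (\<integral>\<^sup>+x. ennreal (poisson 1 \<tau>) * (ennreal ((cmod (P (x + \<tau>)))\<^sup>2) * indicator S' x) \<partial>lborel) \<partial>lborel) =
      (\<integral>\<^sup>+\<tau>. ennreal (poisson 1 \<tau>) * ennreal (V * s) \<partial>lborel)"
    by (simp add: nn_integral_cmult)
  also have "\<dots> = (\<integral>\<^sup>+\<tau>. ennreal (poisson 1 \<tau>) \<partial>lborel) * ennreal (V * s)"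
    by (rule nn_integral_multc) measurable
  also have "(\<integral>\<^sup>+\<tau>. ennreal (poisson 1 \<tau>) \<partial>lborel) = (\<integral>\<^sup>+\<tau>. ennreal (poisson 1 \<tau>) \<partial>lebesgue)"
    by (simp add: nn_integral_completion)
  also have "\<dots> = ennreal (LINT \<tau>|lebesgue. poisson 1 \<tau>)"
    using poisson_integrable[of 1] P_nonneg by (intro nn_integral_eq_integral) auto
  also have "\<dots> = 1" by (simp add: poisson_integral)
  finally have eq0: "(\<integral>\<^sup>+\<tau>. (\<integral>\<^sup>+x. ennreal (poisson 1 \<tau>) * (ennreal ((cmod (P (x + \<tau>)))\<^sup>2) * indicator S' x) \<partial>lborel) \<partial>lborel) = ennreal (V * s)"
    by simp
  have "(\<lambda>(\<tau>, x). ennreal (poisson 1 \<tau>) * (ennreal ((cmod (P (x + \<tau>)))\<^sup>2) * indicator S' x)) \<in> borel_measurable (lborel \<Otimes>\<^sub>M lborel)"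
    by measurable
  from lborel_pair.Fubini'[OF this]
  have eq: "(\<integral>\<^sup>+x. (\<integral>\<^sup>+\<tau>. ennreal (poisson 1 \<tau>) * (ennreal ((cmod (P (x + \<tau>)))\<^sup>2) * indicator S' x) \<partial>lborel) \<partial>lborel) = ennreal (V * s)"
    unfolding eq0 .
  \<comment> \<open>In the other order of integration the substitution \<open>y = x + \<tau>\<close>
    moves the translation to the kernel, and comparing kernels removes it at the cost
    \<open>D\<close>.\<close>
  have "ennreal (1 / D) * A * indicator S' x \<le> (\<integral>\<^sup>+\<tau>. ennreal (poisson 1 \<tau>) * (ennreal ((cmod (P (x + \<tau>)))\<^sup>2) * indicator S' x) \<partial>lborel)" for x
  proof (cases "x \<in> S'")
    case True
    then have x: "\<bar>x\<bar> \<le> B" using S'(2) S(2) by force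
    have "(\<integral>\<^sup>+\<tau>. ennreal (poisson 1 \<tau>) * (ennreal ((cmod (P (x + \<tau>)))\<^sup>2) * indicator S' x) \<partial>lborel) =
        (\<integral>\<^sup>+\<tau>. ennreal (poisson 1 \<tau>) * ennreal ((cmod (P (x + \<tau>)))\<^sup>2) \<partial>lborel)"
      using True by simp
    also have "\<dots> = (\<integral>\<^sup>+y. ennreal (poisson 1 (y - x)) * ennreal ((cmod (P y))\<^sup>2) \<partial>lborel)"
    proof -
      have "(\<lambda>\<tau>. ennreal (poisson 1 \<tau>) * ennreal ((cmod (P (x + \<tau>)))\<^sup>2)) \<in> borel_measurable borel"
        by measurable
      from nn_integral_real_affine[OF this, of 1 "- x"] show ?thesis by simp
    qed
    also have "\<dots> \<ge> (\<integral>\<^sup>+y. ennreal (1 / D) * ennreal (poisson 1 y * (cmod (P y))\<^sup>2) \<partial>lborel)"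
    proof (rule nn_integral_mono)
      fix y
      have "(1 / D) * (poisson 1 y * (cmod (P y))\<^sup>2) \<le> poisson 1 (y - x) * (cmod (P y))\<^sup>2"
        using mult_right_mono[OF poisson_shift_le[OF x, of y, folded D_def], of "(cmod (P y))\<^sup>2"] D
        by (simp add: field_simps)
      then show "ennreal (1 / D) * ennreal (poisson 1 y * (cmod (P y))\<^sup>2) \<le> ennreal (poisson 1 (y - x)) * ennreal ((cmod (P y))\<^sup>2)"
        using D P_nonneg by (simp flip: ennreal_mult')
    qed
    also have "(\<integral>\<^sup>+y. ennreal (1 / D) * ennreal (poisson 1 y * (cmod (P y))\<^sup>2) \<partial>lborel) = ennreal (1 / D) * A"
      unfolding A_def by (rule nn_integral_cmult) measurable
    finally show ?thesis using True by simp
  qed simp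
  then have "(\<integral>\<^sup>+x. ennreal (1 / D) * A * indicator S' x \<partial>lborel) \<le> ennreal (V * s)"
    unfolding eq[symmetric] by (intro nn_integral_mono)
  moreover have "(\<integral>\<^sup>+x. ennreal (1 / D) * A * indicator S' x \<partial>lborel) = ennreal (1 / D) * A * ennreal V"
  proof -
    have "(\<integral>\<^sup>+x. 1 * indicator S' x \<partial>lborel) = (\<integral>\<^sup>+x. 1 \<partial>lebesgue_on S)"
      by (rule nn_integral_lebesgue_set[OF S(1) S', symmetric]) measurable
    also have "\<dots> = emeasure lebesgue S" using S(1) by (simp add: emeasure_restrict_space)
    also have "\<dots> = ennreal V" unfolding V_def by (rule emeasure_eq_measure2[OF m])
    finally show ?thesis by (subst nn_integral_cmult) auto
  qed
  ultimately have "ennreal (1 / D) * A * ennreal V \<le> ennreal (V * s)" by simp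
  then have "ennreal (D / V) * (ennreal (1 / D) * A * ennreal V) \<le> ennreal (D / V) * ennreal (V * s)"
    by (intro mult_left_mono) auto
  moreover have "ennreal (D / V) * (ennreal (1 / D) * A * ennreal V) = A"
  proof -
    have "ennreal (D / V) * (ennreal (1 / D) * A * ennreal V) = (ennreal (D / V) * ennreal (1 / D) * ennreal V) * A"
      by (simp add: mult_ac)
    also have "ennreal (D / V) * ennreal (1 / D) * ennreal V = 1"
      using D V by (simp flip: ennreal_mult)
    finally show ?thesis by simp
  qed
  moreover have "ennreal (D / V) * ennreal (V * s) = ennreal (D * s)"
    using D V s by (simp flip: ennreal_mult)
  ultimately have A_le: "A \<le> ennreal (D * s)" by simp
  have A': "A = (\<integral>\<^sup>+t. ennreal (poisson 1 t * (cmod (P t))\<^sup>2) \<partial>lebesgue)"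
    unfolding A_def by (simp add: nn_integral_completion)
  show int: "integrable lebesgue (\<lambda>t. poisson 1 t * (cmod (P t))\<^sup>2)"
  proof (rule integrableI_bounded)
    have "(\<lambda>t. poisson 1 t * (cmod (P t))\<^sup>2) \<in> borel_measurable lborel" by measurable
    then show "(\<lambda>t. poisson 1 t * (cmod (P t))\<^sup>2) \<in> borel_measurable lebesgue"
      by (rule measurable_completion)
    have "(\<integral>\<^sup>+t. ennreal (norm (poisson 1 t * (cmod (P t))\<^sup>2)) \<partial>lebesgue) = A"
      unfolding A' using P_nonneg by (intro nn_integral_cong) simp
    then show "(\<integral>\<^sup>+t. ennreal (norm (poisson 1 t * (cmod (P t))\<^sup>2)) \<partial>lebesgue) < \<infinity>"
      using A_le by (simp add: le_less_trans[OF A_le])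
  qed
  have "ennreal (LINT t|lebesgue. poisson 1 t * (cmod (P t))\<^sup>2) = A"
    unfolding A' using P_nonneg int by (intro nn_integral_eq_integral[symmetric]) auto
  then have "ennreal (LINT t|lebesgue. poisson 1 t * (cmod (P t))\<^sup>2) \<le> ennreal (D * s)"
    using A_le by simp
  then show "(LINT t|lebesgue. poisson 1 t * (cmod (P t))\<^sup>2) \<le> 2 * (1 + B\<^sup>2) * (\<Sum>l\<in>F. (cmod (c l))\<^sup>2)"
    using D s by (simp add: D_def s_def)
qed

text \<open>The frequencies are orthogonal on \<open>S\<close>, not on the interval. By duality the
  weighted bound for exponential sums still gives a Bessel inequality there, with a worse constant
  depending only on \<open>B\<close>.\<close>

lemma bessel_interval:
  assumes S: "S \<in> sets lebesgue" "S \<subseteq> {- B..<B}" "measure lebesgue S > 0"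
    and F: "finite F" "hat_orth S F" and g: "sqint (lebesgue_on {- B..<B}) g"
  shows "(\<Sum>l\<in>F. (cmod (ip (lebesgue_on {- B..<B}) g (exp_char l)))\<^sup>2) \<le>
    2 * pi * (1 + B\<^sup>2)\<^sup>2 * (LINT x|lebesgue_on {- B..<B}. (cmod (g x))\<^sup>2)"
proof -
  let ?J = "lebesgue_on {- B..<B}"
  define b where "b l = ip ?J g (exp_char l)" for l
  define P where "P x = (\<Sum>l\<in>F. b l * exp_char l x)" for x
  define s where "s = (\<Sum>l\<in>F. (cmod (b l))\<^sup>2)"
  \<comment> \<open>The product of \<open>pi * (1 + B\<^sup>2)\<close>, the reciprocal of the least
    value of \<open>poisson 1\<close> on the interval, and the constant
    \<open>2 * (1 + B\<^sup>2)\<close> of the weighted bound.\<close>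
  define C where "C = 2 * pi * (1 + B\<^sup>2)\<^sup>2"
  have "1 + B\<^sup>2 > 0" by (simp add: add_pos_nonneg)
  then have C: "C > 0" by (simp add: C_def)
  have sP: "sqint ?J P" unfolding P_def by (intro sqint_sum sqint_cmult sqint_exp_char) simp
  have "(LINT x|?J. (cmod (P x))\<^sup>2) \<le> C * s"
  proof -
    have w: "integrable lebesgue (\<lambda>t. poisson 1 t * (cmod (P t))\<^sup>2)"
      "(LINT t|lebesgue. poisson 1 t * (cmod (P t))\<^sup>2) \<le> 2 * (1 + B\<^sup>2) * s"
      unfolding P_def s_def by (rule poisson_norm_le[OF S F])+
    have "(LINT x|?J. (cmod (P x))\<^sup>2) = (LINT x|lebesgue. (if x \<in> {- B..<B} then (cmod (P x))\<^sup>2 else 0))"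
      by (rule Lebesgue_Measure.integral_restrict_UNIV[symmetric]) simp
    also have "\<dots> \<le> (LINT x|lebesgue. (pi * (1 + B\<^sup>2)) * (poisson 1 x * (cmod (P x))\<^sup>2))"
    proof (rule integral_mono)
      show "integrable lebesgue (\<lambda>x. if x \<in> {- B..<B} then (cmod (P x))\<^sup>2 else 0)"
        using sP by (subst Lebesgue_Measure.integrable_restrict_UNIV) (auto simp: sqint_def)
      show "integrable lebesgue (\<lambda>x. (pi * (1 + B\<^sup>2)) * (poisson 1 x * (cmod (P x))\<^sup>2))"
        using w(1) by (rule integrable_mult_right)
      fix x
      show "(if x \<in> {- B..<B} then (cmod (P x))\<^sup>2 else 0) \<le> pi * (1 + B\<^sup>2) * (poisson 1 x * (cmod (P x))\<^sup>2)"
      proof (cases "x \<in> {- B..<B}")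
        case True
        then have "x\<^sup>2 \<le> B\<^sup>2" by (intro abs_le_square_iff[THEN iffD1]) auto
        then have "1 \<le> pi * (1 + B\<^sup>2) * poisson 1 x"
          by (simp add: poisson_def divide_simps add_pos_nonneg)
        then have "1 * (cmod (P x))\<^sup>2 \<le> pi * (1 + B\<^sup>2) * poisson 1 x * (cmod (P x))\<^sup>2"
          by (intro mult_right_mono) auto
        then show ?thesis using True by (simp add: mult.assoc)
      next
        case False
        then show ?thesis using poisson_pos[of 1 x] by (auto intro!: mult_nonneg_nonneg simp: less_imp_le)
      qed
    qed
    also have "\<dots> = (pi * (1 + B\<^sup>2)) * (LINT x|lebesgue. poisson 1 x * (cmod (P x))\<^sup>2)" by simp
    also have "\<dots> \<le> (pi * (1 + B\<^sup>2)) * (2 * (1 + B\<^sup>2) * s)"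
      using w(2) by (intro mult_left_mono) auto
    finally show ?thesis by (simp add: C_def power2_eq_square mult_ac)
  qed
  then have "(LINT x|?J. (cmod (P x))\<^sup>2) / C\<^sup>2 \<le> C * s / C\<^sup>2"
    by (rule divide_right_mono) simp
  \<comment> \<open>The test function is \<open>P / C\<close>: with the norm bound
    \<open>C * s\<close> the expanded square has linear term \<open>2 * s / C\<close> against
    quadratic term at most \<open>s / C\<close>, which leaves the desired inequality.\<close>
  moreover have ips: "ip ?J g (\<lambda>x. of_real (1 / C) * P x) = of_real (s / C)"
  proof -
    have "ip ?J g (\<lambda>x. of_real (1 / C) * P x) = ip ?J g (\<lambda>x. \<Sum>l\<in>F. (of_real (1 / C) * b l) * exp_char l x)"
      by (simp add: P_def sum_distrib_left mult.assoc)
    also have "\<dots> = (\<Sum>l\<in>F. cnj (of_real (1 / C) * b l) * b l)"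
      unfolding b_def by (rule ip_sum_right[OF g sqint_exp_char]) simp
    also have "\<dots> = of_real (1 / C) * (\<Sum>l\<in>F. b l * cnj (b l))"
      by (simp add: sum_distrib_left mult_ac)
    also have "\<dots> = of_real (s / C)"
      unfolding mult_cnj_eq_cmod_squared by (simp add: s_def)
    finally show ?thesis .
  qed
  moreover have "0 \<le> (LINT x|?J. (cmod (g x))\<^sup>2) - 2 * (s / C) + (LINT x|?J. (cmod (P x))\<^sup>2) / C\<^sup>2"
  proof -
  have "0 \<le> (LINT x|?J. (cmod (g x - of_real (1 / C) * P x))\<^sup>2)" by simp
  also have "\<dots> = (LINT x|?J. (cmod (g x))\<^sup>2) - 2 * (s / C) + (LINT x|?J. (cmod (of_real (1 / C) * P x))\<^sup>2)"
    unfolding integral_norm_diff_squared[OF g sqint_cmult[OF sP, of "of_real (1 / C)"]] ips Re_complex_of_real ..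
  also have "(LINT x|?J. (cmod (of_real (1 / C) * P x))\<^sup>2) = (LINT x|?J. (cmod (P x))\<^sup>2) / C\<^sup>2"
    using C by (simp add: norm_mult norm_divide power_mult_distrib power_divide)
  finally show ?thesis .
  qed
  ultimately have "0 \<le> (LINT x|?J. (cmod (g x))\<^sup>2) - 2 * (s / C) + C * s / C\<^sup>2"
    by linarith
  then have "s / C \<le> (LINT x|?J. (cmod (g x))\<^sup>2)" using C by (simp add: power2_eq_square)
  then have "s \<le> C * (LINT x|?J. (cmod (g x))\<^sup>2)" using C by (simp add: divide_le_eq mult.commute)
  then show ?thesis unfolding s_def b_def C_def .
qed

section \<open>Uniform decay over orthogonal frequencies\<close>

lemma finite_set_separated:
  fixes Z :: "real set"
  assumes "finite Z"
  obtains \<delta> where "\<delta> > 0" "\<And>x y. x \<in> Z \<Longrightarrow> y \<in> Z \<Longrightarrow> x \<noteq> y \<Longrightarrow> \<bar>x - y\<bar> \<ge> \<delta>"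
proof -
  \<comment> \<open>The extra element 1 keeps the minimum defined when there are no two distinct
    points.\<close>
  define D where "D = insert 1 ((\<lambda>(x, y). \<bar>x - y\<bar>) ` {(x, y). x \<in> Z \<and> y \<in> Z \<and> x \<noteq> y})"
  have "finite {(x, y). x \<in> Z \<and> y \<in> Z \<and> x \<noteq> y}"
    by (rule finite_subset[of _ "Z \<times> Z"]) (use assms in auto)
  then have D: "finite D" "D \<noteq> {}" by (auto simp: D_def)
  have "Min D > 0" unfolding Min_gr_iff[OF D] by (auto simp: D_def)
  moreover have "\<bar>x - y\<bar> \<ge> Min D" if "x \<in> Z" "y \<in> Z" "x \<noteq> y" for x y
    using that D(1) by (intro Min_le) (auto simp: D_def)
  ultimately show ?thesis using that by blast
qed

text \<open>Differences of distinct frequencies are nonzero zeros of \<open>hat S\<close>, and only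
  finitely many zeros lie near 0. Hence one gap serves all orthogonal sets.\<close>

lemma hat_orth_separated:
  assumes S: "S \<in> sets lebesgue" "bounded S" "measure lebesgue S > 0"
  obtains \<delta> where "\<delta> > 0"
    "\<And>L l m. hat_orth S L \<Longrightarrow> l \<in> L \<Longrightarrow> m \<in> L \<Longrightarrow> l \<noteq> m \<Longrightarrow> \<bar>l - m\<bar> \<ge> \<delta>"
proof -
  define Z where "Z = insert 0 {l \<in> {- 1..1}. hat S l = 0}"
  have "finite Z" using finite_zeros_hat[OF S, of 1] by (simp add: Z_def)
  then obtain \<delta> where \<delta>: "\<delta> > 0" "\<And>x y. x \<in> Z \<Longrightarrow> y \<in> Z \<Longrightarrow> x \<noteq> y \<Longrightarrow> \<bar>x - y\<bar> \<ge> \<delta>"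
    by (rule finite_set_separated) blast
  show ?thesis
  proof (rule that[of "min 1 \<delta>"])
    fix L l m assume L: "hat_orth S L" "l \<in> L" "m \<in> L" "l \<noteq> m"
    show "min 1 \<delta> \<le> \<bar>l - m\<bar>"
    proof (cases "\<bar>l - m\<bar> \<le> 1")
      case True
      then have "l - m \<in> Z" using L by (auto simp: Z_def hat_orth_def)
      then show ?thesis using \<delta>(2)[of "l - m" 0] L(4) by (simp add: Z_def)
    qed simp
  qed (use \<delta> in simp)
qed

text \<open>A bin of length \<open>\<delta>\<close> contains at most one point of \<open>F\<close>,
  so a sum over \<open>F\<close> is a sum over distinct bin indices.\<close>

lemma sum_separated_le:
  fixes f :: "real \<Rightarrow> real" and b :: "nat \<Rightarrow> real"
  assumes F: "\<And>l. l \<in> F \<Longrightarrow> l \<ge> 0" and \<delta>: "\<delta> > 0"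
    and sep: "\<And>l m. l \<in> F \<Longrightarrow> m \<in> F \<Longrightarrow> l \<noteq> m \<Longrightarrow> \<bar>l - m\<bar> \<ge> \<delta>"
    and le: "\<And>l. l \<in> F \<Longrightarrow> f l \<le> b (nat \<lfloor>l / \<delta>\<rfloor>)"
  shows "(\<Sum>l\<in>F. f l) \<le> (\<Sum>j\<in>(\<lambda>l. nat \<lfloor>l / \<delta>\<rfloor>) ` F. b j)"
proof -
  have "inj_on (\<lambda>l. nat \<lfloor>l / \<delta>\<rfloor>) F"
  proof (rule inj_onI, rule ccontr)
    fix l m assume lm: "l \<in> F" "m \<in> F" "nat \<lfloor>l / \<delta>\<rfloor> = nat \<lfloor>m / \<delta>\<rfloor>" "l \<noteq> m"
    then have "\<lfloor>l / \<delta>\<rfloor> = \<lfloor>m / \<delta>\<rfloor>"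
      using F \<delta> by (metis eq_nat_nat_iff zero_le_floor divide_nonneg_pos)
    then have "\<bar>l / \<delta> - m / \<delta>\<bar> < 1" by linarith
    then have "\<bar>l - m\<bar> < \<delta>" using \<delta> by (simp add: field_simps flip: diff_divide_distrib)
    then show False using sep[OF lm(1,2,4)] by simp
  qed
  then have "(\<Sum>j\<in>(\<lambda>l. nat \<lfloor>l / \<delta>\<rfloor>) ` F. b j) = (\<Sum>l\<in>F. b (nat \<lfloor>l / \<delta>\<rfloor>))"
    by (simp add: sum.reindex)
  then show ?thesis using le by (simp add: sum_mono)
qed

lemma summable_tail:
  fixes b :: "nat \<Rightarrow> real"
  assumes "summable b" "\<And>j. b j \<ge> 0" "e > 0"
  obtains N where "\<And>J. finite J \<Longrightarrow> J \<subseteq> {N..} \<Longrightarrow> sum b J < e"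
proof -
  obtain N where N: "\<And>m n. m \<ge> N \<Longrightarrow> norm (sum b {m..<n}) < e"
    using assms(1,3) unfolding summable_Cauchy by meson
  have "sum b J < e" if J: "finite J" "J \<subseteq> {N..}" for J
  proof -
    obtain n where "J \<subseteq> {..<n}" using J(1) finite_nat_bounded by blast
    then have "sum b J \<le> sum b {N..<n}" using J assms(2) by (intro sum_mono2) auto
    then show ?thesis using N[of N n] by simp
  qed
  then show ?thesis using that by blast
qed

lemma inverse_squares_tail:
  fixes \<delta> e :: real
  assumes \<delta>: "\<delta> > 0" and e: "e > 0"
  obtains R where "R > 0" "\<And>F. finite F \<Longrightarrow> (\<And>l. l \<in> F \<Longrightarrow> \<bar>l\<bar> \<ge> R) \<Longrightarrow>
    (\<And>l m. l \<in> F \<Longrightarrow> m \<in> F \<Longrightarrow> l \<noteq> m \<Longrightarrow> \<bar>l - m\<bar> \<ge> \<delta>) \<Longrightarrow> (\<Sum>l\<in>F. 1 / l\<^sup>2) < e"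
proof -
  define b where "b j = (1 / \<delta>\<^sup>2) * inverse ((real j)\<^sup>2)" for j
  have b: "summable b" "\<And>j. b j \<ge> 0"
    unfolding b_def using inverse_power_summable[of 2, where 'a=real] by (auto intro!: summable_mult)
  obtain N where N: "\<And>J. finite J \<Longrightarrow> J \<subseteq> {N..} \<Longrightarrow> sum b J < e / 2"
    using summable_tail[OF b, of "e / 2"] e by (metis half_gt_zero)
  \<comment> \<open>The additional 1 keeps \<open>R\<close> and the bin indices positive, so that
    the comparison terms have nonzero denominators.\<close>
  define R where "R = \<delta> * (real N + 1)"
  have pos: "(\<Sum>l\<in>F. 1 / l\<^sup>2) < e / 2" if F: "finite F" "\<And>l. l \<in> F \<Longrightarrow> l \<ge> R"
    "\<And>l m. l \<in> F \<Longrightarrow> m \<in> F \<Longrightarrow> l \<noteq> m \<Longrightarrow> \<bar>l - m\<bar> \<ge> \<delta>" for F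
  proof -
    have R: "R > 0" using \<delta> by (simp add: R_def)
    have fl: "real (nat \<lfloor>l / \<delta>\<rfloor>) \<le> l / \<delta>" "N + 1 \<le> nat \<lfloor>l / \<delta>\<rfloor>" if "l \<in> F" for l
    proof -
      have "real N + 1 \<le> l / \<delta>" using F(2)[OF that] \<delta> by (simp add: R_def field_simps)
      then have "int N + 1 \<le> \<lfloor>l / \<delta>\<rfloor>" by (simp add: le_floor_iff)
      then show "N + 1 \<le> nat \<lfloor>l / \<delta>\<rfloor>" by linarith
      have "0 \<le> l / \<delta>" using \<open>real N + 1 \<le> l / \<delta>\<close> by linarith
      then show "real (nat \<lfloor>l / \<delta>\<rfloor>) \<le> l / \<delta>" by (simp add: of_nat_nat)
    qed
    have "(\<Sum>l\<in>F. 1 / l\<^sup>2) \<le> (\<Sum>j\<in>(\<lambda>l. nat \<lfloor>l / \<delta>\<rfloor>) ` F. b j)"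
    proof (rule sum_separated_le[OF _ \<delta> F(3)])
      show "l \<ge> 0" if "l \<in> F" for l using F(2)[OF that] R by simp
      fix l assume l: "l \<in> F"
      have j: "0 < \<delta> * real (nat \<lfloor>l / \<delta>\<rfloor>)" "\<delta> * real (nat \<lfloor>l / \<delta>\<rfloor>) \<le> l"
      proof -
        have "0 < nat \<lfloor>l / \<delta>\<rfloor>" using fl(2)[OF l] by linarith
        then show "0 < \<delta> * real (nat \<lfloor>l / \<delta>\<rfloor>)" using \<delta> by simp
        show "\<delta> * real (nat \<lfloor>l / \<delta>\<rfloor>) \<le> l" using fl(1)[OF l] \<delta> by (simp add: field_simps)
      qed
      then have "(\<delta> * real (nat \<lfloor>l / \<delta>\<rfloor>))\<^sup>2 \<le> l\<^sup>2" by (intro power_mono) auto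
      then have "1 / l\<^sup>2 \<le> 1 / (\<delta> * real (nat \<lfloor>l / \<delta>\<rfloor>))\<^sup>2" 
        by (intro divide_left_mono mult_pos_pos zero_less_power[OF j(1)] zero_less_power) (use j in linarith)+
      also have "\<dots> = b (nat \<lfloor>l / \<delta>\<rfloor>)" by (simp add: b_def power_mult_distrib divide_inverse)
      finally show "1 / l\<^sup>2 \<le> b (nat \<lfloor>l / \<delta>\<rfloor>)" .
    qed
    also have "\<dots> < e / 2"
      using F(1) fl(2) by (intro N) (auto intro: order_trans[of N "N + 1"])
    finally show ?thesis .
  qed
  show ?thesis
  proof (rule that[of R])
    show "R > 0" using \<delta> by (simp add: R_def)
    fix F assume F: "finite F" "\<And>l. l \<in> F \<Longrightarrow> \<bar>l\<bar> \<ge> R"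
      "\<And>l m. l \<in> F \<Longrightarrow> m \<in> F \<Longrightarrow> l \<noteq> m \<Longrightarrow> \<bar>l - m\<bar> \<ge> \<delta>"
    have "F = {l\<in>F. l \<ge> 0} \<union> {l\<in>F. l < 0}" by auto
    then have "(\<Sum>l\<in>F. 1 / l\<^sup>2) = (\<Sum>l\<in>{l\<in>F. l \<ge> 0}. 1 / l\<^sup>2) + (\<Sum>l\<in>{l\<in>F. l < 0}. 1 / l\<^sup>2)"
      using F(1) by (subst sum.union_disjoint[symmetric]) auto
    also have "(\<Sum>l\<in>{l\<in>F. l < 0}. 1 / l\<^sup>2) = (\<Sum>l\<in>uminus ` {l\<in>F. l < 0}. 1 / l\<^sup>2)"
      by (subst sum.reindex) auto
    also have "(\<Sum>l\<in>{l\<in>F. l \<ge> 0}. 1 / l\<^sup>2) < e / 2"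
      using F by (intro pos) fastforce+
    also have "(\<Sum>l\<in>uminus ` {l\<in>F. l < 0}. 1 / l\<^sup>2) < e / 2"
    proof (rule pos)
      show "R \<le> l" if "l \<in> uminus ` {l\<in>F. l < 0}" for l using that F(2) by fastforce
      fix l m assume "l \<in> uminus ` {l\<in>F. l < 0}" "m \<in> uminus ` {l\<in>F. l < 0}" "l \<noteq> m"
      then show "\<delta> \<le> \<bar>l - m\<bar>" using F(3)[of "- l" "- m"] by auto
    qed (use F in auto)
    finally show "(\<Sum>l\<in>F. 1 / l\<^sup>2) < e" by simp
  qed
qed

lemma norm_hat_interval_le:
  assumes "B > 0" "l \<noteq> 0"
  shows "cmod (hat {- B..<B} l) \<le> 1 / (pi * \<bar>l\<bar>)"
proof -
  have "hat {- B..<B} l = (exp_char l B - exp_char l (- B)) / (2 * of_real pi * \<i> * of_real l)"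
    unfolding hat_def using assms by (simp add: integral_half_open_eq_closed integral_exp_char_interval)
  then have "cmod (hat {- B..<B} l) = cmod (exp_char l B - exp_char l (- B)) / (2 * pi * \<bar>l\<bar>)"
    by (simp add: norm_divide norm_mult)
  also have "\<dots> \<le> 2 / (2 * pi * \<bar>l\<bar>)"
    using norm_triangle_ineq4[of "exp_char l B" "exp_char l (- B)"] by (intro divide_right_mono) auto
  finally show ?thesis by simp
qed

lemma indicator_trig_approx:
  assumes S: "S \<in> sets lebesgue" "S \<subseteq> {- B..<B}" and B: "B > 0" and e: "e > 0"
  obtains M d where "finite M"
    "(LINT x|lebesgue_on {- B..<B}. (cmod (indicator S x - (\<Sum>m\<in>M. d m * exp_char m x)))\<^sup>2) < e"
proof -
  define f where "f x = (indicator S (- B + 2 * B * x) :: complex)" for x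
  have "(\<lambda>x. indicator S (- B + (2 * B) *\<^sub>R x) :: complex) \<in> borel_measurable lebesgue"
    using S B by (intro borel_measurable_affine[of "indicator S :: real \<Rightarrow> complex"]) auto
  then have "f \<in> borel_measurable (lebesgue_on {0..<1})"
    unfolding f_def by (intro measurable_restrict_space1) simp
  then have f: "sqint (lebesgue_on {0..<1}) f"
    by (intro sqint_bounded[where B=1] finite_measure_lebesgue_on) (auto simp: f_def indicator_def)
  have "e / (2 * B) > 0" using e B by simp
  from exp_dense_unit_interval[unfolded exp_dense_def, rule_format, OF f this]
  obtain F c where F: "finite F" and
    c: "(LINT x|lebesgue_on {0..<1}. (cmod (f x - (\<Sum>l\<in>F. c l * exp_char l x)))\<^sup>2) < e / (2 * B)"
    by (elim exE conjE)
  define M where "M = (\<lambda>l. l / (2 * B)) ` F"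
  \<comment> \<open>The factor \<open>exp_char m B\<close> undoes the translation by
    \<open>- B\<close> in the affine map from the unit interval.\<close>
  define d where "d m = c (2 * B * m) * exp_char m B" for m
  have sum: "(\<Sum>m\<in>M. d m * exp_char m (- B + 2 * B * x)) = (\<Sum>l\<in>F. c l * exp_char l x)" for x
  proof -
    have "(\<Sum>m\<in>M. d m * exp_char m (- B + 2 * B * x)) = (\<Sum>l\<in>F. d (l / (2 * B)) * exp_char (l / (2 * B)) (- B + 2 * B * x))"
      unfolding M_def using B by (subst sum.reindex) (auto simp: inj_on_def)
    also have "\<dots> = (\<Sum>l\<in>F. c l * exp_char l x)"
    proof (rule sum.cong[OF refl])
      fix l
      have "exp_char (l / (2 * B)) B * exp_char (l / (2 * B)) (- B + 2 * B * x) = exp_char (l / (2 * B)) (B + (- B + 2 * B * x))"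
        by (rule exp_char_add_right[symmetric])
      also have "\<dots> = exp_char l x" using B by (simp add: exp_char_scale)
      finally show "d (l / (2 * B)) * exp_char (l / (2 * B)) (- B + 2 * B * x) = c l * exp_char l x"
        using B by (simp add: d_def mult.assoc)
    qed
    finally show ?thesis .
  qed
  define G where "G x = (cmod (indicator S x - (\<Sum>m\<in>M. d m * exp_char m x)))\<^sup>2" for x
  have mem: "- B + 2 * B * x \<in> {- B..<B} \<longleftrightarrow> x \<in> {0..<1}" for x
    using B by (auto simp: zero_le_mult_iff)
  have "(LINT x|lebesgue_on {- B..<B}. G x) = (LINT x|lebesgue. (if x \<in> {- B..<B} then G x else 0))"
    by (rule Lebesgue_Measure.integral_restrict_UNIV[symmetric]) simp
  also have "\<dots> = 2 * B * (LINT x|lebesgue. (if - B + 2 * B * x \<in> {- B..<B} then G (- B + 2 * B * x) else 0))"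
    using lebesgue_integral_real_affine[of "2 * B" "\<lambda>x. if x \<in> {- B..<B} then G x else 0" "- B"] B by simp
  also have "(LINT x|lebesgue. (if - B + 2 * B * x \<in> {- B..<B} then G (- B + 2 * B * x) else 0)) =
      (LINT x|lebesgue. (if x \<in> {0..<1} then G (- B + 2 * B * x) else 0))"
    unfolding mem ..
  also have "\<dots> = (LINT x|lebesgue_on {0..<1}. G (- B + 2 * B * x))"
    by (rule Lebesgue_Measure.integral_restrict_UNIV) simp
  also have "\<dots> = (LINT x|lebesgue_on {0..<1}. (cmod (f x - (\<Sum>l\<in>F. c l * exp_char l x)))\<^sup>2)"
    unfolding G_def sum f_def ..
  also have "2 * B * \<dots> < e" using c B by (simp add: field_simps)
  finally show ?thesis using that[of M d] F by (simp add: G_def M_def)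
qed

text \<open>The transform of an indicator need not decay at a known rate. Up to a small error in the
  mean square, controlled by \<open>bessel_interval\<close>, the indicator is a trigonometric
  polynomial; the latter contributes decay of order \<open>1 / \<bar>l\<bar>\<close>, and the
  squares are summable uniformly over separated frequencies.\<close>

lemma uniform_tail:
  assumes S: "S \<in> sets lebesgue" "bounded S" "measure lebesgue S > 0" and e: "e > 0"
  obtains R where "R > 0" "\<And>F. finite F \<Longrightarrow> hat_orth S F \<Longrightarrow> (\<And>l. l \<in> F \<Longrightarrow> \<bar>l\<bar> \<ge> R) \<Longrightarrow>
    (\<Sum>l\<in>F. (cmod (hat S l))\<^sup>2) < e"
proof -
  obtain B0 where B0: "\<And>x. x \<in> S \<Longrightarrow> \<bar>x\<bar> \<le> B0" using S(2) by (auto simp: bounded_iff)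
  define B where "B = \<bar>B0\<bar> + 1"
  have B: "B > 0" "S \<subseteq> {- B..<B}" using B0 by (force simp: B_def)+
  let ?J = "lebesgue_on {- B..<B}"
  define C where "C = 2 * pi * (1 + B\<^sup>2)\<^sup>2"
  have "1 + B\<^sup>2 > 0" by (simp add: add_pos_nonneg)
  then have C: "C > 0" by (simp add: C_def)
  \<comment> \<open>The error term is bounded by \<open>C * (e / (4 * C))\<close>, the polynomial
    term by less than \<open>e / 4\<close>, and each is doubled by
    \<open>norm_add_squared_le\<close>.\<close>
  have "e / (4 * C) > 0" using C e by simp
  then obtain M d where M: "finite M" and
    d: "(LINT x|?J. (cmod (indicator S x - (\<Sum>m\<in>M. d m * exp_char m x)))\<^sup>2) < e / (4 * C)"
    by (rule indicator_trig_approx[OF S(1) B(2,1)])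
  define g where "g x = (\<Sum>m\<in>M. d m * exp_char m x)" for x
  define f where "f x = indicator S x - g x" for x
  have sg: "sqint ?J g" unfolding g_def by (intro sqint_sum sqint_cmult sqint_exp_char) simp
  have si: "sqint ?J (indicator S)"
    using S(1) by (intro sqint_bounded[where B=1] finite_measure_lebesgue_on measurable_restrict_space1) (auto simp: indicator_def)
  have sf: "sqint ?J f" unfolding f_def by (rule sqint_diff[OF si sg])
  have hat_eq: "cmod (hat S l) = cmod (ip ?J (indicator S) (exp_char l))" for l
  proof -
    have "ip ?J (indicator S) (exp_char l) = (LINT x|?J. (if x \<in> S then exp_char (- l) x else 0))"
      unfolding ip_def by (intro Bochner_Integration.integral_cong) (auto simp: cnj_exp_char)
    also have "\<dots> = hat S (- l)"
      unfolding hat_def using S(1) B(2) by (intro Lebesgue_Measure.integral_restrict) auto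
    finally show ?thesis by (simp add: hat_uminus)
  qed
  have ip_add: "ip ?J (indicator S) (exp_char l) = ip ?J f (exp_char l) + ip ?J g (exp_char l)" for l
  proof -
    have "ip ?J (indicator S) (exp_char l) = (LINT x|?J. f x * cnj (exp_char l x) + g x * cnj (exp_char l x))"
      unfolding ip_def f_def by (simp add: algebra_simps)
    also have "\<dots> = ip ?J f (exp_char l) + ip ?J g (exp_char l)"
      unfolding ip_def by (intro Bochner_Integration.integral_add sqint_mult_integrable sf sg sqint_exp_char) simp_all
    finally show ?thesis .
  qed
  \<comment> \<open>Beyond this radius every \<open>m\<close> in \<open>M\<close> is at most half of
    \<open>l\<close> in absolute value, so \<open>l - m\<close> keeps at least half the size of
    \<open>l\<close>.\<close>
  define R1 where "R1 = 1 + 2 * (\<Sum>m\<in>M. \<bar>m\<bar>)"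
  define D where "D = 1 + (\<Sum>m\<in>M. cmod (d m) * 2 / pi)"
  have D: "D > 0" by (simp add: D_def add_pos_nonneg sum_nonneg)
  have ip_g: "(cmod (ip ?J g (exp_char l)))\<^sup>2 \<le> D\<^sup>2 * (1 / l\<^sup>2)" if l: "\<bar>l\<bar> \<ge> R1" for l
  proof -
    have "0 \<le> (\<Sum>m\<in>M. \<bar>m\<bar>)" by (simp add: sum_nonneg)
    then have l0: "\<bar>l\<bar> > 0" using l unfolding R1_def by linarith
    have "ip ?J g (exp_char l) = cnj (ip ?J (exp_char l) g)" by (rule ip_commute)
    also have "\<dots> = (\<Sum>m\<in>M. d m * cnj (hat {- B..<B} (l - m)))"
      unfolding g_def by (subst ip_sum_right) (auto intro!: sqint_exp_char simp: ip_exp_char)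
    also have "cmod \<dots> \<le> (\<Sum>m\<in>M. (cmod (d m) * 2 / pi) * (1 / \<bar>l\<bar>))"
    proof (rule sum_norm_le)
      fix m assume "m \<in> M"
      then have "\<bar>m\<bar> \<le> (\<Sum>m\<in>M. \<bar>m\<bar>)" using M by (intro member_le_sum) auto
      moreover from this have "0 \<le> (\<Sum>m\<in>M. \<bar>m\<bar>)" by linarith
      ultimately have lm: "\<bar>l\<bar> / 2 \<le> \<bar>l - m\<bar>" "\<bar>l - m\<bar> > 0" using l unfolding R1_def by linarith+
      then have "cmod (hat {- B..<B} (l - m)) \<le> 1 / (pi * \<bar>l - m\<bar>)"
        using B(1) by (intro norm_hat_interval_le) auto
      also have "\<dots> \<le> 1 / (pi * (\<bar>l\<bar> / 2))"
        using lm l0 by (intro divide_left_mono mult_left_mono) auto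
      finally have "cmod (d m) * cmod (hat {- B..<B} (l - m)) \<le> cmod (d m) * (1 / (pi * (\<bar>l\<bar> / 2)))"
        by (intro mult_left_mono) auto
      then show "norm (d m * cnj (hat {- B..<B} (l - m))) \<le> (cmod (d m) * 2 / pi) * (1 / \<bar>l\<bar>)"
        by (simp add: norm_mult mult.commute)
    qed
    also have "\<dots> = (\<Sum>m\<in>M. cmod (d m) * 2 / pi) * (1 / \<bar>l\<bar>)" by (rule sum_distrib_right[symmetric])
    also have "\<dots> \<le> D * (1 / \<bar>l\<bar>)" by (intro mult_right_mono) (auto simp: D_def)
    finally have "(cmod (ip ?J g (exp_char l)))\<^sup>2 \<le> (D * (1 / \<bar>l\<bar>))\<^sup>2" by (intro power_mono) auto
    then show ?thesis by (simp add: power_mult_distrib power_divide)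
  qed
  obtain \<delta> where \<delta>: "\<delta> > 0" "\<And>L l m. hat_orth S L \<Longrightarrow> l \<in> L \<Longrightarrow> m \<in> L \<Longrightarrow> l \<noteq> m \<Longrightarrow> \<bar>l - m\<bar> \<ge> \<delta>"
    by (rule hat_orth_separated[OF S]) blast
  have "e / (4 * D\<^sup>2) > 0" using e D by simp
  then obtain R2 where R2: "R2 > 0" "\<And>F. finite F \<Longrightarrow> (\<And>l. l \<in> F \<Longrightarrow> \<bar>l\<bar> \<ge> R2) \<Longrightarrow>
    (\<And>l m. l \<in> F \<Longrightarrow> m \<in> F \<Longrightarrow> l \<noteq> m \<Longrightarrow> \<bar>l - m\<bar> \<ge> \<delta>) \<Longrightarrow> (\<Sum>l\<in>F. 1 / l\<^sup>2) < e / (4 * D\<^sup>2)"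
    by (rule inverse_squares_tail[OF \<delta>(1)]) blast
  show ?thesis
  proof (rule that[of "max R1 R2"])
    show "max R1 R2 > 0" using R2 by simp
    fix F assume F: "finite F" "hat_orth S F" "\<And>l. l \<in> F \<Longrightarrow> \<bar>l\<bar> \<ge> max R1 R2"
    have "(\<Sum>l\<in>F. (cmod (hat S l))\<^sup>2) \<le> (\<Sum>l\<in>F. 2 * (cmod (ip ?J f (exp_char l)))\<^sup>2 + 2 * (cmod (ip ?J g (exp_char l)))\<^sup>2)"
      unfolding hat_eq ip_add by (intro sum_mono norm_add_squared_le)
    also have "\<dots> = 2 * (\<Sum>l\<in>F. (cmod (ip ?J f (exp_char l)))\<^sup>2) + 2 * (\<Sum>l\<in>F. (cmod (ip ?J g (exp_char l)))\<^sup>2)"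
      by (simp add: sum.distrib sum_distrib_left)
    also have "(\<Sum>l\<in>F. (cmod (ip ?J f (exp_char l)))\<^sup>2) \<le> C * (LINT x|?J. (cmod (f x))\<^sup>2)"
      unfolding C_def by (rule bessel_interval[OF S(1) B(2) S(3) F(1,2) sf])
    also have "C * (LINT x|?J. (cmod (f x))\<^sup>2) \<le> C * (e / (4 * C))"
      using d C unfolding f_def g_def by (intro mult_left_mono less_imp_le) auto
    also have "C * (e / (4 * C)) = e / 4" using C by simp
    also have "(\<Sum>l\<in>F. (cmod (ip ?J g (exp_char l)))\<^sup>2) \<le> (\<Sum>l\<in>F. D\<^sup>2 * (1 / l\<^sup>2))"
      using F(3) by (intro sum_mono ip_g) force
    also have "\<dots> = D\<^sup>2 * (\<Sum>l\<in>F. 1 / l\<^sup>2)" by (simp add: sum_distrib_left)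
    also have "(\<Sum>l\<in>F. 1 / l\<^sup>2) < e / (4 * D\<^sup>2)"
      using F(1,3) \<delta>(2)[OF F(2)] by (intro R2(2)) force+
    also have "D\<^sup>2 * (e / (4 * D\<^sup>2)) = e / 4" using D by simp
    finally show "(\<Sum>l\<in>F. (cmod (hat S l))\<^sup>2) < e" using D by simp
  qed
qed

section \<open>Boundary uniqueness\<close>

lemma le_one_plus_square: "(x :: real) \<ge> 0 \<Longrightarrow> x \<le> 1 + x\<^sup>2"
  using sum_squares_bound[of x 1] by simp

text \<open>
  An exponential sum with positive frequencies is small high up in the upper half plane, so \<open>1 - P\<close>
  is not small there; by Jensen's inequality it cannot be too small on a set of positive measure.
\<close>

lemma one_not_approximable:
  assumes S: "S \<in> sets lebesgue" "bounded S" "measure lebesgue S > 0" and \<delta>0: "\<delta>0 > 0"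
  obtains \<epsilon> where "\<epsilon> > 0" "\<And>F c. finite F \<Longrightarrow> F \<subseteq> {\<delta>0..} \<Longrightarrow> hat_orth S F \<Longrightarrow>
    \<epsilon> \<le> (LINT x|lebesgue_on S. (cmod (1 - (\<Sum>l\<in>F. c l * exp_char l x)))\<^sup>2)"
proof -
  obtain B0 where B0: "\<And>x. x \<in> S \<Longrightarrow> \<bar>x\<bar> \<le> B0" using S(2) by (auto simp: bounded_iff)
  define B where "B = \<bar>B0\<bar> + 1"
  have B: "B > 0" "S \<subseteq> {- B..<B}" using B0 by (force simp: B_def)+
  let ?M = "lebesgue_on S"
  define V where "V = measure lebesgue S"
  have V: "V > 0" using S by (simp add: V_def)
  have m: "S \<in> lmeasurable" by (rule bounded_set_imp_lmeasurable[OF S(2,1)])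
  \<comment> \<open>An a priori bound for the sum of the squared coefficients: an approximant with
    squared error at most 1 has squared norm at most \<open>2 * V + 2\<close> on \<open>S\<close>,
    and orthogonality divides by \<open>V\<close>.\<close>
  define A where "A = (2 * V + 2) / V"
  have A: "A > 2" using V by (simp add: A_def field_simps)
  define D where "D = 2 * (1 + B\<^sup>2)"
  have D: "D > 0" by (simp add: D_def add_pos_nonneg)
  obtain \<delta>1 where \<delta>1: "\<delta>1 > 0" "\<And>L l m. hat_orth S L \<Longrightarrow> l \<in> L \<Longrightarrow> m \<in> L \<Longrightarrow> l \<noteq> m \<Longrightarrow> \<bar>l - m\<bar> \<ge> \<delta>1"
    by (rule hat_orth_separated[OF S]) blast
  \<comment> \<open>One number below both the smallest frequency and all gaps, so that every bin has
    index at least 1 and holds at most one frequency.\<close>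
  define \<delta> where "\<delta> = min \<delta>0 \<delta>1"
  have \<delta>: "\<delta> > 0" "\<delta> \<le> \<delta>0" "\<delta> \<le> \<delta>1" using \<delta>0 \<delta>1 by (auto simp: \<delta>_def)
  \<comment> \<open>The height at which Cauchy-Schwarz, with the coefficient bound \<open>A\<close>
    and a geometric series with ratio \<open>q\<close>, makes the exponential sum at most 1/2; this
    requires \<open>q\<close> at most \<open>1 / (8 * A)\<close>.\<close>
  define Y where "Y = max 1 (ln (8 * A) / (4 * pi * \<delta>))"
  have Y: "Y \<ge> 1" by (simp add: Y_def)
  define q where "q = exp (- (4 * pi * \<delta> * Y))"
  have "ln (8 * A) \<le> 4 * pi * \<delta> * Y"
  proof -
    have "ln (8 * A) / (4 * pi * \<delta>) \<le> Y" by (simp add: Y_def)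
    then show ?thesis using \<delta> by (simp add: field_simps)
  qed
  then have "q \<le> exp (- ln (8 * A))" by (simp add: q_def)
  also have "\<dots> = inverse (8 * A)" using A by (subst exp_minus, subst exp_ln) auto
  also have "\<dots> = 1 / (8 * A)" by (rule inverse_eq_divide)
  finally have q_le: "q \<le> 1 / (8 * A)" .
  also have "\<dots> \<le> 1 / 2" using A by (simp add: field_simps)
  finally have q_half: "q \<le> 1 / 2" .
  have q0: "0 < q" unfolding q_def by (rule exp_gt_zero)
  note q = q0 q_half
  \<comment> \<open>The harmonic measure of \<open>S\<close> seen from height \<open>Y\<close>. Its
    positivity gives small values on \<open>S\<close> a definite weight in Jensen's
    inequality.\<close>
  define \<kappa> where "\<kappa> = (LINT t|lebesgue. (if t \<in> S then poisson Y t else 0))"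
  have kS: "integrable lebesgue (\<lambda>t. if t \<in> S then poisson Y t else 0)"
  proof -
    have "(\<lambda>t. if t \<in> S then poisson Y t else 0) = (\<lambda>t. indicator S t *\<^sub>R poisson Y t)"
      by (auto simp: indicator_def)
    then show ?thesis using integrable_mult_indicator[OF S(1) poisson_integrable[of Y]] Y by simp
  qed
  have \<kappa>: "\<kappa> > 0"
  proof -
    define b where "b = (Y / pi) / (Y\<^sup>2 + B\<^sup>2)"
    have b: "b > 0" using Y by (simp add: b_def add_pos_nonneg)
    have "(LINT t|lebesgue. (if t \<in> S then b else 0)) \<le> \<kappa>"
      unfolding \<kappa>_def
    proof (rule integral_mono[OF _ kS])
      show "integrable lebesgue (\<lambda>t. if t \<in> S then b else 0)"
        using m by (subst Lebesgue_Measure.integrable_restrict_UNIV)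
          (auto simp: finite_measure.integrable_const finite_measure_lebesgue_on)
      fix t
      show "(if t \<in> S then b else 0) \<le> (if t \<in> S then poisson Y t else 0)"
      proof (cases "t \<in> S")
        case True
        then have "t\<^sup>2 \<le> B\<^sup>2" using B(2) by (intro abs_le_square_iff[THEN iffD1]) force
        then show ?thesis using True Y unfolding poisson_def b_def
          by (auto intro!: divide_left_mono mult_pos_pos add_pos_nonneg)
      qed simp
    qed
    also have "(LINT t|lebesgue. (if t \<in> S then b else 0)) = (LINT t|?M. b)"
      by (rule Lebesgue_Measure.integral_restrict_UNIV[OF S(1)])
    also have "\<dots> = V * b" using m by (simp add: V_def measure_lebesgue_on_self)
    finally show ?thesis using mult_pos_pos[OF V b] by linarith
  qed
  \<comment> \<open>Chosen so that \<open>\<kappa> * ln s\<close> outweighs all other terms of the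
    majorant below: its integral is then at most -2, below the logarithm of 1/2.\<close>
  define s where "s = exp (- ((6 + 2 * Y * D * A) / \<kappa>))"
  have "0 \<le> 6 + 2 * Y * D * A" using Y D A by (intro add_nonneg_nonneg mult_nonneg_nonneg) auto
  then have s: "0 < s" "s \<le> 1" using \<kappa> by (simp_all add: s_def)
  have ln_s: "\<kappa> * ln s = - (6 + 2 * Y * D * A)" using \<kappa> by (simp add: s_def)
  have "s\<^sup>2 \<le> (LINT x|?M. (cmod (1 - (\<Sum>l\<in>F. c l * exp_char l x)))\<^sup>2)"
    if F: "finite F" "F \<subseteq> {\<delta>0..}" "hat_orth S F" for F and c :: "real \<Rightarrow> complex"
  proof (rule ccontr)
    assume neg: "\<not> ?thesis"
    define P where "P x = (\<Sum>l\<in>F. c l * exp_char l x)" for x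
    have small: "(LINT x|?M. (cmod (1 - P x))\<^sup>2) < s\<^sup>2" using neg by (simp add: P_def)
    interpret orthogonal_family ?M F exp_char V
      unfolding V_def by (rule orthogonal_family_exp_char[OF m F(1,3)])
    have sP: "sqint ?M P" unfolding P_def by (rule sqint_comb)
    have s1: "sqint ?M (\<lambda>x. 1)" by (rule sqint_bounded[OF finite_measure_lebesgue_on[OF m], where B=1]) simp_all
    define N where "N = (\<Sum>l\<in>F. (cmod (c l))\<^sup>2)"
    have N: "N \<ge> 0" by (simp add: N_def sum_nonneg)
    have "V * N = (LINT x|?M. (cmod (0 - P x))\<^sup>2)"
      unfolding N_def integral_comb_squared[symmetric] P_def by simp
    also have "\<dots> \<le> 2 * (LINT x|?M. (cmod (0 - 1))\<^sup>2) + 2 * (LINT x|?M. (cmod (1 - P x))\<^sup>2)"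
      by (rule integral_norm_diff_squared_triangle[OF sqint_zero s1 sP])
    also have "(LINT x|?M. (cmod (0 - 1))\<^sup>2) = V" using m by (simp add: V_def measure_lebesgue_on_self)
    also have "2 * (LINT x|?M. (cmod (1 - P x))\<^sup>2) \<le> 2 * 1"
      using small s by (intro mult_left_mono) (auto intro: order_trans[OF less_imp_le] simp: power_le_one)
    finally have "N \<le> A" using V by (simp add: A_def field_simps)
    \<comment> \<open>The complex extension of the exponentials; positive frequencies keep them
      bounded in the upper half plane.\<close>
    define E where "E l z = exp (2 * of_real pi * \<i> * of_real l * z)" for l :: real and z
    define Q where "Q z = 1 - (\<Sum>l\<in>F. c l * E l z)" for z
    have Q_real: "Q (of_real t) = 1 - P t" for t by (simp add: Q_def P_def E_def exp_char_def)
    have E_norm: "cmod (E l z) = exp (- (2 * pi * l * Im z))" for l z by (simp add: E_def norm_exp_eq_Re)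
    have F_pos: "l \<ge> \<delta>" "l > 0" if "l \<in> F" for l using that F(2) \<delta> by force+
    have Q_hol: "Q holomorphic_on UNIV" unfolding Q_def E_def by (intro holomorphic_intros)
    have Q_bd: "cmod (Q z) \<le> 1 + (\<Sum>l\<in>F. cmod (c l))" if "Im z \<ge> 0" for z
    proof -
      have "cmod (\<Sum>l\<in>F. c l * E l z) \<le> (\<Sum>l\<in>F. cmod (c l))"
      proof (rule sum_norm_le)
        fix l assume "l \<in> F"
        then have "cmod (E l z) \<le> 1" using F_pos that unfolding E_norm by (simp add: less_imp_le)
        then show "norm (c l * E l z) \<le> cmod (c l)" by (simp add: norm_mult mult_left_le)
      qed
      then show ?thesis unfolding Q_def using norm_triangle_ineq4[of 1 "\<Sum>l\<in>F. c l * E l z"] by simp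
    qed
    have sumE: "(\<Sum>l\<in>F. exp (- (4 * pi * l * Y))) \<le> 2 * q"
    proof -
      have "(\<Sum>l\<in>F. exp (- (4 * pi * l * Y))) \<le> (\<Sum>j\<in>(\<lambda>l. nat \<lfloor>l / \<delta>\<rfloor>) ` F. q ^ j)"
      proof (rule sum_separated_le[OF _ \<delta>(1)])
        show "l \<ge> 0" if "l \<in> F" for l using F_pos[OF that] by simp
        show "\<bar>l - m\<bar> \<ge> \<delta>" if "l \<in> F" "m \<in> F" "l \<noteq> m" for l m
          using \<delta>1(2)[OF F(3) that] \<delta> by simp
        fix l assume "l \<in> F"
        define j where "j = nat \<lfloor>l / \<delta>\<rfloor>"
        have "real j \<le> l / \<delta>" using F_pos[OF \<open>l \<in> F\<close>] \<delta> by (simp add: j_def of_nat_nat)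
        then have "real j * (4 * pi * \<delta> * Y) \<le> (l / \<delta>) * (4 * pi * \<delta> * Y)" using \<delta> Y by (intro mult_right_mono) auto
        also have "\<dots> = 4 * pi * l * Y" using \<delta> by simp
        finally have "exp (- (4 * pi * l * Y)) \<le> exp (real j * - (4 * pi * \<delta> * Y))" by simp
        then show "exp (- (4 * pi * l * Y)) \<le> q ^ nat \<lfloor>l / \<delta>\<rfloor>"
          by (simp only: q_def j_def[symmetric] exp_of_nat_mult)
      qed
      also have "\<dots> \<le> (\<Sum>j. q ^ Suc j)"
      proof -
        have "(\<lambda>l. nat \<lfloor>l / \<delta>\<rfloor>) ` F \<subseteq> Suc ` UNIV"
        proof
          fix j assume "j \<in> (\<lambda>l. nat \<lfloor>l / \<delta>\<rfloor>) ` F"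
          then obtain l where l: "l \<in> F" "j = nat \<lfloor>l / \<delta>\<rfloor>" by auto
          have "1 \<le> l / \<delta>" using F_pos[OF l(1)] \<delta> by simp
          then have "1 \<le> \<lfloor>l / \<delta>\<rfloor>" by (simp add: le_floor_iff)
          then have "j \<noteq> 0" using l by simp
          then show "j \<in> Suc ` UNIV" by (metis not0_implies_Suc rangeI)
        qed
        then obtain J where J: "(\<lambda>l. nat \<lfloor>l / \<delta>\<rfloor>) ` F = Suc ` J" by (meson subset_imageE)
        have "finite J" using F(1) by (metis J finite_imageI finite_imageD inj_Suc inj_on_subset subset_UNIV)
        have "(\<Sum>j\<in>(\<lambda>l. nat \<lfloor>l / \<delta>\<rfloor>) ` F. q ^ j) = (\<Sum>j\<in>J. q ^ Suc j)"
          unfolding J by (simp add: sum.reindex)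
        also have "\<dots> \<le> (\<Sum>j. q ^ Suc j)"
          using q \<open>finite J\<close> by (intro sum_le_suminf) (auto intro!: summable_mult summable_geometric)
        finally show ?thesis .
      qed
      also have "\<dots> = q * (1 / (1 - q))"
        using q by (simp add: suminf_mult suminf_geometric)
      also have "\<dots> \<le> q * 2" using q by (intro mult_left_mono) (auto simp: field_simps)
      finally show ?thesis by simp
    qed
    have "cmod (\<Sum>l\<in>F. c l * E l (\<i> * of_real Y)) \<le> 1 / 2"
    proof -
      have E2: "(exp (- (2 * pi * l * Y)))\<^sup>2 = exp (- (4 * pi * l * Y))" for l
        using exp_double[of "- (2 * pi * l * Y)"] by (simp add: mult_ac)
      have "cmod (\<Sum>l\<in>F. c l * E l (\<i> * of_real Y)) \<le> (\<Sum>l\<in>F. \<bar>cmod (c l)\<bar> * \<bar>exp (- (2 * pi * l * Y))\<bar>)"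
        by (rule order_trans[OF norm_sum]) (simp add: norm_mult E_norm)
      also have "\<dots> \<le> L2_set (\<lambda>l. cmod (c l)) F * L2_set (\<lambda>l. exp (- (2 * pi * l * Y))) F"
        by (rule L2_set_mult_ineq)
      also have "\<dots> = sqrt (N * (\<Sum>l\<in>F. exp (- (4 * pi * l * Y))))"
        by (simp add: L2_set_def N_def real_sqrt_mult E2)
      also have "\<dots> \<le> sqrt (A * (2 * q))"
        using \<open>N \<le> A\<close> sumE A by (intro real_sqrt_le_mono mult_mono) (auto simp: sum_nonneg)
      also have "\<dots> \<le> sqrt (1 / 4)"
      proof (rule real_sqrt_le_mono)
        have "A * (2 * q) \<le> A * (2 * (1 / (8 * A)))" using q_le A by (intro mult_left_mono) auto
        then show "A * (2 * q) \<le> 1 / 4" using A by simp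
      qed
      also have "sqrt (1 / 4) = 1 / (2 :: real)" by (simp add: real_sqrt_divide)
      finally show ?thesis .
    qed
    then have Q_iY: "cmod (Q (\<i> * of_real Y)) \<ge> 1 / 2"
      unfolding Q_def using norm_triangle_ineq2[of 1 "\<Sum>l\<in>F. c l * E l (\<i> * of_real Y)"] by simp
    have Y0: "Y > 0" using Y by simp
    have Q0: "Q (\<i> * of_real Y) \<noteq> 0" using Q_iY by auto
    note J = jensen_half_plane[OF Q_hol Q_bd Y0 s(1) Q0, unfolded Q_real]
    have kle: "poisson Y t \<le> Y * poisson 1 t" for t
    proof -
      have "1 + t\<^sup>2 \<le> Y\<^sup>2 + t\<^sup>2" using Y by (simp add: one_le_power)
      then show ?thesis using Y unfolding poisson_def
        by (auto intro!: divide_left_mono mult_pos_pos add_pos_nonneg)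
    qed
    have k1: "poisson Y t \<le> 1" for t
    proof -
      have "poisson Y t \<le> (Y / pi) / Y\<^sup>2"
        using Y unfolding poisson_def by (auto intro!: divide_left_mono mult_pos_pos add_pos_nonneg)
      also have "\<dots> = 1 / (pi * Y)" using Y by (simp add: power2_eq_square)
      also have "\<dots> \<le> 1" using Y pi_gt3 mult_mono[of 1 pi 1 Y] by simp
      finally show ?thesis .
    qed
    have k0: "poisson Y t \<ge> 0" for t using poisson_pos[OF Y0, of t] by simp
    have wP: "integrable lebesgue (\<lambda>t. poisson 1 t * (cmod (P t))\<^sup>2)"
      "(LINT t|lebesgue. poisson 1 t * (cmod (P t))\<^sup>2) \<le> D * N"
      unfolding P_def D_def N_def by (rule poisson_norm_le[OF S(1) B(2) S(3) F(1,3)])+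
    have iS: "integrable lebesgue (\<lambda>t. if t \<in> S then (cmod (1 - P t))\<^sup>2 else 0)"
      using sqint_diff[OF s1 sP] S(1) by (subst Lebesgue_Measure.integrable_restrict_UNIV) (auto simp: sqint_def)
    \<comment> \<open>A majorant of the Jensen integrand. On \<open>S\<close> it uses
      \<open>ln (u + s) \<le> u / s + ln s\<close>, which retains the large negative term; elsewhere
      \<open>ln (u + s) \<le> u\<close>, with \<open>u\<close> bounded by
      \<open>3 + 2 * (cmod (P t))\<^sup>2\<close>.\<close>
    define b where "b t = 3 * poisson Y t + 2 * Y * (poisson 1 t * (cmod (P t))\<^sup>2)
        + (1 / s\<^sup>2) * (if t \<in> S then (cmod (1 - P t))\<^sup>2 else 0) + ln s * (if t \<in> S then poisson Y t else 0)" for t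
    have b_int: "integrable lebesgue b"
      unfolding b_def using poisson_integrable[OF Y0] wP(1) iS kS
      by (intro Bochner_Integration.integrable_add integrable_mult_right)
    have b_LINT: "(LINT t|lebesgue. b t) \<le> 3 + 2 * Y * (D * A) + 1 + ln s * \<kappa>"
    proof -
      have "(LINT t|lebesgue. b t) = 3 * (LINT t|lebesgue. poisson Y t) + 2 * Y * (LINT t|lebesgue. poisson 1 t * (cmod (P t))\<^sup>2)
        + (1 / s\<^sup>2) * (LINT t|lebesgue. (if t \<in> S then (cmod (1 - P t))\<^sup>2 else 0)) + ln s * \<kappa>"
        unfolding b_def \<kappa>_def using poisson_integrable[OF Y0] wP(1) iS kS
        by (simp add: Bochner_Integration.integral_add)
      also have "(LINT t|lebesgue. (if t \<in> S then (cmod (1 - P t))\<^sup>2 else 0)) = (LINT t|?M. (cmod (1 - P t))\<^sup>2)"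
        by (rule Lebesgue_Measure.integral_restrict_UNIV[OF S(1)])
      also have "(1 / s\<^sup>2) * \<dots> \<le> (1 / s\<^sup>2) * s\<^sup>2" using small by (intro mult_left_mono) auto
      also have "(1 / s\<^sup>2) * s\<^sup>2 = 1" using s by simp
      also have "2 * Y * (LINT t|lebesgue. poisson 1 t * (cmod (P t))\<^sup>2) \<le> 2 * Y * (D * A)"
      proof (rule mult_left_mono)
        have "D * N \<le> D * A" using D \<open>N \<le> A\<close> by simp
        then show "(LINT t|lebesgue. poisson 1 t * (cmod (P t))\<^sup>2) \<le> D * A" using wP(2) by linarith
      qed (use Y in simp)
      also have "(LINT t|lebesgue. poisson Y t) = 1" by (rule poisson_integral[OF Y0])
      finally show ?thesis by simp
    qed
    have "poisson Y t * ln (cmod (1 - P t) + s) \<le> b t" for t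
    proof -
      define u where "u = cmod (1 - P t)"
      have u: "u \<ge> 0" by (simp add: u_def)
      have P2: "poisson Y t * (2 * (cmod (P t))\<^sup>2) \<le> 2 * Y * (poisson 1 t * (cmod (P t))\<^sup>2)"
        using mult_right_mono[OF kle[of t], of "2 * (cmod (P t))\<^sup>2"] by (simp add: mult_ac)
      show ?thesis
      proof (cases "t \<in> S")
        case True
        have "ln ((u + s) / s) \<le> (u + s) / s - 1" using s u by (intro ln_le_minus_one divide_pos_pos) auto
        moreover have "ln ((u + s) / s) = ln (u + s) - ln s" 
          by (rule ln_divide_pos) (use s u in linarith)+
        moreover have "(u + s) / s - 1 = u / s" using s by (simp add: field_simps)
        ultimately have "ln (u + s) \<le> u / s + ln s" by linarith
        also have "u / s \<le> 1 + u\<^sup>2 / s\<^sup>2"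
          using le_one_plus_square[of "u / s"] u s by (simp add: power_divide)
        finally have "poisson Y t * ln (u + s) \<le> poisson Y t * (1 + u\<^sup>2 / s\<^sup>2 + ln s)"
          using k0 by (intro mult_left_mono) auto
        also have "\<dots> = poisson Y t + poisson Y t * (u\<^sup>2 / s\<^sup>2) + ln s * poisson Y t" by (simp add: algebra_simps)
        also have "poisson Y t * (u\<^sup>2 / s\<^sup>2) \<le> 1 * (u\<^sup>2 / s\<^sup>2)" using k1 by (intro mult_right_mono) auto
        finally have "poisson Y t * ln (u + s) \<le> poisson Y t + u\<^sup>2 / s\<^sup>2 + ln s * poisson Y t" by simp
        moreover have "0 \<le> 2 * Y * (poisson 1 t * (cmod (P t))\<^sup>2)"
          using Y poisson_pos[of 1 t] by (intro mult_nonneg_nonneg) auto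
        ultimately show ?thesis using True k0[of t] by (simp add: b_def u_def)
      next
        case False
        have "ln (u + s) \<le> u + s - 1" using s u by (intro ln_le_minus_one) auto
        also have "\<dots> \<le> u" using s by simp
        also have "u \<le> 1 + u\<^sup>2" by (rule le_one_plus_square[OF u])
        also have "u\<^sup>2 \<le> 2 + 2 * (cmod (P t))\<^sup>2" using norm_add_squared_le[of 1 "- P t"] by (simp add: u_def)
        finally have "poisson Y t * ln (u + s) \<le> poisson Y t * (3 + 2 * (cmod (P t))\<^sup>2)"
          using k0 by (intro mult_left_mono) auto
        also have "\<dots> = 3 * poisson Y t + poisson Y t * (2 * (cmod (P t))\<^sup>2)" by (simp add: algebra_simps)
        finally show ?thesis using False P2 by (simp add: b_def u_def)
      qed
    qed
    then have "(LINT t|lebesgue. poisson Y t * ln (cmod (1 - P t) + s)) \<le> (LINT t|lebesgue. b t)"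
      by (intro integral_mono[OF J(1) b_int])
    then have "ln (cmod (Q (\<i> * of_real Y))) \<le> - 2" using J(2) b_LINT ln_s by (simp add: mult_ac)
    moreover have "ln (1 / 2) \<le> ln (cmod (Q (\<i> * of_real Y)))" using Q_iY Q0 by (subst ln_le_cancel_iff) auto
    moreover have "ln (1 / 2 :: real) \<ge> - 1"
      using ln_2_less_1 by (simp add: ln_div)
    ultimately show False by linarith
  qed
  then show ?thesis using that[of "s\<^sup>2"] s by simp
qed

section \<open>Periodicity of spectra\<close>

lemma hat_orth_reflect:
  assumes "hat_orth S L"
  shows "hat_orth S ((\<lambda>l. a - l) ` L)"
  unfolding hat_orth_def
proof (intro ballI impI)
  fix x y assume "x \<in> (\<lambda>l. a - l) ` L" "y \<in> (\<lambda>l. a - l) ` L" "x \<noteq> y"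
  then obtain l m where "l \<in> L" "m \<in> L" "x = a - l" "y = a - m" "m \<noteq> l" by auto
  then show "hat S (x - y) = 0" using assms by (auto simp: hat_orth_def)
qed

lemma hat_orth_shift:
  assumes "hat_orth S L"
  shows "hat_orth S ((\<lambda>l. l - a) ` L)"
  using assms by (auto simp: hat_orth_def)

lemma spectrum_locally_finite:
  assumes S: "bounded S" and L: "is_spectrum S L"
  shows "finite (L \<inter> {a..b})"
proof (cases "L \<inter> {a..b} = {}")
  case False
  have m: "S \<in> sets lebesgue" "measure lebesgue S > 0" "hat_orth S L" using L by (auto simp: is_spectrum_iff)
  obtain l0 where "l0 \<in> L \<inter> {a..b}" using False by blast
  then have l0: "l0 \<in> L" "l0 \<in> {a..b}" by simp_all
  have "L \<inter> {a..b} \<subseteq> (\<lambda>z. l0 + z) ` insert 0 {l \<in> {- (b - a)..b - a}. hat S l = 0}"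
  proof
    fix l assume l: "l \<in> L \<inter> {a..b}"
    have "l - l0 \<in> insert 0 {l \<in> {- (b - a)..b - a}. hat S l = 0}"
      using l l0 m(3) by (auto simp: hat_orth_def)
    then show "l \<in> (\<lambda>z. l0 + z) ` insert 0 {l \<in> {- (b - a)..b - a}. hat S l = 0}"
      by (intro image_eqI[of _ _ "l - l0"]) auto
  qed
  then show ?thesis
    by (rule finite_subset) (rule finite_imageI, simp only: finite_insert, rule finite_zeros_hat[OF m(1) S m(2)])
qed simp

text \<open>In the middle of a long gap a further exponential would be almost orthogonal to the
  whole spectrum, by the uniform tail bound, against Parseval.\<close>

lemma spectrum_relatively_dense:
  assumes S: "bounded S" and L: "is_spectrum S L"
  obtains R where "R > 0" "\<And>x. \<exists>l\<in>L. x < l \<and> l < x + R"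
proof -
  define V where "V = measure lebesgue S"
  have m: "S \<in> sets lebesgue" "V > 0" "hat_orth S L" "S \<in> lmeasurable"
    using L by (auto simp: is_spectrum_iff V_def)
  have "V * V / 2 > 0" using m by simp
  then obtain R where R: "R > 0" "\<And>F. finite F \<Longrightarrow> hat_orth S F \<Longrightarrow> (\<And>l. l \<in> F \<Longrightarrow> \<bar>l\<bar> \<ge> R) \<Longrightarrow>
    (\<Sum>l\<in>F. (cmod (hat S l))\<^sup>2) < V * V / 2"
    using uniform_tail[OF m(1) S, of "V * V / 2"] m(2) unfolding V_def by metis
  have "\<exists>l\<in>L. x < l \<and> l < x + 2 * R" for x
  proof (rule ccontr)
    assume no: "\<not> ?thesis"
    define x0 where "x0 = x + R"
    have far: "\<bar>x0 - l\<bar> \<ge> R" if "l \<in> L" for l using no that by (force simp: x0_def)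
    have V2: "V / 2 > 0" using m by simp
    obtain F where F: "finite F" "F \<subseteq> L" "(LINT y|lebesgue_on S. (cmod (exp_char x0 y))\<^sup>2) - V / 2 <
        (\<Sum>l\<in>F. (cmod (ip (lebesgue_on S) (exp_char x0) (exp_char l)))\<^sup>2) / measure lebesgue S"
      by (rule spectrum_parseval[OF L sqint_exp_char[OF m(4), of x0] V2])
    have "(\<Sum>l\<in>F. (cmod (hat S (x0 - l)))\<^sup>2) = (\<Sum>l\<in>(\<lambda>l. x0 - l) ` F. (cmod (hat S l))\<^sup>2)"
      by (subst sum.reindex) (auto simp: inj_on_def)
    also have "\<dots> < V * V / 2"
      using F far by (intro R(2) hat_orth_reflect hat_orth_subset[OF m(3)]) auto
    finally have "(\<Sum>l\<in>F. (cmod (hat S (x0 - l)))\<^sup>2) / V < (V * V / 2) / V"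
      using m(2) by (intro divide_strict_right_mono)
    moreover have "(V * V / 2) / V = V / 2" using m(2) by simp
    ultimately show False
      using F(3)[unfolded integral_exp_char_squared[OF m(4)] ip_exp_char V_def[symmetric]] by linarith
  qed
  then show ?thesis using that[of "2 * R"] R by simp
qed

text \<open>
  If two elements have the same predecessors in a long window but different successors, then the
  exponential of the smaller successor is nearly a sum of exponentials with strictly larger
  frequencies, which boundary uniqueness excludes.
\<close>

lemma spectrum_next_determined:
  assumes S: "bounded S" and L: "is_spectrum S L"
  obtains n where "n > 0" "\<And>l l' d d'. l \<in> L \<Longrightarrow> l' \<in> L \<Longrightarrow> l + d \<in> L \<Longrightarrow> l' + d' \<in> L \<Longrightarrow> 0 < d \<Longrightarrow> d < d' \<Longrightarrow>
    (\<And>t. 0 < t \<Longrightarrow> t < d' \<Longrightarrow> l' + t \<notin> L) \<Longrightarrow> (\<And>t. - n \<le> t \<Longrightarrow> t \<le> 0 \<Longrightarrow> l' + t \<in> L \<Longrightarrow> l + t \<in> L) \<Longrightarrow> False"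
proof -
  let ?M = "lebesgue_on S"
  define V where "V = measure lebesgue S"
  have m: "S \<in> sets lebesgue" "V > 0" "hat_orth S L" "S \<in> lmeasurable" "measure lebesgue S > 0"
    using L by (auto simp: is_spectrum_iff V_def)
  obtain R where R: "R > 0" "\<And>x. \<exists>l\<in>L. x < l \<and> l < x + R"
    by (rule spectrum_relatively_dense[OF S L]) blast
  \<comment> \<open>Both successor distances are zeros of \<open>hat S\<close> below
    \<open>R\<close>, so if they differ, they differ by at least this fixed amount; it is the
    frequency gap fed to boundary uniqueness.\<close>
  obtain \<delta> where \<delta>: "\<delta> > 0" "\<And>x y. x \<in> {l \<in> {- R..R}. hat S l = 0} \<Longrightarrow> y \<in> {l \<in> {- R..R}. hat S l = 0} \<Longrightarrow> x \<noteq> y \<Longrightarrow> \<bar>x - y\<bar> \<ge> \<delta>"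
    by (rule finite_set_separated[OF finite_zeros_hat[OF m(1) S m(5), of R]]) blast
  obtain \<epsilon> where \<epsilon>: "\<epsilon> > 0" "\<And>F c. finite F \<Longrightarrow> F \<subseteq> {\<delta>..} \<Longrightarrow> hat_orth S F \<Longrightarrow>
    \<epsilon> \<le> (LINT x|?M. (cmod (1 - (\<Sum>l\<in>F. c l * exp_char l x)))\<^sup>2)"
    by (rule one_not_approximable[OF m(1) S m(5) \<delta>(1)]) blast
  \<comment> \<open>The tail bound is later divided by \<open>V\<close>, giving squared norm below
    \<open>\<epsilon> / 4\<close> for the remote part; together with the approximation error
    \<open>\<epsilon> / 4\<close> the triangle inequality yields \<open>\<epsilon>\<close>.\<close>
  have "V * \<epsilon> / 4 > 0" using m \<epsilon> by simp
  then obtain n where n: "n > 0" "\<And>F. finite F \<Longrightarrow> hat_orth S F \<Longrightarrow> (\<And>l. l \<in> F \<Longrightarrow> \<bar>l\<bar> \<ge> n) \<Longrightarrow>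
    (\<Sum>l\<in>F. (cmod (hat S l))\<^sup>2) < V * \<epsilon> / 4"
    by (rule uniform_tail[OF m(1) S m(5)]) blast
  show ?thesis
  proof (rule that[OF n(1)])
    fix l l' d d'
    assume l: "l \<in> L" "l' \<in> L" "l + d \<in> L" "l' + d' \<in> L" and d: "0 < d" "d < d'"
      and gap: "\<And>t. 0 < t \<Longrightarrow> t < d' \<Longrightarrow> l' + t \<notin> L"
      and win: "\<And>t. - n \<le> t \<Longrightarrow> t \<le> 0 \<Longrightarrow> l' + t \<in> L \<Longrightarrow> l + t \<in> L"
    have "d' < R"
    proof -
      obtain y where y: "y \<in> L" "l' < y" "y < l' + R" using R(2) by blast
      then have "\<not> y - l' < d'" using gap[of "y - l'"] by auto
      then show ?thesis using y by simp
    qed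
    moreover have "hat S d = 0" "hat S d' = 0"
      using m(3)[unfolded hat_orth_def, rule_format, OF l(3,1)] m(3)[unfolded hat_orth_def, rule_format, OF l(4,2)] d by auto
    ultimately have dd: "d' - d \<ge> \<delta>" using \<delta>(2)[of d' d] d by auto
    \<comment> \<open>The smaller successor transplanted from \<open>l\<close> to \<open>l'\<close>;
      it lies inside the gap after \<open>l'\<close>.\<close>
    define x0 where "x0 = l' + d"
    have e4: "\<epsilon> / 4 > 0" using \<epsilon> by simp
    obtain F where F: "finite F" "F \<subseteq> L" and
      app: "(LINT x|?M. (cmod (exp_char x0 x - (\<Sum>l\<in>F. (ip ?M (exp_char x0) (exp_char l) / measure lebesgue S) * exp_char l x)))\<^sup>2) < \<epsilon> / 4"
      by (rule spectrum_parseval[OF L sqint_exp_char[OF m(4), of x0] e4])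
    define c where "c \<mu> = hat S (x0 - \<mu>) / V" for \<mu>
    define F0 where "F0 = {\<mu>\<in>F. \<mu> < l' - n}"
    define F1 where "F1 = {\<mu>\<in>F. \<mu> \<ge> l' + d'}"
    have fin: "finite F0" "finite F1" "F0 \<subseteq> L" "F1 \<subseteq> L" "F0 \<inter> F1 = {}"
      using F d n(1) by (auto simp: F0_def F1_def)
    \<comment> \<open>Frequencies in the window before \<open>l'\<close> recur before
      \<open>l\<close>, where they are orthogonal to the genuine element \<open>l + d\<close>; so
      their coefficients vanish exactly.\<close>
    have c0: "c \<mu> = 0" if "\<mu> \<in> F - (F0 \<union> F1)" for \<mu>
    proof -
      have \<mu>: "\<mu> \<in> L" "- n \<le> \<mu> - l'" "\<mu> < l' + d'" using that F by (auto simp: F0_def F1_def)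
      have "\<mu> - l' \<le> 0" using gap[of "\<mu> - l'"] \<mu> by force
      then have "l + (\<mu> - l') \<in> L" using win[of "\<mu> - l'"] \<mu> by simp
      then have "hat S ((l + d) - (l + (\<mu> - l'))) = 0"
        using m(3) l d \<open>\<mu> - l' \<le> 0\<close> by (intro m(3)[unfolded hat_orth_def, rule_format]) auto
      then show ?thesis by (simp add: c_def x0_def algebra_simps)
    qed
    have split: "(\<Sum>\<mu>\<in>F. c \<mu> * exp_char \<mu> x) = (\<Sum>\<mu>\<in>F0. c \<mu> * exp_char \<mu> x) + (\<Sum>\<mu>\<in>F1. c \<mu> * exp_char \<mu> x)" for x
    proof -
      have "(\<Sum>\<mu>\<in>F. c \<mu> * exp_char \<mu> x) = (\<Sum>\<mu>\<in>F0 \<union> F1. c \<mu> * exp_char \<mu> x)"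
        using F c0 by (intro sum.mono_neutral_right) (auto simp: F0_def F1_def)
      then show ?thesis using fin by (simp add: sum.union_disjoint)
    qed
    define P0 where "P0 x = (\<Sum>\<mu>\<in>F0. c \<mu> * exp_char \<mu> x)" for x
    define P1 where "P1 x = (\<Sum>\<mu>\<in>F1. c \<mu> * exp_char \<mu> x)" for x
    have sq: "sqint ?M P0" "sqint ?M P1" "sqint ?M (exp_char x0)"
      unfolding P0_def P1_def by (auto intro!: sqint_sum sqint_cmult sqint_exp_char[OF m(4)])
    have app': "(LINT x|?M. (cmod (exp_char x0 x - (P0 x + P1 x)))\<^sup>2) < \<epsilon> / 4"
      using app unfolding ip_exp_char V_def[symmetric] c_def[symmetric] split P0_def P1_def .
    have P0: "(LINT x|?M. (cmod (P0 x))\<^sup>2) < \<epsilon> / 4"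
    proof -
      interpret orthogonal_family ?M F0 exp_char V
        unfolding V_def by (rule orthogonal_family_exp_char[OF m(4) fin(1) hat_orth_subset[OF m(3) fin(3)]])
      have "(\<Sum>\<mu>\<in>F0. (cmod (hat S (x0 - \<mu>)))\<^sup>2) = (\<Sum>\<mu>\<in>(\<lambda>\<mu>. x0 - \<mu>) ` F0. (cmod (hat S \<mu>))\<^sup>2)"
        by (subst sum.reindex) (auto simp: inj_on_def)
      also have "\<dots> < V * \<epsilon> / 4"
      proof (rule n(2))
        show "hat_orth S ((\<lambda>\<mu>. x0 - \<mu>) ` F0)" by (rule hat_orth_reflect[OF hat_orth_subset[OF m(3) fin(3)]])
        show "n \<le> \<bar>\<mu>\<bar>" if "\<mu> \<in> (\<lambda>\<mu>. x0 - \<mu>) ` F0" for \<mu> using that d by (auto simp: F0_def x0_def)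
      qed (use fin in auto)
      finally have le: "(\<Sum>\<mu>\<in>F0. (cmod (hat S (x0 - \<mu>)))\<^sup>2) < V * \<epsilon> / 4" .
      have "(LINT x|?M. (cmod (P0 x))\<^sup>2) = V * (\<Sum>\<mu>\<in>F0. (cmod (c \<mu>))\<^sup>2)"
        unfolding P0_def by (rule integral_comb_squared)
      also have "\<dots> = (\<Sum>\<mu>\<in>F0. (cmod (hat S (x0 - \<mu>)))\<^sup>2) / V"
        using m(2) by (simp add: c_def norm_divide power_divide sum_divide_distrib[symmetric] power2_eq_square)
      also have "\<dots> < (V * \<epsilon> / 4) / V" using le m(2) by (intro divide_strict_right_mono)
      finally show ?thesis using m(2) by simp
    qed
    have "(LINT x|?M. (cmod (exp_char x0 x - P1 x))\<^sup>2) \<le> 2 * (LINT x|?M. (cmod (exp_char x0 x - (P0 x + P1 x)))\<^sup>2)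
        + 2 * (LINT x|?M. (cmod ((P0 x + P1 x) - P1 x))\<^sup>2)"
      by (rule integral_norm_diff_squared_triangle[OF sq(3) sqint_add[OF sq(1,2)] sq(2)])
    then have "(LINT x|?M. (cmod (exp_char x0 x - P1 x))\<^sup>2) < \<epsilon>" using app' P0 by simp
    moreover have "cmod (exp_char x0 x - P1 x) = cmod (1 - (\<Sum>\<nu>\<in>(\<lambda>\<mu>. \<mu> - x0) ` F1. c (\<nu> + x0) * exp_char \<nu> x))" for x
    proof -
      have "(\<Sum>\<nu>\<in>(\<lambda>\<mu>. \<mu> - x0) ` F1. c (\<nu> + x0) * exp_char \<nu> x) = (\<Sum>\<mu>\<in>F1. c \<mu> * exp_char (\<mu> - x0) x)"
        by (subst sum.reindex) (auto simp: inj_on_def)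
      also have "\<dots> = P1 x * exp_char (- x0) x"
        unfolding P1_def sum_distrib_right by (simp add: exp_char_diff cnj_exp_char mult.assoc)
      finally have "1 - (\<Sum>\<nu>\<in>(\<lambda>\<mu>. \<mu> - x0) ` F1. c (\<nu> + x0) * exp_char \<nu> x) = (exp_char x0 x - P1 x) * exp_char (- x0) x"
        by (simp add: left_diff_distrib flip: exp_char_add)
      then show ?thesis by (simp add: norm_mult)
    qed
    moreover have "\<epsilon> \<le> (LINT x|?M. (cmod (1 - (\<Sum>\<nu>\<in>(\<lambda>\<mu>. \<mu> - x0) ` F1. c (\<nu> + x0) * exp_char \<nu> x)))\<^sup>2)"
      using fin dd by (intro \<epsilon>(2) hat_orth_shift hat_orth_subset[OF m(3) fin(4)]) (auto simp: F1_def x0_def)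
    ultimately show False by simp
  qed
qed

text \<open>By local finiteness a disagreement has a first position. The last common point before it
  sees equal windows at both places, and unequal next points contradict
  \<open>spectrum_next_determined\<close> in one of the two orders.\<close>

lemma spectrum_window_determines:
  assumes S: "bounded S" and L: "is_spectrum S L"
  obtains n where "n > 0" "\<And>l l' t. l \<in> L \<Longrightarrow> l' \<in> L \<Longrightarrow>
    (\<And>t. - n \<le> t \<Longrightarrow> t \<le> 0 \<Longrightarrow> l + t \<in> L \<longleftrightarrow> l' + t \<in> L) \<Longrightarrow> - n \<le> t \<Longrightarrow> l + t \<in> L \<longleftrightarrow> l' + t \<in> L"
proof -
  obtain n where n: "n > 0" "\<And>l l' d d'. l \<in> L \<Longrightarrow> l' \<in> L \<Longrightarrow> l + d \<in> L \<Longrightarrow> l' + d' \<in> L \<Longrightarrow> 0 < d \<Longrightarrow> d < d' \<Longrightarrow>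
    (\<And>t. 0 < t \<Longrightarrow> t < d' \<Longrightarrow> l' + t \<notin> L) \<Longrightarrow> (\<And>t. - n \<le> t \<Longrightarrow> t \<le> 0 \<Longrightarrow> l' + t \<in> L \<Longrightarrow> l + t \<in> L) \<Longrightarrow> False"
    by (rule spectrum_next_determined[OF S L]) blast
  obtain R where R: "R > 0" "\<And>x. \<exists>l\<in>L. x < l \<and> l < x + R"
    by (rule spectrum_relatively_dense[OF S L]) blast
  have fin: "finite (L \<inter> {a..b})" for a b by (rule spectrum_locally_finite[OF S L])
  have step: "l' + t \<in> L"
    if l: "l \<in> L" "l' \<in> L" and t: "0 < t" "l + t \<in> L"
      and agree: "\<And>u. - n \<le> u \<Longrightarrow> u < t \<Longrightarrow> l + u \<in> L \<longleftrightarrow> l' + u \<in> L" for l l' t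
  proof (rule ccontr)
    assume not: "l' + t \<notin> L"
    \<comment> \<open>Its maximum is the predecessor of \<open>l + t\<close> in the spectrum, and it
      exists because \<open>l\<close> itself belongs to the finite set.\<close>
    define X where "X = L \<inter> {l..l + t} - {l + t}"
    have X: "finite X" "l \<in> X" using fin[of l "l + t"] l t by (auto simp: X_def)
    define a where "a = Max X"
    have a: "a \<in> X" "\<And>x. x \<in> X \<Longrightarrow> x \<le> a" using X by (auto simp: a_def intro: Max_in)
    define s where "s = a - l"
    have s: "0 \<le> s" "s < t" "l + s \<in> L" using a(1) by (auto simp: X_def s_def)
    have gap: "l + u \<notin> L" if "s < u" "u < t" for u
    proof
      assume "l + u \<in> L"
      then have "l + u \<in> X" using that s by (auto simp: X_def)
      then show False using a(2)[of "l + u"] that by (simp add: s_def)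
    qed
    have l's: "l' + s \<in> L" using agree[of s] s n(1) by simp
    \<comment> \<open>The next point after \<open>l' + s\<close> exists by relative density, and a
      least one by local finiteness.\<close>
    have "\<exists>y. y \<in> L \<and> l' + s < y \<and> (\<forall>z. l' + s < z \<and> z < y \<longrightarrow> z \<notin> L)"
    proof -
      obtain y0 where y0: "y0 \<in> L" "l' + s < y0" using R(2) by blast
      define W where "W = L \<inter> {l' + s..y0} - {l' + s}"
      have W: "finite W" "y0 \<in> W" using fin[of "l' + s" y0] y0 by (auto simp: W_def)
      have "Min W \<in> W" using W by (intro Min_in) auto
      moreover have "z \<notin> L" if "l' + s < z" "z < Min W" for z
      proof
        assume "z \<in> L"
        have "Min W \<le> y0" using W by simp
        then have "z \<in> W" using that \<open>z \<in> L\<close> by (auto simp: W_def)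
        then show False using Min_le[OF W(1), of z] that by simp
      qed
      ultimately show ?thesis by (intro exI[of _ "Min W"]) (auto simp: W_def)
    qed
    then obtain y where y: "y \<in> L" "l' + s < y" "\<And>z. l' + s < z \<Longrightarrow> z < y \<Longrightarrow> z \<notin> L" by blast
    define d' where "d' = y - (l' + s)"
    have d': "l' + s + d' \<in> L" "0 < d'" "\<And>u. 0 < u \<Longrightarrow> u < d' \<Longrightarrow> l' + s + u \<notin> L"
      using y by (auto simp: d'_def)
    define d where "d = t - s"
    have d: "l + s + d \<in> L" "0 < d" "\<And>u. 0 < u \<Longrightarrow> u < d \<Longrightarrow> l + s + u \<notin> L"
      using t s gap by (auto simp: d_def add.assoc)
    have win: "l + s + u \<in> L \<longleftrightarrow> l' + s + u \<in> L" if "- n \<le> u" "u \<le> 0" for u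
      using agree[of "s + u"] that s by (simp add: add.assoc)
    consider "d < d'" | "d' < d" | "d = d'" by linarith
    then show False
    proof cases
      case 1
      show False by (rule n(2)[OF s(3) l's d(1) d'(1) d(2) 1 d'(3)]) (use win in auto)
    next
      case 2
      show False by (rule n(2)[OF l's s(3) d'(1) d(1) d'(2) 2 d(3)]) (use win in auto)
    next
      case 3
      then have e: "l' + s + d' = l' + t" by (simp add: d_def)
      show False using d'(1) not unfolding e by contradiction
    qed
  qed
  show ?thesis
  proof (rule that[OF n(1)])
    fix l l' t
    assume l: "l \<in> L" "l' \<in> L" and win: "\<And>t. - n \<le> t \<Longrightarrow> t \<le> 0 \<Longrightarrow> l + t \<in> L \<longleftrightarrow> l' + t \<in> L" and t: "- n \<le> t"
    show "l + t \<in> L \<longleftrightarrow> l' + t \<in> L"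
    proof (rule ccontr)
      assume neq: "\<not> ?thesis"
      define X where "X = {u. 0 \<le> u \<and> u \<le> t \<and> (l + u \<in> L) \<noteq> (l' + u \<in> L)}"
      have "0 \<le> t" using win[of t] t neq by force
      have "X \<subseteq> (\<lambda>x. x - l) ` (L \<inter> {l..l + t}) \<union> (\<lambda>x. x - l') ` (L \<inter> {l'..l' + t})"
      proof
        fix u assume u: "u \<in> X"
        then consider "l + u \<in> L" | "l' + u \<in> L" by (auto simp: X_def)
        then show "u \<in> (\<lambda>x. x - l) ` (L \<inter> {l..l + t}) \<union> (\<lambda>x. x - l') ` (L \<inter> {l'..l' + t})"
          using u by cases (auto simp: X_def intro: image_eqI[of _ _ "l + u"] image_eqI[of _ _ "l' + u"])
      qed
      then have X: "finite X" by (rule finite_subset) (simp add: fin)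
      have tX: "t \<in> X" using neq \<open>0 \<le> t\<close> by (auto simp: X_def)
      define u where "u = Min X"
      have u: "u \<in> X" "\<And>x. x \<in> X \<Longrightarrow> u \<le> x" using X tX by (auto simp: u_def intro: Min_in)
      have agree: "l + x \<in> L \<longleftrightarrow> l' + x \<in> L" if "- n \<le> x" "x < u" for x
      proof (cases "x \<le> 0")
        case True
        then show ?thesis using win that by simp
      next
        case False
        then show ?thesis using u(2)[of x] that u(1) by (auto simp: X_def)
      qed
      have "u \<noteq> 0" using u(1) win[of 0] n(1) by (auto simp: X_def)
      then have "0 < u" using u(1) by (simp add: X_def)
      then have "l + u \<in> L \<longleftrightarrow> l' + u \<in> L"
        using step[OF l, of u] step[OF l(2,1), of u] agree by blast
      then show False using u(1) by (simp add: X_def)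
    qed
  qed
qed

text \<open>Patterns in a window are subsets of one finite set of zeros, so two windows coincide. A
  window determines only what lies to its right; coincidences arbitrarily far to the left extend the
  periodicity to the whole line.\<close>

theorem spectrum_has_period:
  assumes S: "bounded S" and L: "is_spectrum S L"
  obtains p where "has_period L p"
proof -
  have m: "S \<in> sets lebesgue" "measure lebesgue S > 0" "hat_orth S L" using L by (auto simp: is_spectrum_iff)
  obtain n where n: "n > 0" "\<And>l l' t. l \<in> L \<Longrightarrow> l' \<in> L \<Longrightarrow>
    (\<And>t. - n \<le> t \<Longrightarrow> t \<le> 0 \<Longrightarrow> l + t \<in> L \<longleftrightarrow> l' + t \<in> L) \<Longrightarrow> - n \<le> t \<Longrightarrow> l + t \<in> L \<longleftrightarrow> l' + t \<in> L"
    by (rule spectrum_window_determines[OF S L]) blast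
  obtain R where R: "R > 0" "\<And>x. \<exists>l\<in>L. x < l \<and> l < x + R"
    by (rule spectrum_relatively_dense[OF S L]) blast
  have "\<exists>l\<in>L. l < - real k" for k :: nat
    using R(2)[of "- real k - R"] by (metis diff_add_cancel)
  \<comment> \<open>A sequence running off to the left, so that some repetition of the pattern lies
    to the left of any prescribed point.\<close>
  then obtain f where f: "\<And>k. f k \<in> L" "\<And>k :: nat. f k < - real k" by metis
  define W where "W l = {t. - n \<le> t \<and> t \<le> 0 \<and> l + t \<in> L}" for l
  define Z where "Z = insert 0 {l \<in> {- n..n}. hat S l = 0}"
  have "finite Z" using finite_zeros_hat[OF m(1) S m(2), of n] by (simp add: Z_def)
  have "W l \<subseteq> Z" if "l \<in> L" for l
  proof
    fix t assume t: "t \<in> W l"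
    show "t \<in> Z"
    proof (cases "t = 0")
      case False
      then have "hat S ((l + t) - l) = 0"
        using t that by (intro m(3)[unfolded hat_orth_def, rule_format]) (auto simp: W_def)
      then show ?thesis using t n(1) by (auto simp: Z_def W_def)
    qed (simp add: Z_def)
  qed
  then have "(\<lambda>k. W (f k)) ` UNIV \<subseteq> Pow Z" using f(1) by auto
  then have "finite ((\<lambda>k. W (f k)) ` (UNIV :: nat set))"
    by (rule finite_subset) (simp add: \<open>finite Z\<close>)
  from pigeonhole_infinite[OF infinite_UNIV_nat this]
  obtain k0 where "infinite {k. W (f k) = W (f k0)}" by auto
  then have far: "\<exists>k. W (f k) = W (f k0) \<and> real k \<ge> x" for x
  proof -
    obtain N :: nat where "x \<le> real N" using real_arch_simple by blast
    moreover obtain k where "k > N" "W (f k) = W (f k0)"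
      using \<open>infinite {k. W (f k) = W (f k0)}\<close> unfolding infinite_nat_iff_unbounded by blast
    ultimately show ?thesis by (intro exI[of _ k]) auto
  qed
  have shift: "f j + t \<in> L \<longleftrightarrow> f k + t \<in> L" if "W (f j) = W (f k0)" "W (f k) = W (f k0)" "0 \<le> t" for j k t
  proof (rule n(2)[OF f(1) f(1)])
    fix t assume "- n \<le> t" "t \<le> 0"
    then show "f j + t \<in> L \<longleftrightarrow> f k + t \<in> L" using that(1,2) unfolding W_def by blast
  qed (use that n(1) in simp)
  obtain k1 where k1: "W (f k1) = W (f k0)" "real k1 \<ge> - f k0" using far by blast
  define p where "p = f k0 - f k1"
  have p: "p > 0" using f(2)[of k1] k1(2) by (simp add: p_def)
  \<comment> \<open>With \<open>f k\<close> left of \<open>y\<close>, the position \<open>y\<close>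
    is first read from \<open>f k0\<close> and then, one period further, from \<open>f k1\<close>;
    both comparisons pass through \<open>f k\<close>, so \<open>p\<close> does not depend on
    \<open>y\<close>.\<close>
  have iff: "y \<in> L \<longleftrightarrow> y + p \<in> L" for y
  proof -
    obtain k where k: "W (f k) = W (f k0)" "real k \<ge> max (- y) (- f k1)" using far by blast
    define q where "q = f k1 - f k"
    have fk: "f k < y" "f k < f k1" using f(2)[of k] k(2) by auto
    have "y \<in> L \<longleftrightarrow> f k + (y - f k) \<in> L" by simp
    also have "\<dots> \<longleftrightarrow> f k0 + (y - f k) \<in> L" by (rule shift[OF k(1) refl]) (use fk in simp)
    also have "f k0 + (y - f k) = f k1 + (y + p - f k)" by (simp add: p_def)
    also have "f k1 + (y + p - f k) \<in> L \<longleftrightarrow> f k + (y + p - f k) \<in> L"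
      by (rule shift[OF k1(1) k(1)]) (use fk p in simp)
    finally show ?thesis by simp
  qed
  have "(+) p ` L = L"
  proof (intro equalityI subsetI)
    fix x assume "x \<in> (+) p ` L"
    then show "x \<in> L" using iff by (auto simp: add.commute)
  next
    fix x assume "x \<in> L"
    then have "x - p \<in> L" using iff[of "x - p"] by simp
    then show "x \<in> (+) p ` L" by (intro image_eqI[of _ _ "x - p"]) auto
  qed
  then show ?thesis using that[of p] p by (simp add: has_period_def)
qed

section \<open>A rigid partition of the unit interval\<close>

text \<open>
  Long distances are covered by a part of the word cycling through the letters
  followed by a part made of blocks of constant letters, short ones by the blocks \<open>i j j \<dots> j\<close>.
\<close>

lemma rigid_word:
  assumes m: "m > 0"
  obtains w :: "nat \<Rightarrow> nat" and Q D where "0 < D" "D < Q" "\<And>v. w v < m"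
    "\<And>i. i < m \<Longrightarrow> \<exists>v. D \<le> v \<and> v + D < Q \<and> w v = i"
    "\<And>u i j. 1 \<le> u \<Longrightarrow> u + D \<le> Q \<Longrightarrow> i < m \<Longrightarrow> j < m \<Longrightarrow> \<exists>v. v + u < Q \<and> w v = i \<and> w (v + u) = j"
proof -
  \<comment> \<open>The number of ordered pairs of letters, the pair of \<open>i\<close> and
    \<open>j\<close> being coded by \<open>m * i + j\<close>.\<close>
  define K where "K = m * m"
  \<comment> \<open>With this value, \<open>u + D \<le> Q\<close> amounts to
    \<open>u + K \<le> 2 * L\<close>, the range that the first two stretches of the word can
    cover.\<close>
  define D where "D = K * (K + 2)"
  define L where "L = D + m"
  define Q where "Q = 2 * L + K * (K + 1)"
  have K: "K > 0" using m by (simp add: K_def)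
  have D_eq: "D = K * (K + 1) + K" by (simp add: D_def algebra_simps)
  have KL: "K \<le> L" by (simp add: L_def D_eq)
  \<comment> \<open>Three stretches: \<open>L\<close> positions cycling through the letters,
    \<open>L\<close> positions with runs of length \<open>m\<close> repeating with period
    \<open>K\<close>, and \<open>K\<close> blocks of length \<open>K + 1\<close>, where block
    \<open>m * i + j\<close> reads \<open>i\<close> once and then \<open>j\<close>.\<close>
  define w where "w v = (if v < L then v mod m else if v < 2 * L then ((v - L) mod K) div m
      else if (v - 2 * L) mod (K + 1) = 0 then ((v - 2 * L) div (K + 1)) div m mod m
      else ((v - 2 * L) div (K + 1)) mod m)" for v
  show ?thesis
  proof (rule that[of D Q w])
    show "0 < D" using K by (simp add: D_def)
    show "D < Q" using m by (simp add: Q_def L_def)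
    show "w v < m" for v
    proof -
      have "(v - L) mod K < m * m" using K by (simp add: K_def)
      then have "((v - L) mod K) div m < m" by (rule less_mult_imp_div_less)
      then show ?thesis using m by (simp add: w_def)
    qed
    show "\<exists>v. D \<le> v \<and> v + D < Q \<and> w v = i" if i: "i < m" for i
    proof (intro exI[of _ "D + i"] conjI)
      have "D mod m = 0" by (simp add: D_def K_def mult.assoc)
      then show "w (D + i) = i" using i by (simp add: w_def L_def mod_add_left_eq[symmetric, of D] del: mod_add_left_eq)
      show "D + i + D < Q" using i by (simp add: Q_def L_def)
    qed simp
    fix u i j assume u: "1 \<le> u" "u + D \<le> Q" and ij: "i < m" "j < m"
    have u2: "u + K \<le> 2 * L" using u(2) by (simp add: Q_def D_eq)
    show "\<exists>v. v + u < Q \<and> w v = i \<and> w (v + u) = j"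
    proof (cases "u \<le> K")
      case True
      define k where "k = m * i + j"
      have "k < m * i + m" using ij by (simp add: k_def)
      also have "\<dots> \<le> m * m" using ij mult_le_mono2[of "Suc i" m m] by simp
      finally have k: "k < K" by (simp add: K_def)
      have kd: "k div m = i" "k mod m = j" using ij by (simp_all add: k_def)
      define x where "x = k * (K + 1)"
      have x: "x mod (K + 1) = 0" "x div (K + 1) = k" 
        unfolding x_def by (rule mod_mult_self2_is_0, rule nonzero_mult_div_cancel_right) simp
      have "(u + (K + 1) * k) div (K + 1) = k + u div (K + 1)" "(u + (K + 1) * k) mod (K + 1) = u mod (K + 1)"
        by (rule div_mult_self2, simp, rule mod_mult_self2)
      then have xu: "(x + u) mod (K + 1) = u" "(x + u) div (K + 1) = k"
        using True by (simp_all add: x_def mult.commute[of k] add.commute[of _ u])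
      define v where "v = 2 * L + x"
      have "x + (K + 1) \<le> K * (K + 1)" using k mult_le_mono1[of "Suc k" K "K + 1"] by (simp add: x_def)
      then have "v + u < Q" using True by (simp add: v_def Q_def)
      moreover have "w v = i" using ij kd x by (simp add: w_def v_def)
      moreover have "w (v + u) = j" using u(1) kd xu by (simp add: w_def v_def)
      ultimately show ?thesis by blast
    next
      case False
      \<comment> \<open>The residue that the offset \<open>r\<close> must have modulo
        \<open>m\<close> in order that position \<open>L + r - u\<close> of the cycling part carries
        \<open>i\<close>.\<close>
      define c where "c = nat ((int i + int u - int L) mod int m)"
      have c: "int c = (int i + int u - int L) mod int m" using m by (simp add: c_def)
      have cm: "c < m"
      proof -
        have "int c < int m" unfolding c using m by simp
        then show ?thesis by simp
      qed
      define r0 where "r0 = u - L"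
      \<comment> \<open>Moves the offset from \<open>r0\<close>, the least one with
        \<open>L + r - u\<close> nonnegative, to the residue \<open>m * j + c\<close> modulo
        \<open>K\<close>. That residue lies in the run of \<open>j\<close> and still reduces to
        \<open>c\<close> modulo \<open>m\<close>.\<close>
      define d where "d = nat ((int (m * j + c) - int r0) mod int K)"
      have d: "int d = (int (m * j + c) - int r0) mod int K" using K by (simp add: d_def)
      have dK: "d < K"
      proof -
        have "int d < int K" unfolding d using K by simp
        then show ?thesis by simp
      qed
      define r where "r = r0 + d"
      have "m * j + c < m * Suc j" using cm by simp
      also have "\<dots> \<le> m * m" using ij by (intro mult_le_mono2) simp
      finally have mjc: "m * j + c < K" by (simp add: K_def)
      have "int r mod int K = int (m * j + c) mod int K"
        unfolding r_def of_nat_add d by (simp add: mod_simps)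
      then have r_mod: "r mod K = m * j + c"
        using mjc by (metis mod_less of_nat_eq_iff of_nat_mod)
      have r: "r < L" "r < u" "u \<le> L + r"
        using dK u2 False KL by (auto simp: r_def r0_def)
      define v where "v = L + r - u"
      have v: "v < L" "v + u = L + r" using r by (auto simp: v_def)
      have "w (v + u) = j"
        using r cm m by (simp add: v(2) w_def r_mod)
      moreover have "w v = i"
      proof -
        have iv: "int v = int L + int r - int u" using r by (simp add: v_def of_nat_diff)
        have rc: "int r mod int m = int c mod int m"
        proof -
          have "r mod m = (r mod K) mod m" by (simp add: K_def mod_mod_cancel)
          then have "r mod m = c mod m" by (simp add: r_mod)
          then show ?thesis by (metis of_nat_mod)
        qed
        have "int v mod int m = ((int L + int r) mod int m - int u) mod int m"
          unfolding iv by (rule mod_diff_left_eq[symmetric])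
        also have "(int L + int r) mod int m = (int L + int r mod int m) mod int m"
          by (rule mod_add_right_eq[symmetric])
        also have "\<dots> = (int L + int c) mod int m"
          unfolding rc by (rule mod_add_right_eq)
        also have "(int L + int c) mod int m = (int L + (int i + int u - int L)) mod int m"
          unfolding c by (rule mod_add_right_eq)
        also have "int L + (int i + int u - int L) = int i + int u" by simp
        also have "((int i + int u) mod int m - int u) mod int m = (int i + int u - int u) mod int m"
          by (rule mod_diff_left_eq)
        also have "\<dots> = int i" using ij by simp
        finally have "v mod m = i" by (metis of_nat_eq_iff of_nat_mod)
        then show ?thesis using v by (simp add: w_def)
      qed
      moreover have "v + u < Q" using r(1) by (simp add: v(2) Q_def)
      ultimately show ?thesis by blast
    qed
  qed
qed

text \<open>The margin \<open>\<delta>\<close> is unavoidable, since displacements near 1 leave too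
  little overlap to show all pairs of colours. It is matched with \<open>color_middle\<close>: a
  unit cell covering a point in the middle of another unit cell is displaced from it by less than
  \<open>1 - \<delta>\<close>.\<close>

locale rigid_coloring =
  fixes \<phi> :: "real \<Rightarrow> nat" and m :: nat and \<delta> :: real
  assumes color_less: "\<And>x. \<phi> x < m"
    and color_measurable: "\<And>j. {x \<in> {0..<1}. \<phi> x = j} \<in> sets borel"
    and color_middle: "\<And>j. j < m \<Longrightarrow> \<exists>a b. a < b \<and> (\<forall>x\<in>{a<..<b}. \<delta> < x \<and> x < 1 - \<delta> \<and> \<phi> x = j)"
    and color_shift: "\<And>i j x. i < m \<Longrightarrow> j < m \<Longrightarrow> x \<noteq> 0 \<Longrightarrow> \<bar>x\<bar> < 1 - \<delta> \<Longrightarrow>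
      \<exists>a b. a < b \<and> (\<forall>y\<in>{a<..<b}. y \<in> {0..<1} \<and> y - x \<in> {0..<1} \<and> \<phi> y = j \<and> \<phi> (y - x) = i)"
    and delta_pos: "\<delta> > 0"

text \<open>The letters of the word colour \<open>Q\<close> equal subintervals. A displacement is
  rounded down to \<open>u\<close> subinterval lengths, where the word supplies the pair of letters;
  negative displacements exchange the two colours.\<close>

lemma rigid_coloring_exists:
  assumes "m > 0"
  obtains \<phi> \<delta> where "rigid_coloring \<phi> m \<delta>"
proof -
  obtain w :: "nat \<Rightarrow> nat" and Q D where DQ: "0 < D" "D < Q" and w: "\<And>v. w v < m"
    and mid: "\<And>i. i < m \<Longrightarrow> \<exists>v. D \<le> v \<and> v + D < Q \<and> w v = i"
    and pairs: "\<And>u i j. 1 \<le> u \<Longrightarrow> u + D \<le> Q \<Longrightarrow> i < m \<Longrightarrow> j < m \<Longrightarrow> \<exists>v. v + u < Q \<and> w v = i \<and> w (v + u) = j"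
    using rigid_word[OF assms] by metis
  define q where "q = real Q"
  have q: "q > 0" using DQ by (simp add: q_def)
  define \<delta> where "\<delta> = real D / q"
  define \<phi> where "\<phi> x = w (nat \<lfloor>q * x\<rfloor>)" for x
  have \<phi>_eq: "\<phi> x = w v" if "real v / q < x" "x < (real v + 1) / q" for x v
  proof -
    have "real v \<le> q * x" "q * x < real v + 1" using that q by (simp_all add: field_simps)
    then have "\<lfloor>q * x\<rfloor> = int v" by (intro floor_unique) auto
    then show ?thesis by (simp add: \<phi>_def)
  qed
  have pos: "\<exists>a b. a < b \<and> (\<forall>y\<in>{a<..<b}. y \<in> {0..<1} \<and> y - x \<in> {0..<1} \<and> \<phi> y = j \<and> \<phi> (y - x) = i)"
    if ij: "i < m" "j < m" and x: "0 < x" "x < 1 - \<delta>" for i j x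
  proof -
    define u where "u = nat \<lfloor>q * x\<rfloor>"
    have u: "real u \<le> q * x" "q * x < real u + 1" using q x by (auto simp: u_def of_nat_nat)
    have "q * x < q - real D" using x q by (simp add: \<delta>_def field_simps)
    then have "real u + real D < q" using u by linarith
    then have uD: "u + D < Q" by (simp add: q_def)
    show ?thesis
    proof (cases "u = 0")
      case True
      \<comment> \<open>A displacement shorter than one subinterval uses two adjacent letters:
        \<open>y\<close> lies just right of their common endpoint and \<open>y - x\<close> just left
        of it.\<close>
      obtain v where v: "v + 1 < Q" "w v = i" "w (v + 1) = j"
        using pairs[of 1 i j] ij DQ by auto
      have vq: "real v + 2 \<le> q" using v(1) by (simp add: q_def)
      define a where "a = (real v + 1) / q"
      have xq: "x < 1 / q" using u True q by (simp add: field_simps)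
      have a: "a + 1 / q = (real v + 2) / q" "a - 1 / q = real v / q" using q by (simp_all add: a_def field_simps)
      have a1: "a + 1 / q \<le> 1" unfolding a using vq q by (simp add: field_simps)
      have a0: "0 \<le> a - 1 / q" unfolding a using q by simp
      have "y \<in> {0..<1} \<and> y - x \<in> {0..<1} \<and> \<phi> y = j \<and> \<phi> (y - x) = i" if y: "y \<in> {a<..<a + x}" for y
      proof (intro conjI)
        show "y \<in> {0..<1}" "y - x \<in> {0..<1}" using y xq a0 a1 x q by auto
        have "\<phi> y = w (v + 1)"
          by (rule \<phi>_eq) (use y xq a in \<open>auto simp: a_def add.commute\<close>)
        then show "\<phi> y = j" using v by simp
        have "\<phi> (y - x) = w v"
          by (rule \<phi>_eq) (use y xq a in \<open>auto simp: a_def add.commute\<close>)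
        then show "\<phi> (y - x) = i" using v by simp
      qed
      then show ?thesis using x(1) by (intro exI[of _ a] exI[of _ "a + x"]) auto
    next
      case False
      obtain v where v: "v + u < Q" "w v = i" "w (v + u) = j"
        using pairs[of u i j] ij uD False by auto
      have vq: "real v + real u + 1 \<le> q" using v(1) by (simp add: q_def)
      define a where "a = real v / q + x"
      define b where "b = (real v + real u + 1) / q"
      have ux: "real u / q \<le> x" "x < (real u + 1) / q" using u q by (simp_all add: field_simps)
      have ab: "a < b" using ux by (simp add: a_def b_def add_divide_distrib)
      have b1: "b \<le> 1" using vq q by (simp add: b_def)
      have bx: "b - x \<le> (real v + 1) / q" using ux by (simp add: b_def add_divide_distrib)
      have av: "(real v + real u) / q \<le> a" using ux by (simp add: a_def add_divide_distrib)
      have v0: "0 \<le> real v / q" using q by simp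
      have "y \<in> {0..<1} \<and> y - x \<in> {0..<1} \<and> \<phi> y = j \<and> \<phi> (y - x) = i" if y: "y \<in> {a<..<b}" for y
      proof (intro conjI)
        show "y \<in> {0..<1}" "y - x \<in> {0..<1}" using y b1 v0 x by (auto simp: a_def)
        have "\<phi> y = w (v + u)"
          by (rule \<phi>_eq) (use y av in \<open>auto simp: b_def\<close>)
        then show "\<phi> y = j" using v by simp
        have "\<phi> (y - x) = w v"
          by (rule \<phi>_eq) (use y bx in \<open>auto simp: a_def\<close>)
        then show "\<phi> (y - x) = i" using v by simp
      qed
      then show ?thesis using ab by blast
    qed
  qed
  have "rigid_coloring \<phi> m \<delta>"
  proof
    show "\<phi> x < m" for x by (simp add: \<phi>_def w)
    show "\<delta> > 0" using DQ q by (simp add: \<delta>_def)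
    show "{x \<in> {0..<1}. \<phi> x = j} \<in> sets borel" for j
    proof -
      have "{x \<in> {0..<1}. \<phi> x = j} = (\<Union>k\<in>{k. w (nat k) = j}. {x \<in> {0..<1}. \<lfloor>q * x\<rfloor> = k})"
        by (auto simp: \<phi>_def)
      moreover have "{x \<in> {0..<1}. \<lfloor>q * x\<rfloor> = k} \<in> sets borel" for k
      proof -
        have "{x \<in> {0..<1}. \<lfloor>q * x\<rfloor> = k} = {0..<1} \<inter> {of_int k / q..<(of_int k + 1) / q}"
          using q by (auto simp: floor_eq_iff field_simps)
        then show ?thesis by simp
      qed
      ultimately show ?thesis by (auto intro!: sets.countable_UN'')
    qed
    show "\<exists>a b. a < b \<and> (\<forall>x\<in>{a<..<b}. \<delta> < x \<and> x < 1 - \<delta> \<and> \<phi> x = j)" if j: "j < m" for j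
    proof -
      obtain v where v: "D \<le> v" "v + D < Q" "w v = j" using mid[OF j] by blast
      have vq: "real v + 1 \<le> q - real D"
      proof -
        have "real (v + D + 1) \<le> q" unfolding q_def using v(2) by (intro of_nat_mono) simp
        then show ?thesis by simp
      qed
      have "\<delta> < x \<and> x < 1 - \<delta> \<and> \<phi> x = j" if x: "x \<in> {real v / q<..<(real v + 1) / q}" for x
      proof (intro conjI)
        have "\<delta> \<le> real v / q" using v(1) q by (simp add: \<delta>_def divide_right_mono)
        then show "\<delta> < x" using x by auto
        have "(real v + 1) / q \<le> (q - real D) / q" using vq q by (intro divide_right_mono) auto
        also have "\<dots> = 1 - \<delta>" using q by (simp add: \<delta>_def diff_divide_distrib)
        finally show "x < 1 - \<delta>" using x by auto
        show "\<phi> x = j" using \<phi>_eq[of v x] x v(3) by auto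
      qed
      then show ?thesis using q by (intro exI[of _ "real v / q"] exI[of _ "(real v + 1) / q"]) (auto simp: divide_strict_right_mono)
    qed
    show "\<exists>a b. a < b \<and> (\<forall>y\<in>{a<..<b}. y \<in> {0..<1} \<and> y - x \<in> {0..<1} \<and> \<phi> y = j \<and> \<phi> (y - x) = i)"
      if ij: "i < m" "j < m" and x: "x \<noteq> 0" "\<bar>x\<bar> < 1 - \<delta>" for i j x
    proof (cases "x > 0")
      case True
      then show ?thesis using pos[OF ij, of x] x by auto
    next
      case False
      then obtain a b where ab: "a < b" "\<And>y. y \<in> {a<..<b} \<Longrightarrow> y \<in> {0..<1} \<and> y - (- x) \<in> {0..<1} \<and> \<phi> y = i \<and> \<phi> (y - (- x)) = j"
        using pos[OF ij(2,1), of "- x"] x by auto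
      have "y \<in> {0..<1} \<and> y - x \<in> {0..<1} \<and> \<phi> y = j \<and> \<phi> (y - x) = i" if "y \<in> {a + x<..<b + x}" for y
        using ab(2)[of "y - x"] that by auto
      then show ?thesis using ab(1) by (intro exI[of _ "a + x"] exI[of _ "b + x"]) auto
    qed
  qed
  then show ?thesis by (rule that)
qed

section \<open>Tilings by coloured cells\<close>

lemma ex_not_in_null_set:
  assumes "a < (b :: real)" "N \<in> null_sets lebesgue"
  obtains x where "a < x" "x < b" "x \<notin> N"
proof -
  have "\<not> {a<..<b} \<subseteq> N"
  proof
    assume "{a<..<b} \<subseteq> N"
    then have "emeasure lebesgue {a<..<b} \<le> emeasure lebesgue N" using assms(2) by (intro emeasure_mono) auto
    then show False using assms(1) null_setsD1[OF assms(2)] by simp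
  qed
  then obtain x where "x \<in> {a<..<b}" "x \<notin> N" by blast
  then show ?thesis using that[of x] by simp
qed

text \<open>Half-open unit intervals that do not overlap and cover almost everything leave no gap of
  positive length, so each is followed and preceded by another at distance exactly 1.\<close>

lemma unit_cells:
  fixes D :: "real set"
  assumes sep: "\<And>c d. c \<in> D \<Longrightarrow> d \<in> D \<Longrightarrow> c < d \<Longrightarrow> c + 1 \<le> d"
    and N: "N \<in> null_sets lebesgue" and cover: "\<And>y. y \<notin> N \<Longrightarrow> \<exists>d\<in>D. d \<le> y \<and> y < d + 1"
    and d: "d \<in> D"
  shows "d + of_int k \<in> D"
proof -
  have up: "d + 1 \<in> D" if d: "d \<in> D" for d
  proof (rule ccontr)
    assume not: "d + 1 \<notin> D"
    obtain y where y: "d + 1 < y" "y < d + 2" "y \<notin> N" using ex_not_in_null_set[OF _ N, of "d + 1" "d + 2"] by auto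
    obtain e where e: "e \<in> D" "e \<le> y" "y < e + 1" using cover[OF y(3)] by blast
    have "d + 1 \<le> e" using sep[OF d e(1)] y e by linarith
    then have "d + 1 < e" using not e(1) by (cases "e = d + 1") auto
    then obtain y' where y': "d + 1 < y'" "y' < e" "y' \<notin> N" using ex_not_in_null_set[OF _ N] by blast
    obtain e' where e': "e' \<in> D" "e' \<le> y'" "y' < e' + 1" using cover[OF y'(3)] by blast
    have "d + 1 \<le> e'" using sep[OF d e'(1)] y' e' by linarith
    moreover have "e' + 1 \<le> e" using sep[OF e'(1) e(1)] y' e' by linarith
    ultimately show False using e y by linarith
  qed
  have down: "d - 1 \<in> D" if d: "d \<in> D" for d
  proof (rule ccontr)
    assume not: "d - 1 \<notin> D"
    obtain y where y: "d - 1 < y" "y < d" "y \<notin> N" using ex_not_in_null_set[OF _ N, of "d - 1" d] by auto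
    obtain e where e: "e \<in> D" "e \<le> y" "y < e + 1" using cover[OF y(3)] by blast
    have "e + 1 \<le> d" using sep[OF e(1) d] y e by linarith
    then have "e + 1 < d" using not e(1) by (cases "e = d - 1") auto
    then obtain y' where y': "e + 1 < y'" "y' < d" "y' \<notin> N" using ex_not_in_null_set[OF _ N] by blast
    obtain e' where e': "e' \<in> D" "e' \<le> y'" "y' < e' + 1" using cover[OF y'(3)] by blast
    have "e' + 1 \<le> d" using sep[OF e'(1) d] y' e' by linarith
    moreover have "e + 1 \<le> e'" using sep[OF e(1) e'(1)] y' e' by linarith
    ultimately show False using e y by linarith
  qed
  show ?thesis
  proof (induction k rule: int_induct[of _ 0])
    case (step1 i)
    then show ?case using up by (force simp: add.assoc[symmetric])
  next
    case (step2 i)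
    then show ?case using down by (force simp: algebra_simps)
  qed (simp add: d)
qed

context rigid_coloring
begin

definition colored :: "(nat \<Rightarrow> int set) \<Rightarrow> real set"
  where "colored A = {y. \<lfloor>y\<rfloor> \<in> A (\<phi> (frac y))}"

lemma pat_colored: "x \<in> {0..<1} \<Longrightarrow> pat (colored A) x = A (\<phi> x)"
proof -
  assume "x \<in> {0..<1}"
  then have "\<lfloor>x + of_int k\<rfloor> = k" "frac (x + of_int k) = x" for k
    by (auto simp: frac_def floor_eq_iff)
  then show ?thesis by (simp add: pat_def colored_def)
qed

lemma colored_shift_iff:
  assumes "y - (t + of_int a) \<in> {0..<1}"
  shows "y \<in> (+) t ` colored A \<longleftrightarrow> a \<in> A (\<phi> (y - (t + of_int a)))"
proof -
  have "\<lfloor>y - t\<rfloor> = a" using assms by (intro floor_unique) auto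
  then have "y - t \<in> colored A \<longleftrightarrow> a \<in> A (\<phi> (y - (t + of_int a)))"
    by (simp add: colored_def frac_def diff_diff_eq)
  moreover have "y \<in> (+) t ` colored A \<longleftrightarrow> y - t \<in> colored A"
    by (auto intro: image_eqI[of _ _ "y - t"])
  ultimately show ?thesis by simp
qed

lemma colored_measurable: "colored A \<in> sets lebesgue"
proof -
  have "colored A = (\<Union>j\<in>{..<m}. \<Union>a\<in>A j. (+) (of_int a) ` {x \<in> {0..<1}. \<phi> x = j})"
  proof (intro equalityI subsetI)
    fix y assume "y \<in> colored A"
    then show "y \<in> (\<Union>j\<in>{..<m}. \<Union>a\<in>A j. (+) (of_int a) ` {x \<in> {0..<1}. \<phi> x = j})"
      using color_less frac_lt_1[of y]
      by (auto simp: colored_def frac_def intro!: bexI[of _ "\<phi> (frac y)"] bexI[of _ "\<lfloor>y\<rfloor>"] image_eqI[of _ _ "frac y"])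
  next
    fix y assume "y \<in> (\<Union>j\<in>{..<m}. \<Union>a\<in>A j. (+) (of_int a) ` {x \<in> {0..<1}. \<phi> x = j})"
    then obtain j a x where "a \<in> A j" "x \<in> {0..<1}" "\<phi> x = j" "y = of_int a + x" by auto
    then show "y \<in> colored A"
      using pat_colored[of x A] by (auto simp: pat_def add.commute)
  qed
  moreover have "(+) (of_int a) ` {x \<in> {0..<1}. \<phi> x = j} \<in> sets lebesgue" for a j
    using color_measurable by (intro lebesgue_sets_translation) (simp add: sets_completionI_sets)
  ultimately show ?thesis by (auto intro!: sets.countable_UN'' countable_finite)
qed

lemma colored_bounded:
  assumes "\<And>j. j < m \<Longrightarrow> finite (A j)"
  shows "bounded (colored A)"
proof -
  define U where "U = (\<Union>j\<in>{..<m}. A j)"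
  have U: "finite U" using assms by (auto simp: U_def)
  have "colored A \<subseteq> (\<Union>a\<in>U. {of_int a..of_int a + 1})"
  proof
    fix y assume "y \<in> colored A"
    then have "\<lfloor>y\<rfloor> \<in> U" using color_less by (auto simp: colored_def U_def)
    then show "y \<in> (\<Union>a\<in>U. {of_int a..of_int a + 1})"
      by (intro UN_I[of "\<lfloor>y\<rfloor>"]) (auto intro: less_imp_le)
  qed
  moreover have "bounded (\<Union>a\<in>U. {of_int a..of_int a + (1 :: real)})"
    using U by (intro bounded_UN) auto
  ultimately show ?thesis by (rule bounded_subset[rotated])
qed

text \<open>A translate of the coloured set is a family of partial unit cells. Rigidity shows that
  the left ends of cells are the same for every colour; they then fill a coset of the integers, and
  the translates in one such coset form the common complement.\<close>

lemma colored_tiling: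
  assumes m: "m > 0" and A: "\<And>j. j < m \<Longrightarrow> A j \<noteq> {}" and tiles: "tiles_by (colored A) T"
  shows "\<exists>T0 :: int set. \<forall>j<m. \<forall>z. \<exists>!t. t \<in> T0 \<and> z - t \<in> A j"
proof -
  define N where "N = UNIV - (\<Union>t\<in>T. (+) t ` colored A)"
  have N: "N \<in> null_sets lebesgue" using tiles by (simp add: tiles_by_def N_def)
  have disj: "(+) s ` colored A \<inter> (+) t ` colored A \<in> null_sets lebesgue" if "s \<in> T" "t \<in> T" "s \<noteq> t" for s t
    using tiles that by (simp add: tiles_by_def)
  \<comment> \<open>Cells at such an offset would show the colours \<open>i\<close> and
    \<open>j\<close> simultaneously on an interval, so two tiles would overlap in positive measure.
    Within one tile the offset is a nonzero integer.\<close>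
  have no_small: "False" if st: "s \<in> T" "t \<in> T" and ij: "i < m" "j < m" and ab: "a \<in> A i" "b \<in> A j"
    and x: "(s + of_int a) - (t + of_int b) \<noteq> 0" "\<bar>(s + of_int a) - (t + of_int b)\<bar> < 1 - \<delta>" for s t i j a b
  proof (cases "s = t")
    case True
    have "a \<noteq> b" using x(1) True by auto
    then have "\<bar>of_int (a - b) :: real\<bar> \<ge> 1" by linarith
    then show False using x(2) True delta_pos by simp
  next
    case False
    define x where "x = (s + of_int a) - (t + of_int b)"
    obtain y1 y2 where y: "y1 < y2" "\<And>y. y \<in> {y1<..<y2} \<Longrightarrow> y \<in> {0..<1} \<and> y - x \<in> {0..<1} \<and> \<phi> y = j \<and> \<phi> (y - x) = i"
      using color_shift[OF ij, of x] x unfolding x_def by blast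
    have "y1 + (t + of_int b) < y2 + (t + of_int b)" using y(1) by simp
    then obtain z where z: "y1 + (t + of_int b) < z" "z < y2 + (t + of_int b)" "z \<notin> (+) s ` colored A \<inter> (+) t ` colored A"
      by (rule ex_not_in_null_set[OF _ disj[OF st False]])
    have *: "z - (t + of_int b) \<in> {y1<..<y2}" using z by auto
    have e: "z - (t + of_int b) - x = z - (s + of_int a)" by (simp add: x_def)
    have "z \<in> (+) t ` colored A"
      using y(2)[OF *] ab by (subst colored_shift_iff[of z t b]) auto
    moreover have "z \<in> (+) s ` colored A"
      using y(2)[OF *] ab unfolding e by (subst colored_shift_iff[of z s a]) auto
    ultimately show False using z(3) by simp
  qed
  have same: "s = t" if st: "s \<in> T" "t \<in> T" and j: "j < m" and ab: "a \<in> A j" "b \<in> A j" "s + of_int a = t + of_int b" for s t j a b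
  proof (rule ccontr)
    assume "s \<noteq> t"
    obtain y1 y2 where y: "y1 < y2" "\<And>y. y \<in> {y1<..<y2} \<Longrightarrow> \<delta> < y \<and> y < 1 - \<delta> \<and> \<phi> y = j"
      using color_middle[OF j] by blast
    have "y1 + (t + of_int b) < y2 + (t + of_int b)" using y(1) by simp
    then obtain z where z: "y1 + (t + of_int b) < z" "z < y2 + (t + of_int b)" "z \<notin> (+) s ` colored A \<inter> (+) t ` colored A"
      by (rule ex_not_in_null_set[OF _ disj[OF st \<open>s \<noteq> t\<close>]])
    have *: "z - (t + of_int b) \<in> {y1<..<y2}" using z by auto
    then have I: "z - (t + of_int b) \<in> {0..<1}" using y(2)[OF *] delta_pos by auto
    have "z \<in> (+) t ` colored A" using y(2)[OF *] ab I by (subst colored_shift_iff[of z t b]) auto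
    moreover have "z \<in> (+) s ` colored A" using y(2)[OF *] ab I by (subst colored_shift_iff[of z s a]) auto
    ultimately show False using z(3) by simp
  qed
  have cell: "\<exists>t\<in>T. \<exists>a. y - (t + of_int a) \<in> {0..<1} \<and> a \<in> A (\<phi> (y - (t + of_int a)))" if y: "y \<notin> N" for y
  proof -
    obtain t where t: "t \<in> T" "y \<in> (+) t ` colored A" using y unfolding N_def by blast
    have I: "y - (t + of_int \<lfloor>y - t\<rfloor>) \<in> {0..<1}" by (auto simp: le_floor_iff) linarith+
    then show ?thesis using t colored_shift_iff[OF I, of A] by blast
  qed
  define D where "D j = {t + of_int a |t a. t \<in> T \<and> a \<in> A j}" for j
  \<comment> \<open>A middle point of colour \<open>j\<close> in the cell at \<open>c\<close> must
    be covered; the covering cell is displaced by less than \<open>1 - \<delta>\<close>, hence not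
    at all.\<close>
  have D_sub: "D i \<subseteq> D j" if ij: "i < m" "j < m" for i j
  proof
    fix c assume "c \<in> D i"
    then obtain s a where s: "s \<in> T" "a \<in> A i" "c = s + of_int a" by (auto simp: D_def)
    obtain y1 y2 where y: "y1 < y2" "\<And>y. y \<in> {y1<..<y2} \<Longrightarrow> \<delta> < y \<and> y < 1 - \<delta> \<and> \<phi> y = j"
      using color_middle[OF ij(2)] by blast
    have "y1 + c < y2 + c" using y(1) by simp
    then obtain z where z: "y1 + c < z" "z < y2 + c" "z \<notin> N" by (rule ex_not_in_null_set[OF _ N])
    have zc: "\<delta> < z - c" "z - c < 1 - \<delta>" "\<phi> (z - c) = j" using y(2)[of "z - c"] z by auto
    obtain t b where t: "t \<in> T" "z - (t + of_int b) \<in> {0..<1}" "b \<in> A (\<phi> (z - (t + of_int b)))"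
      using cell[OF z(3)] by blast
    have "(s + of_int a) - (t + of_int b) = 0"
    proof (rule ccontr)
      assume "(s + of_int a) - (t + of_int b) \<noteq> 0"
      then show False
        by (rule no_small[OF s(1) t(1) ij(1) color_less s(2) t(3)]) (use t(2) zc s(3) in auto)
    qed
    then have "c = t + of_int b" using s(3) by simp
    then show "c \<in> D j" using t zc(3) by (auto simp: D_def)
  qed
  have D_eq: "D j = D 0" if "j < m" for j using D_sub[OF that m] D_sub[OF m that] by blast
  \<comment> \<open>Offsets from \<open>1 - \<delta>\<close> up to 1 escape \<open>no_small\<close>.
    Here the left ends \<open>c\<close> and \<open>d\<close> are realised in every colour, so both
    full cells are covered, and their overlap meets distinct tiles: a nonintegral offset cannot
    occur inside one tile.\<close>
  have sep: "c + 1 \<le> d" if cd: "c \<in> D 0" "d \<in> D 0" "c < d" for c d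
  proof (rule ccontr)
    assume lt: "\<not> c + 1 \<le> d"
    have "\<forall>j\<in>{..<m}. \<exists>t a. t \<in> T \<and> a \<in> A j \<and> e = t + of_int a" if e: "e \<in> D 0" for e
    proof
      fix j assume "j \<in> {..<m}"
      then have "D j = D 0" by (intro D_eq) simp
      then have "e \<in> D j" using e by simp
      then show "\<exists>t a. t \<in> T \<and> a \<in> A j \<and> e = t + of_int a" unfolding D_def by blast
    qed
    note rep = this
    from bchoice[OF rep[OF cd(1)]] obtain s where s0: "\<forall>j\<in>{..<m}. \<exists>a. s j \<in> T \<and> a \<in> A j \<and> c = s j + of_int a" by auto
    from bchoice[OF s0] obtain a where s: "\<And>j. j < m \<Longrightarrow> s j \<in> T \<and> a j \<in> A j \<and> c = s j + of_int (a j)" by auto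
    from bchoice[OF rep[OF cd(2)]] obtain t where t0: "\<forall>j\<in>{..<m}. \<exists>a. t j \<in> T \<and> a \<in> A j \<and> d = t j + of_int a" by auto
    from bchoice[OF t0] obtain b where t: "\<And>j. j < m \<Longrightarrow> t j \<in> T \<and> b j \<in> A j \<and> d = t j + of_int (b j)" by auto
    have st: "s i \<noteq> t j" if "i < m" "j < m" for i j
    proof
      assume "s i = t j"
      then have "d - c = of_int (b j - a i)" using s[OF that(1)] t[OF that(2)] by simp
      then have "0 < (of_int (b j - a i) :: real)" "(of_int (b j - a i) :: real) < 1" using cd(3) lt by linarith+
      then have "0 < b j - a i" "b j - a i < 1" unfolding of_int_0_less_iff of_int_less_1_iff .
      then show False by simp
    qed
    define M where "M = (\<Union>i\<in>{..<m}. \<Union>j\<in>{..<m}. (+) (s i) ` colored A \<inter> (+) (t j) ` colored A)"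
    have "M \<in> null_sets lebesgue"
      unfolding M_def using s t st by (intro null_sets_UN' countable_finite disj) auto
    moreover have "d < c + 1" using lt by simp
    ultimately obtain z where z: "d < z" "z < c + 1" "z \<notin> M" using ex_not_in_null_set by blast
    define i where "i = \<phi> (z - c)"
    define j where "j = \<phi> (z - d)"
    have ij: "i < m" "j < m" by (simp_all add: i_def j_def color_less)
    have "z \<in> (+) (s i) ` colored A"
      using s[OF ij(1)] z cd(3) by (subst colored_shift_iff[of z "s i" "a i"]) (auto simp: i_def)
    moreover have "z \<in> (+) (t j) ` colored A"
      using t[OF ij(2)] z cd(3) by (subst colored_shift_iff[of z "t j" "b j"]) (auto simp: j_def)
    ultimately show False using z(3) ij by (auto simp: M_def)
  qed
  have cover: "\<exists>d\<in>D 0. d \<le> y \<and> y < d + 1" if y: "y \<notin> N" for y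
  proof -
    obtain t a where t: "t \<in> T" "y - (t + of_int a) \<in> {0..<1}" "a \<in> A (\<phi> (y - (t + of_int a)))"
      using cell[OF y] by blast
    have "t + of_int a \<in> D (\<phi> (y - (t + of_int a)))" using t by (auto simp: D_def)
    then have "t + of_int a \<in> D 0" using D_eq color_less by blast
    then show ?thesis using t(2) by (intro bexI[of _ "t + of_int a"]) auto
  qed
  obtain t0 where t0: "t0 \<in> T"
  proof -
    obtain z where "z \<notin> N" using ex_not_in_null_set[OF _ N, of 0 1] by auto
    then show ?thesis using cell that by blast
  qed
  obtain a0 where a0: "a0 \<in> A 0" using A[OF m] by auto
  have d0: "t0 + of_int a0 \<in> D 0" using t0 a0 by (auto simp: D_def)
  show ?thesis
  proof (intro exI[of _ "{k. t0 + of_int k \<in> T}"] allI impI)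
    fix j z assume j: "j < m"
    have "t0 + of_int a0 + of_int (z - a0) \<in> D 0" by (rule unit_cells[OF sep N cover d0])
    then have "t0 + of_int z \<in> D j" using D_eq[OF j] by (simp add: add.assoc)
    then obtain t a where t: "t \<in> T" "a \<in> A j" "t0 + of_int z = t + of_int a" by (auto simp: D_def)
    show "\<exists>!t. t \<in> {k. t0 + of_int k \<in> T} \<and> z - t \<in> A j"
    proof (rule ex1I[of _ "z - a"])
      have e: "t0 + of_int (z - a) = t" using t(3) by simp
      show "z - a \<in> {k. t0 + of_int k \<in> T} \<and> z - (z - a) \<in> A j"
        unfolding mem_Collect_eq e using t by simp
      fix k assume k: "k \<in> {k. t0 + of_int k \<in> T} \<and> z - k \<in> A j"
      have "t0 + of_int k = t"
        by (rule same[of _ _ j "z - k" a]) (use k t j in auto)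
      then show "k = z - a" using t(3) by simp
    qed
  qed
qed

end

section \<open>Universal tilings\<close>

text \<open>Finite families are enough because all fibres of a bounded set are subsets of one finite
  window.\<close>

definition universal_tiling :: bool
  where "universal_tiling \<longleftrightarrow> (\<forall>G \<A>. finite G \<longrightarrow> G \<noteq> {} \<longrightarrow> finite \<A> \<longrightarrow> (\<forall>A\<in>\<A>. dual_set G A) \<longrightarrow>
    (\<exists>T :: int set. \<forall>A\<in>\<A>. \<forall>z. \<exists>!t. t \<in> T \<and> z - t \<in> A))"

lemma universal_tilingD:
  assumes universal_tiling "finite G" "G \<noteq> {}" "finite \<A>" "\<forall>A\<in>\<A>. dual_set G A"
  shows "\<exists>T :: int set. \<forall>A\<in>\<A>. \<forall>z. \<exists>!t. t \<in> T \<and> z - t \<in> A"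
  by (rule assms(1)[unfolded universal_tiling_def, THEN spec[of _ G], THEN spec[of _ \<A>],
      THEN mp, OF assms(2), THEN mp, OF assms(3), THEN mp, OF assms(4), THEN mp, OF assms(5)])

lemma universal_tilingI:
  assumes "\<And>G n A. finite G \<Longrightarrow> G \<noteq> {} \<Longrightarrow> n > 0 \<Longrightarrow> (\<And>j :: nat. j < n \<Longrightarrow> dual_set G (A j)) \<Longrightarrow>
    \<exists>T :: int set. \<forall>j<n. \<forall>z. \<exists>!t. t \<in> T \<and> z - t \<in> A j"
  shows universal_tiling
  unfolding universal_tiling_def
proof (intro allI impI)
  fix G \<A> assume G: "finite G" "G \<noteq> {}" and A: "finite \<A>" "\<forall>A\<in>\<A>. dual_set G A"
  show "\<exists>T :: int set. \<forall>A\<in>\<A>. \<forall>z. \<exists>!t. t \<in> T \<and> z - t \<in> A"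
  proof (cases "\<A> = {}")
    case False
    obtain h where h: "bij_betw h {0..<card \<A>} \<A>" using ex_bij_betw_nat_finite[OF A(1)] by blast
    have d: "dual_set G (h j)" if "j < card \<A>" for j
      using bij_betwE[OF h] that A(2) by simp
    have c: "card \<A> > 0" using False A(1) by (simp add: card_gt_0_iff)
    have "\<exists>T :: int set. \<forall>j<card \<A>. \<forall>z. \<exists>!t. t \<in> T \<and> z - t \<in> h j"
      by (rule assms[OF G c]) (rule d)
    then obtain T :: "int set" where T: "\<forall>j<card \<A>. \<forall>z. \<exists>!t. t \<in> T \<and> z - t \<in> h j" by (elim exE)
    have uq: "\<exists>!t. t \<in> T \<and> z - t \<in> A" if "A \<in> \<A>" for A z
    proof -
      have "A \<in> h ` {0..<card \<A>}" using that unfolding bij_betw_imp_surj_on[OF h] .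
      then obtain j where "j < card \<A>" "A = h j" by auto
      then show ?thesis using T by simp
    qed
    show ?thesis by (intro exI[of _ T] ballI allI uq)
  qed simp
qed

lemma dual_set_finite: "dual_set G A \<Longrightarrow> finite A" and dual_set_card: "dual_set G A \<Longrightarrow> card A = card G"
  by (auto simp: dual_set_def)

section \<open>Integer tilings in terms of almost every point\<close>

lemma AE_lebesgueD: "AE x in lebesgue. P x \<Longrightarrow> \<exists>N. N \<in> null_sets lebesgue \<and> (\<forall>x. x \<notin> N \<longrightarrow> P x)"
  unfolding eventually_ae_filter by auto

lemma AE_translate:
  assumes "AE x in lebesgue. P x"
  shows "AE x in lebesgue. P (x - (a :: real))"
proof -
  obtain N where N: "N \<in> null_sets lebesgue" "\<forall>x. x \<notin> N \<longrightarrow> P x"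
    using AE_lebesgueD[OF assms] by (elim exE conjE)
  have "negligible ((+) a ` N)"
    using N(1) by (intro negligible_translation) (simp add: negligible_iff_null_sets)
  then have "AE x in lebesgue. x \<notin> (+) a ` N"
    by (intro AE_not_in) (simp add: negligible_iff_null_sets)
  then show ?thesis
  proof eventually_elim
    case (elim x)
    have "x - a \<notin> N"
    proof
      assume "x - a \<in> N"
      then have "x \<in> (+) a ` N" by (intro image_eqI[of _ _ "x - a"]) auto
      then show False using elim by simp
    qed
    then show ?case using N(2) by simp
  qed
qed

lemma AE_frac:
  assumes "AE x in lebesgue_on {0..<1::real}. P x"
  shows "AE x in lebesgue. P (frac x)"
proof -
  have "AE x in lebesgue. x \<in> {0..<1::real} \<longrightarrow> P x"
    using assms by (simp add: AE_restrict_space_iff)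
  then have "AE x in lebesgue. \<forall>k :: int. x - of_int k \<in> {0..<1::real} \<longrightarrow> P (x - of_int k)"
    unfolding AE_all_countable by (intro allI AE_translate)
  then show ?thesis
  proof eventually_elim
    case (elim x)
    then show ?case using frac_ge_0[of x] frac_lt_1[of x] by (auto simp: frac_def dest: spec[of _ "\<lfloor>x\<rfloor>"])
  qed
qed

lemma mem_translate_iff: "x \<in> (+) t ` S \<longleftrightarrow> x - t \<in> (S :: real set)"
  by (auto intro: image_eqI[of _ _ "x - t"])

text \<open>There are only countably many pairs of integer translates, so the null overlaps and the
  null complement unite to a single exceptional set.\<close>

lemma tiles_by_int_iff:
  "tiles_by S (of_int ` T) \<longleftrightarrow> (AE x in lebesgue. \<exists>!t. t \<in> T \<and> x - of_int t \<in> S)"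
proof
  assume *: "tiles_by S (of_int ` T)"
  have "AE x in lebesgue. \<forall>s t. s \<in> T \<and> t \<in> T \<and> s \<noteq> t \<longrightarrow> x \<notin> (+) (of_int s) ` S \<inter> (+) (of_int t) ` S"
    unfolding AE_all_countable
  proof (intro allI)
    fix s t
    show "AE x in lebesgue. s \<in> T \<and> t \<in> T \<and> s \<noteq> t \<longrightarrow> x \<notin> (+) (of_int s) ` S \<inter> (+) (of_int t) ` S"
    proof (cases "s \<in> T \<and> t \<in> T \<and> s \<noteq> t")
      case True
      then have "(+) (of_int s) ` S \<inter> (+) (of_int t) ` S \<in> null_sets lebesgue"
        using * unfolding tiles_by_def by (metis imageI of_int_eq_iff)
      then have "AE x in lebesgue. x \<notin> (+) (of_int s) ` S \<inter> (+) (of_int t) ` S" by (rule AE_not_in)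
      then show ?thesis by eventually_elim simp
    next
      case False
      then show ?thesis by (intro AE_I2) blast
    qed
  qed
  moreover have "AE x in lebesgue. x \<notin> UNIV - (\<Union>t\<in>of_int ` T. (+) t ` S)"
    using * unfolding tiles_by_def by (intro AE_not_in) blast
  ultimately show "AE x in lebesgue. \<exists>!t. t \<in> T \<and> x - of_int t \<in> S"
  proof eventually_elim
    case (elim x)
    from elim(2) obtain t where "t \<in> T" "x - of_int t \<in> S" by (auto simp: mem_translate_iff)
    moreover have "s = t" if "s \<in> T" "x - of_int s \<in> S" for s
      using elim(1) that \<open>t \<in> T\<close> \<open>x - of_int t \<in> S\<close> by (auto simp: mem_translate_iff)
    ultimately show ?case by blast
  qed
next
  assume "AE x in lebesgue. \<exists>!t. t \<in> T \<and> x - of_int t \<in> S"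
  from AE_lebesgueD[OF this]
  obtain N where N: "N \<in> null_sets lebesgue" "\<forall>x. x \<notin> N \<longrightarrow> (\<exists>!t. t \<in> T \<and> x - of_int t \<in> S)"
    by (elim exE conjE)
  have sub: "A \<in> null_sets lebesgue" if "A \<subseteq> N" for A
    using null_sets_completion_subset[OF that] N(1) by simp
  have "(+) s ` S \<inter> (+) t ` S \<in> null_sets lebesgue" if st: "s \<in> of_int ` T" "t \<in> of_int ` T" "s \<noteq> t" for s t
  proof (rule sub, rule subsetI, rule ccontr)
    fix x assume x: "x \<in> (+) s ` S \<inter> (+) t ` S" "x \<notin> N"
    obtain s' t' where "s' \<in> T" "t' \<in> T" "s = of_int s'" "t = of_int t'" using st(1,2) by auto
    then show False using N(2)[THEN spec, THEN mp, OF x(2)] x(1) st(3) by (auto simp: mem_translate_iff)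
  qed
  moreover have "UNIV - (\<Union>t\<in>of_int ` T. (+) t ` S) \<in> null_sets lebesgue"
  proof (rule sub, rule subsetI, rule ccontr)
    fix x assume x: "x \<in> UNIV - (\<Union>t\<in>of_int ` T. (+) t ` S)" "x \<notin> N"
    then show False using N(2)[THEN spec, THEN mp, OF x(2)] by (auto simp: mem_translate_iff)
  qed
  ultimately show "tiles_by S (of_int ` T)" unfolding tiles_by_def by blast
qed

section \<open>Normalisation and arithmetic of periods\<close>

lemma has_period_normalize:
  assumes "has_period L p"
  shows "p > 0" "has_period ((*) (1 / p) ` L) 1"
proof -
  show p: "p > 0" using assms by (simp add: has_period_def)
  show "has_period ((*) (1 / p) ` L) 1"
    using has_period_scale[of "1 / p" L p] assms p by simp
qed

text \<open>After the period is scaled to 1, a common complement of all possible fibres tiles almost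
  every fibre at once, hence the set; scaling back multiplies the integers by
  \<open>1 / p\<close>.\<close>

lemma universal_tiling_imp_tiles:
  assumes U: universal_tiling and S: "bounded S" and L: "is_spectrum S L" and p: "has_period L p"
  shows "\<exists>T. T \<subseteq> (*) (1 / p) ` \<int> \<and> tiles_by S T"
proof -
  define S' where "S' = (*) p ` S"
  define L' where "L' = (*) (1 / p) ` L"
  define G where "G = L' \<inter> {0..<1}"
  have p0: "p > 0" and per: "has_period L' 1" using has_period_normalize[OF p] by (simp_all add: L'_def)
  have L': "is_spectrum S' L'" unfolding S'_def L'_def by (rule spectrum_scale[OF p0 L])
  have S': "bounded S'"
    unfolding S'_def using bounded_scaling[OF S, of p] by simp
  obtain B0 where B0: "\<And>x. x \<in> S' \<Longrightarrow> \<bar>x\<bar> \<le> B0" using S' by (auto simp: bounded_iff)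
  obtain B :: nat where "B0 < real B" using reals_Archimedean2 by blast
  then have SB: "S' \<subseteq> {- real B..<real B}" using B0 by force
  note sp = spectrum_imp_dual_set[OF S' L' per, folded G_def]
  \<comment> \<open>All subsets of the window with dual spectrum \<open>G\<close>: a finite family
    that contains almost every fibre without reference to which ones occur.\<close>
  define \<A> where "\<A> = {A \<in> Pow {- int B..<int B}. dual_set G A}"
  have "finite \<A>" "\<forall>A\<in>\<A>. dual_set G A" by (auto simp: \<A>_def)
  from universal_tilingD[OF U sp(1,2) this]
  obtain T :: "int set" where T: "\<forall>A\<in>\<A>. \<forall>z. \<exists>!t. t \<in> T \<and> z - t \<in> A" by (elim exE)
  have "AE x in lebesgue. dual_set G (pat S' (frac x))" by (rule AE_frac[OF sp(4)])
  then have "AE x in lebesgue. \<exists>!t. t \<in> T \<and> x - of_int t \<in> S'"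
  proof eventually_elim
    case (elim x)
    have "frac x \<in> {0..<1}" using frac_ge_0[of x] frac_lt_1[of x] by simp
    then have "pat S' (frac x) \<in> \<A>" using elim pat_subset[OF SB] by (simp add: \<A>_def)
    from T[rule_format, OF this, of "\<lfloor>x\<rfloor>"] show ?case by (simp add: pat_def frac_def)
  qed
  then have "tiles_by S' (of_int ` T)" by (simp add: tiles_by_int_iff)
  then have "tiles_by ((*) (1 / p) ` S') ((*) (1 / p) ` of_int ` T)"
    using p0 by (intro tiles_by_scale) auto
  moreover have "(*) (1 / p) ` S' = S" unfolding S'_def scale_scale using p0 by simp
  ultimately show ?thesis
    by (intro exI[of _ "(*) (1 / p) ` of_int ` T"]) auto
qed

text \<open>After normalisation the measure of the dilated set equals the number of points of the
  spectrum in a unit interval.\<close>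

lemma period_measure_nat:
  assumes S: "bounded S" and L: "is_spectrum S L" and p: "has_period L p"
  obtains c :: nat where "c > 0" "p * measure lebesgue S = c"
proof -
  have p0: "p > 0" and per: "has_period ((*) (1 / p) ` L) 1" using has_period_normalize[OF p] .
  have L': "is_spectrum ((*) p ` S) ((*) (1 / p) ` L)" by (rule spectrum_scale[OF p0 L])
  have S': "bounded ((*) p ` S)" using bounded_scaling[OF S, of p] by simp
  have m: "S \<in> lmeasurable" using L by (simp add: is_spectrum_iff)
  show ?thesis
    using that[of "card ((*) (1 / p) ` L \<inter> {0..<1})"] spectrum_imp_dual_set(1-3)[OF S' L' per]
      lmeasurable_scale(2)[OF p0 m] by (simp add: card_gt_0_iff)
qed

lemma has_period_diff:
  assumes p: "has_period L p" and q: "has_period L q" and pos: "p - of_int k * q > 0"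
  shows "has_period L (p - of_int k * q)"
proof -
  have up: "x + (p - of_int k * q) \<in> L" if "x \<in> L" for x
    using has_period_of_int[OF q has_period_of_int[OF p that, of 1], of "- k"] by (simp add: algebra_simps)
  have down: "x - (p - of_int k * q) \<in> L" if "x \<in> L" for x
    using has_period_of_int[OF q has_period_of_int[OF p that, of "- 1"], of k] by (simp add: algebra_simps)
  have "(+) (p - of_int k * q) ` L = L"
  proof (intro equalityI subsetI)
    fix x assume "x \<in> L"
    then show "x \<in> (+) (p - of_int k * q) ` L"
      using down[of x] by (simp add: mem_translate_iff)
  next
    fix x assume "x \<in> (+) (p - of_int k * q) ` L"
    then have "x - (p - of_int k * q) \<in> L" by (simp only: mem_translate_iff)
    then show "x \<in> L" using up by fastforce
  qed
  then show ?thesis using pos by (simp add: has_period_def)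
qed

text \<open>Division with remainder: a nonzero remainder would be a smaller period.\<close>

lemma period_multiple_of_minimal:
  assumes q: "has_minimal_period L q" and p: "has_period L p"
  obtains k :: int where "p = of_int k * q"
proof -
  have q': "has_period L q" "\<And>r. has_period L r \<Longrightarrow> q \<le> r" using q by (auto simp: has_minimal_period_def)
  have q0: "q > 0" using q' by (simp add: has_period_def)
  define k where "k = \<lfloor>p / q\<rfloor>"
  have "of_int k \<le> p / q" "p / q < of_int k + 1" unfolding k_def by linarith+
  then have k: "of_int k * q \<le> p" "p - of_int k * q < q" using q0 by (simp_all add: field_simps)
  have "\<not> p - of_int k * q > 0"
  proof
    assume "p - of_int k * q > 0"
    then have "q \<le> p - of_int k * q" by (intro q'(2) has_period_diff p q'(1))
    then show False using k by simp
  qed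
  then show ?thesis using that[of k] k by simp
qed

text \<open>All periods are natural multiples of \<open>1 / measure lebesgue S\<close>, so the least
  one exists by well-ordering.\<close>

lemma minimal_period_exists:
  assumes S: "bounded S" and L: "is_spectrum S L" and p: "has_period L p"
  obtains c :: nat where "c > 0" "has_minimal_period L (c / measure lebesgue S)"
proof -
  define V where "V = measure lebesgue S"
  have V: "V > 0" using L by (simp add: is_spectrum_iff V_def)
  define P where "P c \<longleftrightarrow> c > 0 \<and> has_period L (real c / V)" for c :: nat
  have ex: "\<exists>c. P c \<and> q = real c / V" if "has_period L q" for q
    using period_measure_nat[OF S L that] V that by (metis P_def V_def nonzero_eq_divide_eq less_irrefl)
  define c where "c = (LEAST c. P c)"
  have c: "P c" unfolding c_def using ex[OF p] by (metis LeastI)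
  have "real c / V \<le> q" if q: "has_period L q" for q
  proof -
    obtain b where "P b" "q = real b / V" using ex[OF q] by blast
    then show ?thesis using V Least_le[of P b] by (simp add: c_def divide_right_mono)
  qed
  then have "has_minimal_period L (real c / V)" using c by (simp add: has_minimal_period_def P_def)
  then show ?thesis using that[of c] c by (simp add: P_def V_def)
qed

section \<open>Unions of intervals\<close>

lemma finite_interval_unionI:
  assumes P: "finite P" and ab: "\<And>p. p \<in> P \<Longrightarrow> a p \<in> K \<and> b p \<in> K \<and> a p < b p"
  shows "finite_interval_union K (\<Union>p\<in>P. {a p<..<b p})"
proof -
  obtain h where h: "bij_betw h {1..card P} P" using ex_bij_betw_nat_finite_1[OF P] by blast
  have "(\<Union>p\<in>h ` {1..card P}. {a p<..<b p}) = (\<Union>i\<in>{1..card P}. {a (h i)<..<b (h i)})"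
    by simp
  then have "(\<Union>p\<in>P. {a p<..<b p}) = (\<Union>i\<in>{1..card P}. {a (h i)<..<b (h i)})"
    unfolding bij_betw_imp_surj_on[OF h] .
  moreover have "\<forall>i\<in>{1..card P}. a (h i) \<in> K \<and> b (h i) \<in> K \<and> a (h i) < b (h i)"
    using ab bij_betwE[OF h] by blast
  ultimately show ?thesis
    unfolding finite_interval_union_def
    by (intro exI[of _ "card P"] exI[of _ "\<lambda>i. a (h i)"] exI[of _ "\<lambda>i. b (h i)"]) simp
qed

lemma finite_interval_union_bounded: "finite_interval_union K S \<Longrightarrow> bounded S"
  by (auto simp: finite_interval_union_def intro!: bounded_UN)

text \<open>The gluing for the partition of the unit interval into \<open>n\<close> equal parts:
  over the \<open>j\<close>-th part the fibre is \<open>A j\<close>. Open intervals match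
  \<open>finite_interval_union\<close>; the omitted endpoints are null.\<close>

definition pieces :: "nat \<Rightarrow> (nat \<Rightarrow> int set) \<Rightarrow> real set"
  where "pieces n A = (\<Union>(j, a)\<in>Sigma {..<n} A. {of_int a + real j / real n<..<of_int a + (real j + 1) / real n})"

lemma mem_pieces_iff:
  assumes n: "n > 0" and j: "j < n" and x: "real j / real n < x" "x < (real j + 1) / real n"
  shows "x + of_int k \<in> pieces n A \<longleftrightarrow> k \<in> A j"
proof
  assume "k \<in> A j"
  then show "x + of_int k \<in> pieces n A"
    unfolding pieces_def using j x by (intro UN_I[of "(j, k)"]) auto
next
  assume "x + of_int k \<in> pieces n A"
  then obtain i a where ia: "i < n" "a \<in> A i" "of_int a + real i / real n < x + of_int k" "x + of_int k < of_int a + (real i + 1) / real n"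
    by (auto simp: pieces_def)
  have x01: "0 < x" "x < 1"
  proof -
    have "0 \<le> real j / real n" "(real j + 1) / real n \<le> 1" using j by (auto simp: field_simps)
    then show "0 < x" "x < 1" using x by linarith+
  qed
  have i01: "0 \<le> real i / real n" "(real i + 1) / real n \<le> 1" using ia(1) by (auto simp: field_simps)
  have "of_int a < (of_int (k + 1) :: real)" "of_int k < (of_int (a + 1) :: real)" 
    using x01 i01 ia(3,4) unfolding of_int_add of_int_1 by linarith+
  then have ak: "a = k" unfolding of_int_less_iff by simp
  have "real i / real n < (real j + 1) / real n" "real j / real n < (real i + 1) / real n" using ia x ak by simp_all
  then have "real i < real j + 1" "real j < real i + 1" using n by (simp_all add: divide_less_cancel)
  then have "i = j" by linarith
  then show "k \<in> A j" using ia ak by simp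
qed

lemma pat_pieces:
  assumes "n > 0" "j < n" "real j / real n < x" "x < (real j + 1) / real n"
  shows "pat (pieces n A) x = A j"
  using mem_pieces_iff[OF assms] by (simp add: pat_def)

lemma pieces_interval_union:
  assumes n: "n > 0" and c: "c > 0" and A: "\<And>j. j < n \<Longrightarrow> finite (A j)"
    and K: "\<And>a j. c * (of_int a + real j / real n) \<in> K"
  shows "finite_interval_union K ((*) c ` pieces n A)"
proof -
  have "x \<in> (*) c ` {u<..<v} \<longleftrightarrow> x \<in> {c * u<..<c * v}" for u v x :: real
    using c by (subst mem_scale_iff') (auto simp: field_simps)
  then have sc: "(*) c ` {u<..<v} = {c * u<..<c * v}" for u v :: real by blast
  have eq: "(*) c ` pieces n A = (\<Union>p\<in>Sigma {..<n} A. {c * (of_int (snd p) + real (fst p) / real n)<..<c * (of_int (snd p) + real (Suc (fst p)) / real n)})"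
    unfolding pieces_def image_UN by (intro SUP_cong refl) (auto simp: sc add.commute split: prod.split)
  show ?thesis
    unfolding eq
  proof (rule finite_interval_unionI)
    show "finite (Sigma {..<n} A)" using A by auto
    fix p :: "nat \<times> int"
    show "c * (of_int (snd p) + real (fst p) / real n) \<in> K \<and> c * (of_int (snd p) + real (Suc (fst p)) / real n) \<in> K \<and>
      c * (of_int (snd p) + real (fst p) / real n) < c * (of_int (snd p) + real (Suc (fst p)) / real n)"
      using c n K[of "snd p" "fst p"] K[of "snd p" "Suc (fst p)"] by (auto intro: divide_strict_right_mono)
  qed
qed

lemma pieces_spectrum:
  assumes n: "n > 0" and G: "finite G" "G \<noteq> {}" and A: "\<And>j. j < n \<Longrightarrow> dual_set G (A j)"
  shows "is_spectrum (pieces n A) {g + of_int k |g k. g \<in> G}" "measure lebesgue (pieces n A) = card G"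
    "bounded (pieces n A)" "has_period {g + of_int k |g k. g \<in> G} 1"
proof -
  have U: "finite_interval_union UNIV ((*) 1 ` pieces n A)"
    by (rule pieces_interval_union[OF n]) (use A dual_set_finite in auto)
  then show b: "bounded (pieces n A)" by (simp add: finite_interval_union_bounded)
  have "open (pieces n A)" unfolding pieces_def by (auto intro!: open_UN)
  then have s: "pieces n A \<in> sets lebesgue" by simp
  define N where "N = (\<lambda>j. real j / real n) ` {..n}"
  have "N \<in> null_sets lebesgue"
    by (intro null_sets_completionI finite_imp_null_set_lborel) (simp add: N_def)
  then have "AE x in lebesgue. x \<notin> N" by (rule AE_not_in)
  then have "AE x in lebesgue_on {0..<1}. dual_set G (pat (pieces n A) x)"
    unfolding AE_restrict_space_iff[of "{0..<1::real}" lebesgue, simplified]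
  proof eventually_elim
    case (elim x)
    have "dual_set G (pat (pieces n A) x)" if x: "0 \<le> x" "x < 1"
    proof -
      define j where "j = nat \<lfloor>real n * x\<rfloor>"
      have j: "real j \<le> real n * x" "real n * x < real j + 1" using x by (auto simp: j_def of_nat_nat)
      have "real j < real n"
      proof -
        have "real n * x < real n * 1" using n x by (intro mult_strict_left_mono) auto
        then show ?thesis using j by simp
      qed
      then have jn: "j < n" by simp
      then have "x \<noteq> real j / real n" using elim by (auto simp: N_def)
      moreover have le: "real j / real n \<le> x" "x < (real j + 1) / real n"
        using j n by (simp_all add: field_simps)
      ultimately have "real j / real n < x" by simp
      with le(2) show ?thesis using pat_pieces[OF n jn] A[OF jn] by simp
    qed
    then show ?case by simp
  qed
  from dual_set_imp_spectrum[OF b s G this]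
  show "is_spectrum (pieces n A) {g + of_int k |g k. g \<in> G}" "measure lebesgue (pieces n A) = card G" .
  have "(+) 1 ` {g + of_int k |g k. g \<in> G} = {g + of_int k :: real |g k. g \<in> G}"
  proof (intro equalityI subsetI)
    fix x :: real assume "x \<in> (+) 1 ` {g + of_int k |g k. g \<in> G}"
    then obtain g k where "g \<in> G" "x = g + of_int (k + 1)" by auto
    then show "x \<in> {g + of_int k |g k. g \<in> G}" by blast
  next
    fix x :: real assume "x \<in> {g + of_int k |g k. g \<in> G}"
    then obtain g k where "g \<in> G" "x - 1 = g + of_int (k - 1)" by auto
    then show "x \<in> (+) 1 ` {g + of_int k |g k. g \<in> G}" unfolding mem_translate_iff by blast
  qed
  then show "has_period {g + of_int k |g k. g \<in> G} 1" by (simp add: has_period_def)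
qed

text \<open>One non-exceptional point in each subinterval reveals its fibre. The null set is made to
  serve all integer translates simultaneously, so the same point tests every integer
  \<open>z\<close>.\<close>

lemma pieces_tiling:
  assumes n: "n > 0" and T: "tiles_by (pieces n A) T" "T \<subseteq> \<int>"
  shows "\<exists>T0 :: int set. \<forall>j<n. \<forall>z. \<exists>!t. t \<in> T0 \<and> z - t \<in> A j"
proof -
  define T0 where "T0 = {k. of_int k \<in> T}"
  have "T = of_int ` T0" using T(2) by (auto simp: T0_def elim!: Ints_cases)
  then have "AE x in lebesgue. \<exists>!t. t \<in> T0 \<and> x - of_int t \<in> pieces n A"
    using T(1) tiles_by_int_iff by simp
  then have "AE x in lebesgue. \<forall>z. \<exists>!t. t \<in> T0 \<and> x - of_int z - of_int t \<in> pieces n A"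
    unfolding AE_all_countable by (intro allI AE_translate)
  from AE_lebesgueD[OF this]
  obtain N where N: "\<forall>x. x \<notin> N \<longrightarrow> (\<forall>z. \<exists>!t. t \<in> T0 \<and> x - of_int z - of_int t \<in> pieces n A)"
      "N \<in> null_sets lebesgue"
    by (elim exE conjE)
  have uq: "\<exists>!t. t \<in> T0 \<and> z - t \<in> A j" if j: "j < n" for j z
  proof -
    have "real j / real n < (real j + 1) / real n" using n by (intro divide_strict_right_mono) auto
    then obtain x where x: "real j / real n < x" "x < (real j + 1) / real n" "x \<notin> N"
      by (rule ex_not_in_null_set[OF _ N(2)])
    have "x - of_int (- z) - of_int t \<in> pieces n A \<longleftrightarrow> z - t \<in> A j" for t
      using mem_pieces_iff[OF n j x(1,2), of "z - t" A] by (simp add: algebra_simps)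
    then show ?thesis using N(1)[THEN spec, THEN mp, OF x(3), THEN spec, of "- z"] by simp
  qed
  show ?thesis by (intro exI[of _ T0] allI impI uq)
qed

text \<open>The transform is that of the unit interval times a trigonometric polynomial of period 1
  in the frequency, so its nonzero zeros are stable under integer shifts. An integer translate
  missing from \<open>L\<close> would be orthogonal to all of \<open>L\<close>, against
  completeness.\<close>

lemma integer_interval_union_period:
  assumes S: "finite_interval_union \<int> S" and L: "is_spectrum S L"
  shows "has_period L 1"
proof -
  have b: "bounded S" by (rule finite_interval_union_bounded[OF S])
  obtain n :: nat and \<alpha> \<beta> where ab: "\<And>i. i \<in> {1..n} \<Longrightarrow> \<alpha> i \<in> \<int> \<and> \<beta> i \<in> \<int>" and
    S_eq: "S = (\<Union>i\<in>{1..n}. {\<alpha> i<..<\<beta> i})"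
    using S unfolding finite_interval_union_def by blast
  define A where "A = {k :: int. \<exists>i\<in>{1..n}. \<alpha> i \<le> of_int k \<and> of_int k + 1 \<le> \<beta> i}"
  have pat: "pat S x = A" if x: "0 < x" "x < 1" for x
  proof -
    have "x + of_int k \<in> {\<alpha> i<..<\<beta> i} \<longleftrightarrow> \<alpha> i \<le> of_int k \<and> of_int k + 1 \<le> \<beta> i" if i: "i \<in> {1..n}" for i k
    proof -
      obtain a b where "\<alpha> i = of_int a" "\<beta> i = of_int b" using ab[OF i] by (auto elim!: Ints_cases)
      moreover have "of_int a < x + of_int k \<longleftrightarrow> a \<le> k" using x by linarith
      moreover have "x + of_int k < of_int b \<longleftrightarrow> k + 1 \<le> b" using x by linarith
      moreover have "(of_int k + 1 \<le> (of_int b :: real)) \<longleftrightarrow> k + 1 \<le> b" by linarith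
      ultimately show ?thesis by simp
    qed
    then show ?thesis by (auto simp: pat_def S_eq A_def)
  qed
  have m: "S \<in> sets lebesgue" "hat_orth S L" "measure lebesgue S > 0" "S \<in> lmeasurable" using L by (auto simp: is_spectrum_iff)
  obtain B0 where B0: "\<And>x. x \<in> S \<Longrightarrow> \<bar>x\<bar> \<le> B0" using b by (auto simp: bounded_iff)
  obtain B :: nat where "B0 < real B" using reals_Archimedean2 by blast
  then have SB: "S \<subseteq> {- real B..<real B}" using B0 by force
  have hat: "hat S l = hat {0..<1} l * (\<Sum>k\<in>A. exp_char l (of_int k))" for l
  proof -
    have s: "integrable (lebesgue_on {0..<1}) (\<lambda>x. \<Sum>k\<in>pat S x. exp_char l (x + of_int k))"
      by (rule integrable_fibre_sum[OF m(1) SB integrable_exp_char[OF m(4)]])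
    have "hat S l = (LINT x|lebesgue_on {0..<1}. (\<Sum>k\<in>pat S x. exp_char l (x + of_int k)))"
      unfolding hat_def by (rule integral_fibre_sum[OF m(1) SB integrable_exp_char[OF m(4)]])
    also have "\<dots> = (LINT x|lebesgue_on {0..<1}. exp_char l x * (\<Sum>k\<in>A. exp_char l (of_int k)))"
    proof (rule integral_cong_AE)
      show "(\<lambda>x. \<Sum>k\<in>pat S x. exp_char l (x + of_int k)) \<in> borel_measurable (lebesgue_on {0..<1})" using s by auto
      have "AE x in lebesgue. x \<notin> {0::real}" by (intro AE_not_in) auto
      then show "AE x in lebesgue_on {0..<1}. (\<Sum>k\<in>pat S x. exp_char l (x + of_int k)) = exp_char l x * (\<Sum>k\<in>A. exp_char l (of_int k))"
        unfolding AE_restrict_space_iff[of "{0..<1::real}" lebesgue, simplified]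
        by eventually_elim (auto simp: pat exp_char_add_right sum_distrib_left)
    qed simp
    finally show ?thesis by (simp add: hat_def)
  qed
  have hat_shift: "hat S (l + of_int n) = 0" if l: "l \<noteq> 0" "hat S l = 0" "l + of_int n \<noteq> 0" for l n
  proof (cases "hat {0..<1} l = 0")
    case True
    then have "l + of_int n \<in> \<int>" by (simp add: hat_unit_interval_eq_0_iff)
    then have "hat {0..<1} (l + of_int n) = 0" using l(3) by (simp add: hat_unit_interval_eq_0_iff)
    then show ?thesis by (simp add: hat)
  next
    case False
    then have "(\<Sum>k\<in>A. exp_char l (of_int k)) = 0" using l(2) by (simp add: hat)
    then have "(\<Sum>k\<in>A. exp_char (l + of_int n) (of_int k)) = 0" by (simp add: exp_char_add)
    then show ?thesis by (simp add: hat)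
  qed
  have shift: "l + of_int n \<in> L" if l: "l \<in> L" for l n
  proof (rule ccontr)
    assume not: "l + of_int n \<notin> L"
    have zero: "hat S (l + of_int n - \<mu>) = 0" if \<mu>: "\<mu> \<in> L" for \<mu>
    proof (cases "\<mu> = l")
      case True
      have "n \<noteq> 0" using not l by auto
      then have "hat {0..<1} (of_int n) = 0" by (simp add: hat_unit_interval_eq_0_iff)
      then show ?thesis using True by (simp add: hat)
    next
      case False
      then have "hat S (l - \<mu>) = 0" using m(2) l \<mu> by (auto simp: hat_orth_def)
      then have "hat S (l - \<mu> + of_int n) = 0" using False not \<mu> by (intro hat_shift) (auto simp: algebra_simps)
      then show ?thesis by (simp add: algebra_simps)
    qed
    obtain F where F: "F \<subseteq> L" "(LINT x|lebesgue_on S. (cmod (exp_char (l + of_int n) x))\<^sup>2) - measure lebesgue S / 2 <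
        (\<Sum>\<mu>\<in>F. (cmod (ip (lebesgue_on S) (exp_char (l + of_int n)) (exp_char \<mu>)))\<^sup>2) / measure lebesgue S"
      by (rule spectrum_parseval[OF L sqint_exp_char[OF m(4), of "l + of_int n"] half_gt_zero[OF m(3)]])
    have "(\<Sum>\<mu>\<in>F. (cmod (ip (lebesgue_on S) (exp_char (l + of_int n)) (exp_char \<mu>)))\<^sup>2) = 0"
      using F(1) zero by (intro sum.neutral) (auto simp: ip_exp_char)
    then show False using F(2)[unfolded integral_exp_char_squared[OF m(4)]] m(3) by simp
  qed
  have "(+) 1 ` L = L"
  proof (intro equalityI subsetI)
    fix x assume "x \<in> (+) 1 ` L"
    then show "x \<in> L" using shift[of "x - 1" 1] by (simp add: mem_translate_iff)
  next
    fix x assume "x \<in> L"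
    then show "x \<in> (+) 1 ` L" using shift[of x "- 1"] by (simp add: mem_translate_iff)
  qed
  then show ?thesis by (simp add: has_period_def)
qed

theorem theorem1p6:
  shows "let
      S1 = (\<forall>(\<Omega>::real set) (\<Lambda>::real set) (p::real).
              finite_interval_union \<rat> \<Omega> \<longrightarrow> measure lebesgue \<Omega> = 1 \<longrightarrow>
              is_spectrum \<Omega> \<Lambda> \<longrightarrow> has_period \<Lambda> p \<longrightarrow>
              (\<exists>T. T \<subseteq> (*) (1 / p) ` \<int> \<and> tiles_by \<Omega> T));
      S2 = (\<forall>(\<Omega>::real set) (\<Lambda>::real set) (N::nat) (r::int).
              finite_interval_union \<int> \<Omega> \<longrightarrow> measure lebesgue \<Omega> = real N \<longrightarrow>
              is_spectrum \<Omega> \<Lambda> \<longrightarrow> has_minimal_period \<Lambda> (real_of_int r / real N) \<longrightarrow>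
              real N / real_of_int r \<in> \<int> \<and>
              (\<exists>T. T \<subseteq> (*) (real N / real_of_int r) ` \<int> \<and> tiles_by \<Omega> T));
      S3 = (\<forall>\<Omega>::real set. bounded \<Omega> \<longrightarrow> spectral \<Omega> \<longrightarrow> (\<exists>T. tiles_by \<Omega> T))
    in (S1 \<longleftrightarrow> S2) \<and> (S2 \<longleftrightarrow> S3)"
proof -
  define S1 where "S1 \<longleftrightarrow> (\<forall>(\<Omega>::real set) (\<Lambda>::real set) (p::real).
              finite_interval_union \<rat> \<Omega> \<longrightarrow> measure lebesgue \<Omega> = 1 \<longrightarrow>
              is_spectrum \<Omega> \<Lambda> \<longrightarrow> has_period \<Lambda> p \<longrightarrow>
              (\<exists>T. T \<subseteq> (*) (1 / p) ` \<int> \<and> tiles_by \<Omega> T))"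
  define S2 where "S2 \<longleftrightarrow> (\<forall>(\<Omega>::real set) (\<Lambda>::real set) (N::nat) (r::int).
              finite_interval_union \<int> \<Omega> \<longrightarrow> measure lebesgue \<Omega> = real N \<longrightarrow>
              is_spectrum \<Omega> \<Lambda> \<longrightarrow> has_minimal_period \<Lambda> (real_of_int r / real N) \<longrightarrow>
              real N / real_of_int r \<in> \<int> \<and>
              (\<exists>T. T \<subseteq> (*) (real N / real_of_int r) ` \<int> \<and> tiles_by \<Omega> T))"
  define S3 where "S3 \<longleftrightarrow> (\<forall>\<Omega>::real set. bounded \<Omega> \<longrightarrow> spectral \<Omega> \<longrightarrow> (\<exists>T. tiles_by \<Omega> T))"
  have U1: S1 if universal_tiling
    unfolding S1_def using universal_tiling_imp_tiles[OF that] finite_interval_union_bounded by blast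
  have U2: S2 if universal_tiling
    unfolding S2_def
  proof (intro allI impI conjI)
    fix \<Omega> \<Lambda> :: "real set" and N :: nat and r :: int
    assume \<Omega>: "finite_interval_union \<int> \<Omega>" "is_spectrum \<Omega> \<Lambda>" and min: "has_minimal_period \<Lambda> (real_of_int r / real N)"
    then have per: "has_period \<Lambda> (real_of_int r / real N)" by (simp add: has_minimal_period_def)
    \<comment> \<open>Integer endpoints make 1 a period, hence an integer multiple of the minimal
      period; the multiplier is the required integer \<open>N / r\<close>.\<close>
    obtain k :: int where k: "1 = of_int k * (real_of_int r / real N)"
      by (rule period_multiple_of_minimal[OF min integer_interval_union_period[OF \<Omega>]])
    have "real_of_int r / real N \<noteq> 0" using k by auto
    then have "real N / real_of_int r = of_int k" using k by (simp add: field_simps)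
    then show "real N / real_of_int r \<in> \<int>" by simp
    have "1 / (real_of_int r / real N) = real N / real_of_int r" by simp
    then show "\<exists>T. T \<subseteq> (*) (real N / real_of_int r) ` \<int> \<and> tiles_by \<Omega> T"
      using universal_tiling_imp_tiles[OF that finite_interval_union_bounded[OF \<Omega>(1)] \<Omega>(2) per] by simp
  qed
  have U3: S3 if universal_tiling
    unfolding S3_def
  proof (intro allI impI)
    fix \<Omega> :: "real set" assume b: "bounded \<Omega>" and "spectral \<Omega>"
    then obtain \<Lambda> where L: "is_spectrum \<Omega> \<Lambda>" by (auto simp: spectral_def)
    obtain p where "has_period \<Lambda> p" by (rule spectrum_has_period[OF b L])
    then show "\<exists>T. tiles_by \<Omega> T" using universal_tiling_imp_tiles[OF that b L] by blast
  qed
  \<comment> \<open>Contracting the glued set by \<open>card G\<close> gives measure 1 and rational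
    endpoints, and turns the period 1 into \<open>card G\<close>. The translates then lie in a
    lattice that scales back to the integers.\<close>
  have 1: universal_tiling if S1
  proof (rule universal_tilingI)
    fix G n and A :: "nat \<Rightarrow> int set"
    assume G: "finite G" "G \<noteq> {}" and n: "n > 0" and A: "\<And>j. j < n \<Longrightarrow> dual_set G (A j)"
    define L where "L = {g + of_int k |g k. g \<in> G}"
    define r where "r = real (card G)"
    have r: "r > 0" using G by (simp add: r_def card_gt_0_iff)
    note sp = pieces_spectrum[OF n G A, folded L_def]
    have "finite_interval_union \<rat> ((*) (1 / r) ` pieces n A)"
      using r by (intro pieces_interval_union[OF n]) (auto simp: r_def intro: A dual_set_finite)
    moreover have "measure lebesgue ((*) (1 / r) ` pieces n A) = 1"
      using lmeasurable_scale(2)[of "1 / r" "pieces n A"] sp(1,2) r by (simp add: r_def is_spectrum_iff)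
    moreover have "is_spectrum ((*) (1 / r) ` pieces n A) ((*) r ` L)"
      using spectrum_scale[of "1 / r", OF _ sp(1)] r by simp
    moreover have "has_period ((*) r ` L) r"
      using has_period_scale[OF r sp(4)] by simp
    ultimately obtain T where T: "T \<subseteq> (*) (1 / r) ` \<int>" "tiles_by ((*) (1 / r) ` pieces n A) T"
      using \<open>S1\<close> unfolding S1_def by blast
    have "tiles_by ((*) r ` (*) (1 / r) ` pieces n A) ((*) r ` T)" by (rule tiles_by_scale[OF r T(2)])
    then have "tiles_by (pieces n A) ((*) r ` T)" unfolding scale_scale[of r "1 / r"] using r by simp
    moreover have "(*) r ` T \<subseteq> \<int>" using T(1) r by auto
    ultimately show "\<exists>T :: int set. \<forall>j<n. \<forall>z. \<exists>!t. t \<in> T \<and> z - t \<in> A j" by (rule pieces_tiling[OF n])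
  qed
  \<comment> \<open>Dilating by \<open>n\<close> makes the endpoints integers and turns the period 1
    into \<open>1 / n\<close>. The minimal period may be smaller, but it divides
    \<open>1 / n\<close>, so the translates are multiples of \<open>n\<close> and remain integers
    after scaling back.\<close>
  have 2: universal_tiling if S2
  proof (rule universal_tilingI)
    fix G n and A :: "nat \<Rightarrow> int set"
    assume G: "finite G" "G \<noteq> {}" and n: "n > 0" and A: "\<And>j. j < n \<Longrightarrow> dual_set G (A j)"
    define L where "L = {g + of_int k |g k. g \<in> G}"
    note sp = pieces_spectrum[OF n G A, folded L_def]
    define \<Omega> where "\<Omega> = (*) (real n) ` pieces n A"
    define N where "N = n * card G"
    have n0: "real n > 0" using n by simp
    have N: "N > 0" using n G by (simp add: N_def card_gt_0_iff)
    have \<Omega>: "finite_interval_union \<int> \<Omega>"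
      unfolding \<Omega>_def
    proof (rule pieces_interval_union[OF n n0])
      show "finite (A j)" if "j < n" for j using A[OF that] by (rule dual_set_finite)
      fix a :: int and j :: nat
      have "real n * (of_int a + real j / real n) = of_int (int n * a + int j)"
        using n by (simp add: distrib_left)
      then show "real n * (of_int a + real j / real n) \<in> \<int>" by (metis Ints_of_int)
    qed
    have meas: "measure lebesgue \<Omega> = real N"
      using lmeasurable_scale(2)[OF n0, of "pieces n A"] sp(1,2) by (simp add: \<Omega>_def N_def is_spectrum_iff)
    have L: "is_spectrum \<Omega> ((*) (1 / real n) ` L)"
      unfolding \<Omega>_def by (rule spectrum_scale[OF n0 sp(1)])
    have per: "has_period ((*) (1 / real n) ` L) (1 / real n)"
      using has_period_scale[of "1 / real n", OF _ sp(4)] n by simp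
    obtain c :: nat where c: "c > 0" "has_minimal_period ((*) (1 / real n) ` L) (real c / real N)"
      using minimal_period_exists[OF finite_interval_union_bounded[OF \<Omega>] L per] unfolding meas by blast
    then have "has_minimal_period ((*) (1 / real n) ` L) (real_of_int (int c) / real N)" by simp
    from \<open>S2\<close>[unfolded S2_def, rule_format, OF \<Omega> meas L this]
    obtain T where T: "T \<subseteq> (*) (real N / real c) ` \<int>" "tiles_by \<Omega> T" by auto
    obtain k :: int where k: "1 / real n = of_int k * (real c / real N)"
      by (rule period_multiple_of_minimal[OF c(2) per])
    then have Nc: "real N / real c = real n * of_int k" using n N c by (simp add: field_simps)
    have "tiles_by ((*) (1 / real n) ` \<Omega>) ((*) (1 / real n) ` T)" using n by (intro tiles_by_scale[OF _ T(2)]) simp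
    then have "tiles_by (pieces n A) ((*) (1 / real n) ` T)"
      unfolding \<Omega>_def scale_scale[of "1 / real n" "real n"] using n by simp
    moreover have "(*) (1 / real n) ` T \<subseteq> \<int>"
    proof
      fix x assume "x \<in> (*) (1 / real n) ` T"
      then obtain t where t: "t \<in> T" "x = (1 / real n) * t" by auto
      then obtain z where "z \<in> \<int>" "t = real n * of_int k * z" using T(1) unfolding Nc by auto
      then show "x \<in> \<int>" using n t by simp
    qed
    ultimately show "\<exists>T :: int set. \<forall>j<n. \<forall>z. \<exists>!t. t \<in> T \<and> z - t \<in> A j" by (rule pieces_tiling[OF n])
  qed
  \<comment> \<open>No lattice of translates is given here, so the sets are glued along the rigid
    colouring.\<close>
  have 3: universal_tiling if S3
  proof (rule universal_tilingI)
    fix G n and A :: "nat \<Rightarrow> int set"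
    assume G: "finite G" "G \<noteq> {}" and n: "n > 0" and A: "\<And>j. j < n \<Longrightarrow> dual_set G (A j)"
    obtain \<phi> \<delta> where "rigid_coloring \<phi> n \<delta>" by (rule rigid_coloring_exists[OF n])
    then interpret rigid_coloring \<phi> n \<delta> .
    have b: "bounded (colored A)" by (rule colored_bounded) (use A dual_set_finite in blast)
    have "AE x in lebesgue_on {0..<1}. dual_set G (pat (colored A) x)"
      using A color_less by (intro AE_I2) (simp add: pat_colored)
    then have "spectral (colored A)"
      using dual_set_imp_spectrum(1)[OF b colored_measurable G] by (auto simp: spectral_def)
    then obtain T where T: "tiles_by (colored A) T" using \<open>S3\<close> b unfolding S3_def by blast
    have ne: "A j \<noteq> {}" if "j < n" for j
      using dual_set_card[OF A[OF that]] G by auto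
    show "\<exists>T :: int set. \<forall>j<n. \<forall>z. \<exists>!t. t \<in> T \<and> z - t \<in> A j"
      by (rule colored_tiling[OF n ne T])
  qed
  have "(S1 \<longleftrightarrow> S2) \<and> (S2 \<longleftrightarrow> S3)" using U1 U2 U3 1 2 3 by blast
  then show ?thesis unfolding Let_def S1_def S2_def S3_def .
qed

end
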